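(* Let $I$ be a nonempty increasing set in $(\Phi^+,\leq)$. (i) If there exists $v_0\in C$ with $(v_0\mid\beta)=1$ for all $\beta\in I_{\min}$ and $(v_0\mid\beta)<1$ for all $\beta\in I^c_{\max}$, then $R_{I\setminus\Lambda}\neq\emptyset$ for every $\Lambda\subseteq I_{\min}$. (ii) If there exists $v_0\in C$ with $(v_0\mid\beta)=1$ for all $\beta\in I^c_{\max}$ and $(v_0\mid\beta)>1$ for all $\beta\in I_{\min}$, then $R_{I\cup\Lambda}\neq\emptyset$ for every $\Lambda\subseteq I^c_{\max}$.
   Context: $V$ is a real Euclidean space of dimension $n$ with inner product $(\cdot\mid\cdot)$; $\Phi\subset V$ is a finite root system (not necessarily crystallographic, arbitrary root lengths) with simple roots $\alpha_1,\dots,\alpha_n$ and positive roots $\Phi^+$. Root order: $\beta\leq\gamma$ iff $\gamma-\beta$ is a nonnegative real combination of simple roots. An increasing set is $I\subseteq\Phi^+$ closed upward under $\leq$; $I^c=\Phi^+\setminus I$; $I_{\min}$ is the set of $\leq$-minimal elements of $I$ and $I^c_{\max}$ the set of $\leq$-maximal elements of $I^c$. $C=\{v\in V:(v\mid\alpha_i)>0\ \forall i\}$. For an increasing set $J$, $R_J=\{v\in C:(v\mid\beta)>1\ \forall\beta\in J,\ (v\mid\gamma)<1\ \forall\gamma\in J^c\}$. (For $\Lambda\subseteq I_{\min}$, $I\setminus\Lambda$ is increasing; for $\Lambda\subseteq I^c_{\max}$, $I\cup\Lambda$ is increasing.) *)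

theory Defs
  imports "HOL-Analysis.Analysis"
begin

definition reflection :: "'a::euclidean_space \<Rightarrow> 'a \<Rightarrow> 'a" where
  "reflection \<alpha> v = v - (2 * (v \<bullet> \<alpha>) / (\<alpha> \<bullet> \<alpha>)) *\<^sub>R \<alpha>"

text \<open>Neither integrality of the numbers 2(\<beta>|\<alpha>)/(\<alpha>|\<alpha>) nor any normalisation of root lengths is
  required. The roots span the ambient space, whose dimension is therefore the rank.\<close>

definition root_system :: "'a::euclidean_space set \<Rightarrow> bool" where
  "root_system \<Phi> \<longleftrightarrow>
     finite \<Phi> \<and> 0 \<notin> \<Phi> \<and> span \<Phi> = UNIV \<and>
     (\<forall>\<alpha>\<in>\<Phi>. reflection \<alpha> ` \<Phi> = \<Phi>) \<and>
     (\<forall>\<alpha>\<in>\<Phi>. \<Phi> \<inter> range (\<lambda>c. c *\<^sub>R \<alpha>) = {\<alpha>, - \<alpha>})"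

definition nonneg_comb :: "'a::euclidean_space set \<Rightarrow> 'a \<Rightarrow> bool" where
  "nonneg_comb \<Delta> v \<longleftrightarrow> (\<exists>c. (\<forall>\<alpha>\<in>\<Delta>. 0 \<le> c \<alpha>) \<and> v = (\<Sum>\<alpha>\<in>\<Delta>. c \<alpha> *\<^sub>R \<alpha>))"

definition simple_roots :: "'a::euclidean_space set \<Rightarrow> 'a set \<Rightarrow> bool" where
  "simple_roots \<Phi> \<Delta> \<longleftrightarrow>
     \<Delta> \<subseteq> \<Phi> \<and> independent \<Delta> \<and> span \<Delta> = UNIV \<and>
     (\<forall>\<beta>\<in>\<Phi>. nonneg_comb \<Delta> \<beta> \<or> nonneg_comb \<Delta> (- \<beta>))"

definition pos_roots :: "'a::euclidean_space set \<Rightarrow> 'a set \<Rightarrow> 'a set" where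
  "pos_roots \<Phi> \<Delta> = {\<beta> \<in> \<Phi>. nonneg_comb \<Delta> \<beta>}"

definition root_le :: "'a::euclidean_space set \<Rightarrow> 'a \<Rightarrow> 'a \<Rightarrow> bool" where
  "root_le \<Delta> \<beta> \<gamma> \<longleftrightarrow> nonneg_comb \<Delta> (\<gamma> - \<beta>)"

definition increasing_set :: "'a::euclidean_space set \<Rightarrow> 'a set \<Rightarrow> 'a set \<Rightarrow> bool" where
  "increasing_set \<Phi> \<Delta> I \<longleftrightarrow>
     I \<subseteq> pos_roots \<Phi> \<Delta> \<and>
     (\<forall>\<beta>\<in>I. \<forall>\<gamma>\<in>pos_roots \<Phi> \<Delta>. root_le \<Delta> \<beta> \<gamma> \<longrightarrow> \<gamma> \<in> I)"

definition minimal_roots :: "'a::euclidean_space set \<Rightarrow> 'a set \<Rightarrow> 'a set" where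
  "minimal_roots \<Delta> S = {\<beta> \<in> S. \<forall>\<gamma>\<in>S. root_le \<Delta> \<gamma> \<beta> \<longrightarrow> \<gamma> = \<beta>}"

definition maximal_roots :: "'a::euclidean_space set \<Rightarrow> 'a set \<Rightarrow> 'a set" where
  "maximal_roots \<Delta> S = {\<beta> \<in> S. \<forall>\<gamma>\<in>S. root_le \<Delta> \<beta> \<gamma> \<longrightarrow> \<gamma> = \<beta>}"

definition chamber :: "'a::euclidean_space set \<Rightarrow> 'a set" where
  "chamber \<Delta> = {v. \<forall>\<alpha>\<in>\<Delta>. v \<bullet> \<alpha> > 0}"

definition region :: "'a::euclidean_space set \<Rightarrow> 'a set \<Rightarrow> 'a set \<Rightarrow> 'a set" where
  "region \<Phi> \<Delta> J =
     {v \<in> chamber \<Delta>. (\<forall>\<beta>\<in>J. v \<bullet> \<beta> > 1) \<and> (\<forall>\<gamma>\<in>pos_roots \<Phi> \<Delta> - J. v \<bullet> \<gamma> < 1)}"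

end

theory Submission
  imports Defs
begin

text \<open>
  The point is that for a finite reduced root system and a regular vector \<open>v\<close> the roots \<open>\<beta>\<close> with
  \<open>(v|\<beta>) = 1\<close> are linearly independent; then \<open>v\<close> can be moved so that these values become larger
  or smaller than 1 independently of one another. In the crystallographic case the independence
  holds because such roots are pairwise obtuse, but in general it is a global statement. The proof
  is by contradiction and imitates the absence of Jordan blocks for a self-adjoint operator.

  Let \<open>Q\<close> be a minimal dependent set of such roots and restrict to the roots in its span \<open>U\<close>,
  replacing \<open>v\<close> by its projection \<open>\<lambda>\<close>. Since the coefficients of \<open>\<lambda>\<close> with respect to \<open>Q\<close> are not
  unique, a positive system can be chosen such that \<open>\<lambda>\<close> is a strictly positive combination of the
  positive representatives of \<open>Q\<close>, and is still a nonnegative one without either of two suitable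
  members. The function \<open>x \<mapsto> \<Sum>w. h(w) e^(w\<lambda>|x) \<eta>(w) \<otimes> \<eta>(w)\<close> on the Weyl chamber, with \<open>\<eta>(w)\<close> the
  weight vectors of the principal series of the graded Hecke algebra, satisfies symmetric boundary
  conditions for the Laplacian. At \<open>\<lambda>\<close> only square integrable terms survive, and so do the first
  order terms in a direction \<open>y\<close> with \<open>(\<lambda>|y) \<noteq> 0\<close>. The derivative along \<open>y\<close> is then a generalised
  eigenfunction, and Green's formula forces the square norm of the function to vanish. All the
  integrals are of exponentials over a simplicial cone, so that they are products of reciprocals
  of linear forms and Green's formula is a finite identity.
\<close>

section \<open>Reflections and positive systems\<close>

text \<open>The tensor square is there because of signs. The positive representatives of
  \<open>Q\<close> may take either of the values 1 and -1 on \<lambda>. A weight adapted to a single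
  \<eta>(w) has factors 1 + 1/(v|\<beta>) or 1 - 1/(v|\<beta>), which vanish at one sign only; for
  the tensor square the factors are 1 - 1/(v|\<beta>)^2 and vanish at both. The direction
  \<open>y\<close> is dictated by the growth of the derivative. A term with exactly one vanishing
  factor, from a root \<beta>, survives to first order, and its exponent is controlled by writing
  \<lambda> as a nonnegative combination of the representatives other than \<beta>. The relation in
  \<open>Q\<close> gives a one-parameter family of coefficients of \<lambda>; between two
  consecutive parameters at which coefficients vanish the signs are constant, and each endpoint lets
  one member be dropped. At the other members of \<open>Q\<close> the zero must persist along the
  line, so \<open>y\<close> is the component of \<lambda> orthogonal to them. It is nonzero because
  \<lambda> is not in their span, and (\<lambda>|y) = (y|y).\<close>

lemma reflection_self: "\<alpha> \<noteq> 0 \<Longrightarrow> reflection \<alpha> \<alpha> = - \<alpha>"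
  by (simp add: reflection_def scaleR_2)

lemma linear_reflection: "linear (reflection \<alpha>)"
  by (rule linearI)
    (simp_all add: reflection_def inner_add_left add_divide_distrib algebra_simps)

lemma reflection_reflection [simp]: "\<alpha> \<noteq> 0 \<Longrightarrow> reflection \<alpha> (reflection \<alpha> v) = v"
  by (simp add: reflection_def inner_diff_left)

lemma inner_reflection_left: "reflection \<alpha> v \<bullet> w = v \<bullet> reflection \<alpha> w"
  by (simp add: reflection_def inner_diff_left inner_diff_right inner_commute)

lemma inner_reflection_reflection:
  "\<alpha> \<noteq> 0 \<Longrightarrow> reflection \<alpha> v \<bullet> reflection \<alpha> w = v \<bullet> w"
  by (simp add: inner_reflection_left)

lemma reflection_uminus_left [simp]: "reflection (- \<alpha>) = reflection \<alpha>"
  by (rule ext) (simp add: reflection_def)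

lemma reflection_conj:
  assumes "\<alpha> \<noteq> 0"
  shows "reflection (reflection \<alpha> \<beta>) (reflection \<alpha> v) = reflection \<alpha> (reflection \<beta> v)"
proof -
  interpret linear "reflection \<alpha>" by (rule linear_reflection)
  show ?thesis
    unfolding reflection_def[of "reflection \<alpha> \<beta>"] reflection_def[of \<beta>]
    by (simp add: diff scale inner_reflection_reflection[OF assms])
qed

text \<open>The roots need not span the ambient space: the locale is later instantiated with the
  roots lying in the span of a minimal dependent set. The regular vector \<open>p\<close> fixes the
  positive system, and signs of \<open>u p \<bullet> \<beta>\<close> replace inversion sets and
  lengths throughout.\<close>

locale positive_system =
  fixes R :: "'a::euclidean_space set" and p :: 'a and D :: "'a set"
  assumes fin_R: "finite R"
    and zero_notin_R: "0 \<notin> R"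
    and reflection_in_R: "\<alpha> \<in> R \<Longrightarrow> \<beta> \<in> R \<Longrightarrow> reflection \<alpha> \<beta> \<in> R"
    and reduced: "\<beta> \<in> R \<Longrightarrow> c *\<^sub>R \<beta> \<in> R \<Longrightarrow> c = 1 \<or> c = - 1"
    and regular_p: "\<beta> \<in> R \<Longrightarrow> p \<bullet> \<beta> \<noteq> 0"
    and D_subset: "D \<subseteq> {\<beta> \<in> R. p \<bullet> \<beta> > 0}"
    and indep_D: "independent D"
    and nonneg_comb_D: "\<beta> \<in> R \<Longrightarrow> p \<bullet> \<beta> > 0 \<Longrightarrow> nonneg_comb D \<beta>"
begin

definition Pos :: "'a set" where "Pos = {\<beta> \<in> R. p \<bullet> \<beta> > 0}"

abbreviation coord :: "'a \<Rightarrow> 'a \<Rightarrow> real" where "coord \<alpha> v \<equiv> representation D v \<alpha>"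

text \<open>The number of letters is recorded because the exchange condition lowers it, which drives
  the strong induction behind \<open>W_induct\<close>. Words need not be reduced.\<close>

primrec words :: "nat \<Rightarrow> ('a \<Rightarrow> 'a) set" where
  "words 0 = {id}"
| "words (Suc k) = {reflection \<alpha> \<circ> u | \<alpha> u. \<alpha> \<in> D \<and> u \<in> words k}"

abbreviation word :: "nat \<Rightarrow> ('a \<Rightarrow> 'a) \<Rightarrow> bool" where "word k u \<equiv> u \<in> words k"

definition W :: "('a \<Rightarrow> 'a) set" where "W = {u. \<exists>k. word k u}"

lemma word_0: "word 0 id"
  by simp

lemma word_step: "word k u \<Longrightarrow> \<alpha> \<in> D \<Longrightarrow> word (Suc k) (reflection \<alpha> \<circ> u)"
  by auto

lemma word_induct [consumes 1, case_names word_0 word_Suc]: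
  assumes "word k u" "P 0 id"
    and "\<And>k u \<alpha>. word k u \<Longrightarrow> P k u \<Longrightarrow> \<alpha> \<in> D \<Longrightarrow> P (Suc k) (reflection \<alpha> \<circ> u)"
  shows "P k u"
  using assms(1) by (induction k arbitrary: u) (auto intro: assms(2,3) simp del: o_apply)

lemma word_cases [consumes 1, case_names word_0 word_Suc]:
  assumes "word k u"
  obtains "k = 0" "u = id" 
  | l w \<alpha> where "k = Suc l" "u = reflection \<alpha> \<circ> w" "word l w" "\<alpha> \<in> D"
  using assms by (cases k) auto

lemma fin_D: "finite D"
  using D_subset fin_R finite_subset by fastforce

lemma D_in_R: "\<alpha> \<in> D \<Longrightarrow> \<alpha> \<in> R" and D_in_Pos: "\<alpha> \<in> D \<Longrightarrow> \<alpha> \<in> Pos"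
  using D_subset by (auto simp: Pos_def)

lemma D_nonzero: "\<alpha> \<in> D \<Longrightarrow> \<alpha> \<noteq> 0" and R_nonzero: "\<beta> \<in> R \<Longrightarrow> \<beta> \<noteq> 0"
  using D_in_R zero_notin_R by auto

lemma fin_Pos: "finite Pos" and Pos_in_R: "\<beta> \<in> Pos \<Longrightarrow> \<beta> \<in> R"
  using fin_R by (auto simp: Pos_def)

lemma uminus_in_R: "\<beta> \<in> R \<Longrightarrow> - \<beta> \<in> R"
  using reflection_in_R[of \<beta> \<beta>] reflection_self R_nonzero by metis

lemma Pos_or_neg: "\<beta> \<in> R \<Longrightarrow> \<beta> \<in> Pos \<or> - \<beta> \<in> Pos"
  using regular_p uminus_in_R unfolding Pos_def by (auto simp: neq_iff)

lemma sum_D_in_span: "(\<Sum>\<alpha>\<in>D. c \<alpha> *\<^sub>R \<alpha>) \<in> span D"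
  by (intro span_sum span_scale span_base)

lemma coord_sum: 
  assumes "\<alpha> \<in> D" shows "coord \<alpha> (\<Sum>\<alpha>\<in>D. c \<alpha> *\<^sub>R \<alpha>) = c \<alpha>"
proof -
  have "coord \<alpha> (\<Sum>\<alpha>\<in>D. c \<alpha> *\<^sub>R \<alpha>) = (\<Sum>\<beta>\<in>D. coord \<alpha> (c \<beta> *\<^sub>R \<beta>))"
    using representation_sum[OF indep_D, of D "\<lambda>\<beta>. c \<beta> *\<^sub>R \<beta>"]
    by (simp add: span_scale span_base)
  also have "\<dots> = (\<Sum>\<beta>\<in>D. c \<beta> * (if \<alpha> = \<beta> then 1 else 0))"
    by (intro sum.cong refl)
      (simp add: representation_scale[OF indep_D] span_base representation_basis[OF indep_D])
  also have "\<dots> = c \<alpha>" using assms fin_D by (simp add: if_distrib cong: if_cong)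
  finally show ?thesis .
qed

lemma R_subset_span_D: "\<beta> \<in> R \<Longrightarrow> \<beta> \<in> span D"
proof -
  assume b: "\<beta> \<in> R"
  have *: "\<gamma> \<in> span D" if "\<gamma> \<in> Pos" for \<gamma>
    using nonneg_comb_D[of \<gamma>] that sum_D_in_span by (auto simp: Pos_def nonneg_comb_def)
  from Pos_or_neg[OF b] show ?thesis using * span_neg by force
qed

lemma span_R: "span R = span D"
  by (rule antisym)
    (use R_subset_span_D D_in_R span_minimal[of R "span D"] span_mono[of D R] in auto)

lemma coord_add: "v \<in> span D \<Longrightarrow> w \<in> span D \<Longrightarrow> coord \<alpha> (v + w) = coord \<alpha> v + coord \<alpha> w"
  by (simp add: representation_add[OF indep_D])

lemma coord_scale: "v \<in> span D \<Longrightarrow> coord \<alpha> (c *\<^sub>R v) = c * coord \<alpha> v"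
  by (simp add: representation_scale[OF indep_D])

lemma coord_lincomb:
  assumes "\<And>\<beta>. \<beta> \<in> B \<Longrightarrow> f \<beta> \<in> span D"
  shows "coord \<alpha> (\<Sum>\<beta>\<in>B. c \<beta> *\<^sub>R f \<beta>) = (\<Sum>\<beta>\<in>B. c \<beta> * coord \<alpha> (f \<beta>))"
  using representation_sum[OF indep_D, of B "\<lambda>\<beta>. c \<beta> *\<^sub>R f \<beta>"] assms
  by (simp add: coord_scale span_scale)

lemma coord_Pos: "\<beta> \<in> Pos \<Longrightarrow> \<alpha> \<in> D \<Longrightarrow> coord \<alpha> \<beta> \<ge> 0"
  using nonneg_comb_D[of \<beta>] by (auto simp: Pos_def nonneg_comb_def coord_sum)

lemma sum_coord: "v \<in> span D \<Longrightarrow> (\<Sum>\<alpha>\<in>D. coord \<alpha> v *\<^sub>R \<alpha>) = v"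
  using sum_representation_eq[OF indep_D, of v D] fin_D by auto

lemma coord_basis: "\<alpha> \<in> D \<Longrightarrow> \<beta> \<in> D \<Longrightarrow> coord \<alpha> \<beta> = (if \<alpha> = \<beta> then 1 else 0)"
  using representation_basis[OF indep_D, of \<beta>] by auto

lemma reflection_span: "v \<in> span D \<Longrightarrow> \<alpha> \<in> D \<Longrightarrow> reflection \<alpha> v \<in> span D"
  unfolding reflection_def by (intro span_diff span_scale) (auto intro: span_base)

lemma coord_reflection:
  assumes "v \<in> span D" "\<alpha> \<in> D" "\<beta> \<in> D" "\<beta> \<noteq> \<alpha>"
  shows "coord \<beta> (reflection \<alpha> v) = coord \<beta> v"
  using assms unfolding reflection_def
  by (simp add: representation_diff[OF indep_D] representation_scale[OF indep_D] span_scale span_base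
        representation_basis[OF indep_D])

text \<open>Only the \<alpha>-coordinate changes under the reflection. If the image were negative,
  every other coordinate of \<beta> would be both nonnegative and nonpositive, making \<beta> a
  multiple of \<alpha>, and reducedness would give \<beta> = \<alpha>.\<close>

lemma reflection_Pos:
  assumes "\<alpha> \<in> D" "\<beta> \<in> Pos" "\<beta> \<noteq> \<alpha>"
  shows "reflection \<alpha> \<beta> \<in> Pos"
proof (rule ccontr)
  assume "reflection \<alpha> \<beta> \<notin> Pos"
  moreover have r: "reflection \<alpha> \<beta> \<in> R" using assms reflection_in_R D_in_R Pos_in_R by blast
  ultimately have neg: "- reflection \<alpha> \<beta> \<in> Pos" using Pos_or_neg by blast
  have sp: "\<beta> \<in> span D" using assms Pos_in_R R_subset_span_D by blast
  have "coord \<gamma> \<beta> = 0" if "\<gamma> \<in> D" "\<gamma> \<noteq> \<alpha>" for \<gamma>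
    using coord_Pos[OF neg that(1)] coord_Pos[OF assms(2) that(1)] coord_reflection[OF sp assms(1) that]
      representation_neg[OF indep_D reflection_span[OF sp assms(1)]] by simp
  then have "(\<Sum>\<gamma>\<in>D. coord \<gamma> \<beta> *\<^sub>R \<gamma>) = (\<Sum>\<gamma>\<in>D. if \<gamma> = \<alpha> then coord \<alpha> \<beta> *\<^sub>R \<alpha> else 0)"
    by (intro sum.cong) auto
  then have b: "\<beta> = coord \<alpha> \<beta> *\<^sub>R \<alpha>" using sum_coord[OF sp] assms fin_D by simp
  then have "coord \<alpha> \<beta> = 1 \<or> coord \<alpha> \<beta> = -1"
    using reduced[of \<alpha> "coord \<alpha> \<beta>"] assms D_in_R Pos_in_R by metis
  moreover have "coord \<alpha> \<beta> \<ge> 0" using assms coord_Pos by blast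
  ultimately have "\<beta> = \<alpha>" using b by auto
  then show False using assms by simp
qed

section \<open>The reflection group: finiteness, exchange, free action on regular vectors\<close>

lemma word_linear: "word k u \<Longrightarrow> linear u"
  by (induction rule: word_induct) (blast intro: linear_compose linear_reflection linear_id)+

lemma word_inner: "word k u \<Longrightarrow> u x \<bullet> u y = x \<bullet> y"
  by (induction rule: word_induct) (auto simp: inner_reflection_reflection D_nonzero)

lemma word_R: "word k u \<Longrightarrow> \<beta> \<in> R \<Longrightarrow> u \<beta> \<in> R"
  by (induction rule: word_induct) (auto intro: reflection_in_R D_in_R)

lemma word_span: "word k u \<Longrightarrow> v \<in> span D \<Longrightarrow> u v \<in> span D"
  by (induction rule: word_induct) (auto intro: reflection_span)

lemma word_orthogonal: "word k u \<Longrightarrow> (\<And>\<alpha>. \<alpha> \<in> D \<Longrightarrow> v \<bullet> \<alpha> = 0) \<Longrightarrow> u v = v"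
  by (induction rule: word_induct) (auto simp: reflection_def)

lemma word_comp: "word k u \<Longrightarrow> word l v \<Longrightarrow> word (k + l) (u \<circ> v)"
proof (induction rule: word_induct)
  case (word_Suc k u \<alpha>)
  then show ?case using word_step[of "u \<circ> v" "k + l" \<alpha>] by (simp add: comp_assoc del: o_apply)
qed (simp del: id_apply o_apply)

lemma reflection_comp_self: "\<alpha> \<in> D \<Longrightarrow> reflection \<alpha> \<circ> reflection \<alpha> = id"
  using D_nonzero by (auto simp: fun_eq_iff)

lemma id_in_W: "id \<in> W"
  using word_0 unfolding W_def by blast

lemma reflection_comp_in_W: "\<alpha> \<in> D \<Longrightarrow> u \<in> W \<Longrightarrow> reflection \<alpha> \<circ> u \<in> W"
  using word_step unfolding W_def by blast

lemma reflection_comp_in_W_iff: "\<alpha> \<in> D \<Longrightarrow> reflection \<alpha> \<circ> u \<in> W \<longleftrightarrow> u \<in> W"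
  using reflection_comp_in_W[of \<alpha> u] reflection_comp_in_W[of \<alpha> "reflection \<alpha> \<circ> u"]
  by (auto simp: comp_assoc[symmetric] reflection_comp_self)

lemma comp_in_W: "u \<in> W \<Longrightarrow> v \<in> W \<Longrightarrow> u \<circ> v \<in> W"
  using word_comp unfolding W_def by blast

lemma W_linear: "u \<in> W \<Longrightarrow> linear u"
  and W_inner: "u \<in> W \<Longrightarrow> u x \<bullet> u y = x \<bullet> y"
  and W_R: "u \<in> W \<Longrightarrow> \<beta> \<in> R \<Longrightarrow> u \<beta> \<in> R"
  and W_span: "u \<in> W \<Longrightarrow> v \<in> span D \<Longrightarrow> u v \<in> span D"
  unfolding W_def using word_linear word_inner word_R word_span by blast+

lemma W_inverse: 
  assumes "u \<in> W" obtains u' where "u' \<in> W" "u' \<circ> u = id" "u \<circ> u' = id"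
proof -
  have "\<exists>u'. u' \<in> W \<and> u' \<circ> u = id \<and> u \<circ> u' = id" if "word k u" for k
    using that
  proof (induction rule: word_induct)
    case (word_Suc k u \<alpha>)
    then obtain u' where u': "u' \<in> W" "u' \<circ> u = id" "u \<circ> u' = id" by blast
    have "reflection \<alpha> \<in> W" using reflection_comp_in_W[OF word_Suc(2) id_in_W] by simp
    then have "u' \<circ> reflection \<alpha> \<in> W" using u' comp_in_W by blast
    moreover have "(u' \<circ> reflection \<alpha>) \<circ> (reflection \<alpha> \<circ> u) = id"
      using u'(2) D_nonzero[OF word_Suc(2)] by (auto simp: fun_eq_iff)
    moreover have "(reflection \<alpha> \<circ> u) \<circ> (u' \<circ> reflection \<alpha>) = id"
      using u'(3) D_nonzero[OF word_Suc(2)] by (auto simp: fun_eq_iff)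
    ultimately show ?case by blast
  qed (use id_in_W in \<open>auto simp del: id_apply\<close>)
  then show thesis using that assms unfolding W_def by blast
qed

lemma W_preimage_R:
  assumes "u \<in> W" "\<beta> \<in> R" obtains \<gamma> where "\<gamma> \<in> R" "u \<gamma> = \<beta>"
proof -
  obtain u' where "u' \<in> W" "u \<circ> u' = id" using W_inverse[OF assms(1)] by metis
  then show thesis using that[of "u' \<beta>"] W_R assms(2) by (auto simp: fun_eq_iff)
qed

text \<open>An element is determined by its action on the finite set \<open>R\<close>, because the
  orthogonal complement of \<open>span D\<close> is fixed pointwise.\<close>

lemma finite_W: "finite W"
proof (rule finite_imageD)
  have "(\<lambda>u. restrict u R) ` W \<subseteq> (R \<rightarrow>\<^sub>E R)" using W_R by auto
  then show "finite ((\<lambda>u. restrict u R) ` W)" by (rule finite_subset) (simp add: finite_PiE fin_R)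
  show "inj_on (\<lambda>u. restrict u R) W"
  proof (rule inj_onI, rule ext)
    fix u w v assume u: "u \<in> W" and w: "w \<in> W" and eq: "restrict u R = restrict w R"
    have "u \<beta> = w \<beta>" if "\<beta> \<in> D" for \<beta> using eq D_in_R[OF that] by (metis restrict_apply')
    then have sp: "u x = w x" if "x \<in> span D" for x
      using linear_eq_on_span[of u w D] W_linear u w that by blast
    obtain y z where y: "y \<in> span D" and z: "\<And>x. x \<in> span D \<Longrightarrow> orthogonal z x" and v: "v = y + z"
      using orthogonal_subspace_decomp_exists[of D v] by blast
    have "u z = z" "w z = z" using u w z word_orthogonal[of _ _ z] unfolding W_def
      by (auto simp: orthogonal_def span_base)
    then show "u v = w v" using sp[OF y] W_linear[OF u] W_linear[OF w] v by (simp add: linear_add)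
  qed
qed

text \<open>Exchange condition. If \<beta> is the letter applied last, it cancels; otherwise the
  reflection of \<beta> in that letter is again positive, and by conjugation the deletion can be
  carried out in the shorter word.\<close>

lemma word_exchange:
  assumes "word k u" "\<beta> \<in> Pos" "u p \<bullet> \<beta> < 0"
  shows "k > 0 \<and> word (k - 1) (reflection \<beta> \<circ> u)"
  using assms
proof (induction arbitrary: \<beta> rule: word_induct)
  case word_0
  then show ?case by (auto simp: Pos_def)
next
  case (word_Suc k u \<alpha>)
  show ?case
  proof (cases "\<beta> = \<alpha>")
    case True
    then show ?thesis using word_Suc
      by (simp add: comp_assoc[symmetric] reflection_comp_self del: o_apply)
  next
    case False
    let ?b = "reflection \<alpha> \<beta>"
    have "?b \<in> Pos" using reflection_Pos word_Suc False by blast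
    moreover have "u p \<bullet> ?b < 0" using word_Suc by (simp add: inner_reflection_left)
    ultimately have k: "k > 0" and wd: "word (k - 1) (reflection ?b \<circ> u)" using word_Suc.IH by blast+
    have "reflection \<alpha> \<circ> (reflection ?b \<circ> u) = reflection \<beta> \<circ> (reflection \<alpha> \<circ> u)"
    proof
      fix x
      have "reflection \<alpha> (reflection ?b (u x)) = reflection (reflection \<alpha> ?b) (reflection \<alpha> (u x))"
        by (simp only: reflection_conj[OF D_nonzero[OF word_Suc(2)]])
      then show "(reflection \<alpha> \<circ> (reflection ?b \<circ> u)) x = (reflection \<beta> \<circ> (reflection \<alpha> \<circ> u)) x"
        using D_nonzero[OF word_Suc(2)] by simp
    qed
    then show ?thesis using word_step[OF wd word_Suc(2)] k by (simp del: o_apply)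
  qed
qed

text \<open>Induction along steps that increase length, the only ones for which the recursion for
  \<open>eta\<close> keeps its normalisation. A step in the wrong direction never has to be taken:
  exchange then provides a shorter word for the same element.\<close>

lemma W_induct [consumes 1, case_names id step]:
  assumes "w \<in> W" and "P id"
    and step: "\<And>u \<alpha>. u \<in> W \<Longrightarrow> P u \<Longrightarrow> \<alpha> \<in> D \<Longrightarrow> u p \<bullet> \<alpha> > 0 \<Longrightarrow> P (reflection \<alpha> \<circ> u)"
  shows "P w"
proof -
  have "word k w \<Longrightarrow> P w" for k w
  proof (induction k arbitrary: w rule: less_induct)
    case (less k)
    from less.prems show ?case
    proof (cases rule: word_cases)
      case word_0 then show ?thesis using assms(2) by metis
    next
      case (word_Suc l u \<alpha>)
      have uW: "u \<in> W" using word_Suc unfolding W_def by blast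
      obtain \<gamma> where "\<gamma> \<in> R" "u \<gamma> = \<alpha>" using W_preimage_R[OF uW D_in_R] word_Suc by blast
      then have ne: "u p \<bullet> \<alpha> \<noteq> 0" using W_inner[OF uW, of p \<gamma>] regular_p by simp
      show ?thesis
      proof (cases "u p \<bullet> \<alpha> > 0")
        case True
        then show ?thesis using step[OF uW less.IH[of l u]] word_Suc by (metis lessI)
      next
        case False
        then have "l > 0" "word (l - 1) w" 
          using word_exchange[of u l \<alpha>] word_Suc D_in_Pos ne by auto
        then show ?thesis using less.IH[of "l - 1" w] word_Suc(1) by linarith
      qed
    qed
  qed
  then show ?thesis using assms(1) unfolding W_def by blast
qed

lemma W_descent:
  assumes "w \<in> W" "w \<noteq> id" obtains \<alpha> where "\<alpha> \<in> D" "w p \<bullet> \<alpha> < 0"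
proof -
  have "w \<noteq> id \<longrightarrow> (\<exists>\<alpha>\<in>D. w p \<bullet> \<alpha> < 0)" using assms(1)
  proof (induction rule: W_induct)
    case (step u \<alpha>)
    then show ?case 
      by (intro impI bexI[of _ \<alpha>]) (simp_all add: inner_reflection_left reflection_self D_nonzero)
  qed simp
  then show thesis using that assms by blast
qed

lemma W_regular: 
  assumes "w \<in> W" "\<beta> \<in> R" "\<And>\<gamma>. \<gamma> \<in> R \<Longrightarrow> v \<bullet> \<gamma> \<noteq> 0" shows "w v \<bullet> \<beta> \<noteq> 0"
proof -
  obtain \<gamma> where "\<gamma> \<in> R" "w \<gamma> = \<beta>" using W_preimage_R[OF assms(1,2)] by blast
  then show ?thesis using W_inner[OF assms(1), of v \<gamma>] assms(3) by simp
qed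

lemma Pos_inner_pos:
  assumes "\<beta> \<in> Pos" "\<And>\<alpha>. \<alpha> \<in> D \<Longrightarrow> q \<bullet> \<alpha> > 0" shows "q \<bullet> \<beta> > 0"
proof -
  have sp: "\<beta> \<in> span D" using assms Pos_in_R R_subset_span_D by blast
  have eq: "q \<bullet> \<beta> = (\<Sum>\<alpha>\<in>D. coord \<alpha> \<beta> * (q \<bullet> \<alpha>))"
    by (subst sum_coord[OF sp, symmetric]) (simp add: inner_sum_right)
  have nn: "\<forall>\<alpha>\<in>D. coord \<alpha> \<beta> * (q \<bullet> \<alpha>) \<ge> 0" using coord_Pos assms by (simp add: less_imp_le)
  moreover have "\<exists>\<alpha>\<in>D. coord \<alpha> \<beta> * (q \<bullet> \<alpha>) > 0"
  proof (rule ccontr)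
    assume "\<not> ?thesis"
    then have "\<forall>\<alpha>\<in>D. coord \<alpha> \<beta> = 0" using nn assms(2) coord_Pos[OF assms(1)]
      by (metis less_eq_real_def mult_pos_pos)
    then have "\<beta> = 0" using sum_coord[OF sp] by simp
    then show False using assms Pos_in_R R_nonzero by blast
  qed
  ultimately show ?thesis unfolding eq using fin_D by (auto intro!: sum_pos2)
qed

text \<open>Take the element of the orbit with the largest inner product with \<open>p\<close>;
  reflecting in a simple root of negative pairing would increase it further.\<close>

lemma W_to_chamber:
  assumes "\<And>\<gamma>. \<gamma> \<in> R \<Longrightarrow> v \<bullet> \<gamma> \<noteq> 0"
  obtains w where "w \<in> W" "\<And>\<alpha>. \<alpha> \<in> D \<Longrightarrow> w v \<bullet> \<alpha> > 0"
proof -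
  define m where "m = Max ((\<lambda>u. u v \<bullet> p) ` W)"
  have "m \<in> (\<lambda>u. u v \<bullet> p) ` W" unfolding m_def using finite_W id_in_W by (intro Max_in) auto
  then obtain w where w: "w \<in> W" and m: "m = w v \<bullet> p" by blast
  have mx: "u v \<bullet> p \<le> w v \<bullet> p" if "u \<in> W" for u
    unfolding m[symmetric] m_def using that finite_W by (intro Max_ge) auto
  have "w v \<bullet> \<alpha> > 0" if a: "\<alpha> \<in> D" for \<alpha>
  proof (rule ccontr)
    assume "\<not> ?thesis"
    then have neg: "w v \<bullet> \<alpha> < 0" using W_regular[OF w D_in_R[OF a] assms] by simp
    have pa: "\<alpha> \<bullet> p > 0" using D_in_Pos[OF a] by (simp add: Pos_def inner_commute)
    have "reflection \<alpha> (w v) \<bullet> p \<le> w v \<bullet> p" using mx[OF reflection_comp_in_W[OF a w]] by simp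
    then have "0 \<le> (2 * (w v \<bullet> \<alpha>) / (\<alpha> \<bullet> \<alpha>)) * (\<alpha> \<bullet> p)"
      unfolding reflection_def inner_diff_left inner_scaleR_left by linarith
    moreover have "2 * (w v \<bullet> \<alpha>) / (\<alpha> \<bullet> \<alpha>) < 0"
      using neg D_nonzero[OF a] by (simp add: divide_less_0_iff)
    ultimately show False using pa mult_neg_pos by fastforce
  qed
  then show thesis using that w by blast
qed

text \<open>Conjugate so that the fixed vector lies in the open chamber. A nontrivial element maps
  some negative root \<gamma> to a simple root; invariance of the inner product then gives the fixed
  vector a negative value at that simple root.\<close>

lemma W_stabilizer_trivial:
  assumes "z \<in> W" "z v = v" "\<And>\<gamma>. \<gamma> \<in> R \<Longrightarrow> v \<bullet> \<gamma> \<noteq> 0"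
  shows "z = id"
proof -
  obtain w where w: "w \<in> W" and ch: "\<And>\<alpha>. \<alpha> \<in> D \<Longrightarrow> w v \<bullet> \<alpha> > 0"
    using W_to_chamber[of v] assms(3) by blast
  obtain w' where w': "w' \<in> W" "w' \<circ> w = id" "w \<circ> w' = id" using W_inverse[OF w] .
  define z' where "z' = w \<circ> z \<circ> w'"
  have z': "z' \<in> W" unfolding z'_def using w w' assms comp_in_W by blast
  have fx: "z' (w v) = w v" unfolding z'_def using w'(2) assms(2) by (simp add: fun_eq_iff)
  have "z' = id"
  proof (rule ccontr)
    assume "z' \<noteq> id"
    then obtain \<alpha> where a: "\<alpha> \<in> D" "z' p \<bullet> \<alpha> < 0" using W_descent z' by blast
    obtain \<gamma> where g: "\<gamma> \<in> R" "z' \<gamma> = \<alpha>" using W_preimage_R[OF z' D_in_R[OF a(1)]] .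
    have "p \<bullet> \<gamma> < 0" using a g W_inner[OF z', of p \<gamma>] by simp
    then have "- \<gamma> \<in> Pos" using g uminus_in_R by (simp add: Pos_def)
    then have "w v \<bullet> (- \<gamma>) > 0" using Pos_inner_pos ch by blast
    then have "w v \<bullet> \<alpha> < 0" using W_inner[OF z', of "w v" \<gamma>] fx g by simp
    then show False using ch a by fastforce
  qed
  then have "w \<circ> z \<circ> w' = id" unfolding z'_def .
  then have "w' \<circ> (w \<circ> z \<circ> w') \<circ> w = w' \<circ> w" by simp
  then show ?thesis using w'(2) by (simp add: fun_eq_iff)
qed

lemma W_free:
  assumes "u \<in> W" "w \<in> W" "u v = w v" "\<And>\<gamma>. \<gamma> \<in> R \<Longrightarrow> v \<bullet> \<gamma> \<noteq> 0"
  shows "u = w"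
proof -
  obtain w' where w': "w' \<in> W" "w' \<circ> w = id" "w \<circ> w' = id" using W_inverse[OF assms(2)] .
  have "w' \<circ> u = id"
    by (rule W_stabilizer_trivial[of _ v]) (use assms w' comp_in_W in \<open>auto simp: fun_eq_iff\<close>)
  then have "w \<circ> (w' \<circ> u) = w" by simp
  then show ?thesis using w'(3) by (simp add: fun_eq_iff)
qed

end

section \<open>Weight vectors of the principal series\<close>

text \<open>
  The boundary terms of Green's formula on one wall for a rank one intertwiner, with
  \<open>P = \<langle>\<eta>, \<eta>'\<rangle>\<close>, \<open>Q = \<langle>s \<eta>, \<eta>'\<rangle>\<close> and \<open>a\<close>, \<open>b\<close> the two normal exponents.
\<close>

lemma four_term_identity:
  fixes a b P Q :: real
  assumes "a \<noteq> 0" "b \<noteq> 0"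
  shows "(1 - 1/a\<^sup>2) * (1 - 1/b\<^sup>2) * P\<^sup>2 * (a - b) + (1 - 1/b\<^sup>2) * (Q - P/a)\<^sup>2 * (- a - b)
    + (1 - 1/a\<^sup>2) * (Q - P/b)\<^sup>2 * (a + b) + (P - Q/a - Q/b + P/(a*b))\<^sup>2 * (- a + b) = 0"
proof -
  have "a^4*b^4*((1 - 1/a\<^sup>2) * (1 - 1/b\<^sup>2) * P\<^sup>2 * (a - b) + (1 - 1/b\<^sup>2) * (Q - P/a)\<^sup>2 * (- a - b)
    + (1 - 1/a\<^sup>2) * (Q - P/b)\<^sup>2 * (a + b) + (P - Q/a - Q/b + P/(a*b))\<^sup>2 * (- a + b))
    = (a^4-a^2) * (b^4-b^2)* P\<^sup>2 * (a - b) + (b^4-b^2) * (a^2*Q - a*P)\<^sup>2 * (- a - b)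
    + (a^4-a^2) * (b^2*Q - b*P)\<^sup>2 * (a + b) + (a*b*(a*b*P - b*Q - a*Q + P))\<^sup>2 * (- a + b)"
  proof -
    have e: "a^4*(1 - 1/a\<^sup>2) = a^4-a^2" "b^4*(1 - 1/b\<^sup>2) = b^4-b^2" "a^2*(Q - P/a) = a^2*Q - a*P"
      "b^2*(Q-P/b) = b^2*Q - b*P" "a^2*b^2*(P - Q/a - Q/b + P/(a*b)) = a*b*(a*b*P - b*Q - a*Q + P)"
      using assms by (auto simp: field_simps power2_eq_square power4_eq_xxxx)
    show ?thesis unfolding e[symmetric] by algebra
  qed
  also have "\<dots> = 0" by algebra
  finally show ?thesis using assms by simp
qed

context positive_system
begin

text \<open>
  The graded Hecke algebra with parameters \<open>2/(\<beta>|\<beta>)\<close> acts on functions on \<open>W\<close>: the group by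
  translation, and a vector \<open>\<xi>\<close> by the Bernstein relation, which is triangular with diagonal
  \<open>(\<xi>|u v)\<close>. Pairing the equation below with \<open>\<xi>\<close> says that \<open>f\<close> has weight \<open>w v\<close>.
\<close>

definition weight_vector :: "'a \<Rightarrow> ('a \<Rightarrow> 'a) \<Rightarrow> (('a \<Rightarrow> 'a) \<Rightarrow> real) \<Rightarrow> bool" where
  "weight_vector v w f \<longleftrightarrow> (\<forall>u. u \<notin> W \<longrightarrow> f u = 0) \<and>
     (\<forall>u\<in>W. f u *\<^sub>R (u v - w v)
        + (\<Sum>\<beta>\<in>{\<beta>\<in>Pos. u p \<bullet> \<beta> > 0}. (2 * f (reflection \<beta> \<circ> u) / (\<beta> \<bullet> \<beta>)) *\<^sub>R \<beta>) = 0)"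

lemma weight_vector_outside: "weight_vector v w f \<Longrightarrow> u \<notin> W \<Longrightarrow> f u = 0"
  unfolding weight_vector_def by blast

lemma weight_vectorD:
  "weight_vector v w f \<Longrightarrow> u \<in> W \<Longrightarrow> f u *\<^sub>R (u v - w v)
     + (\<Sum>\<beta>\<in>{\<beta>\<in>Pos. u p \<bullet> \<beta> > 0}. (2 * f (reflection \<beta> \<circ> u) / (\<beta> \<bullet> \<beta>)) *\<^sub>R \<beta>) = 0"
  unfolding weight_vector_def by blast

text \<open>The rank one intertwiner. Substituting by the reflection turns the equation at
  \<open>reflection \<alpha> \<circ> u\<close> into the one at \<open>u\<close>, up to a single
  multiple of \<alpha>, which the correction term cancels. The parameters 2/(\<beta>|\<beta>) make
  the denominator exactly \<open>w v \<bullet> \<alpha>\<close> whatever the root lengths, so that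
  inner product 1 is the critical value.\<close>

lemma weight_vector_step:
  assumes f: "weight_vector v w f" and a: "\<alpha> \<in> D" and ne: "w v \<bullet> \<alpha> \<noteq> 0"
  shows "weight_vector v (reflection \<alpha> \<circ> w) (\<lambda>u. f (reflection \<alpha> \<circ> u) - f u / (w v \<bullet> \<alpha>))"
  unfolding weight_vector_def
proof (intro conjI allI impI ballI)
  fix u assume "u \<notin> W"
  then show "f (reflection \<alpha> \<circ> u) - f u / (w v \<bullet> \<alpha>) = 0"
    using weight_vector_outside[OF f] reflection_comp_in_W_iff[OF a, of u] by simp
next
  fix u assume u: "u \<in> W"
  let ?s = "reflection \<alpha>"
  interpret s: linear ?s by (rule linear_reflection)
  note a0 = D_nonzero[OF a]
  have aux: "x + y = z" if "0 = x + (y - z)" for x y z :: 'a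
    using that by (simp add: algebra_simps)
  define T where "T = {\<beta>\<in>Pos. u p \<bullet> \<beta> > 0}"
  define T' where "T' = {\<beta>\<in>Pos. (?s \<circ> u) p \<bullet> \<beta> > 0}"
  define G where "G = (\<lambda>\<gamma>. (2 * f (?s \<circ> (reflection \<gamma> \<circ> u)) / (\<gamma> \<bullet> \<gamma>)) *\<^sub>R \<gamma>)"
  have finT: "finite T" unfolding T_def using fin_Pos by simp
  have inj: "inj_on ?s T'" using a0 by (metis inj_onI reflection_reflection)
  have ss: "?s (?s x) = x" for x using a0 by simp
  have pn: "u p \<bullet> \<alpha> \<noteq> 0" using W_regular[OF u D_in_R[OF a]] regular_p by blast
  have e1: "f (?s \<circ> u) *\<^sub>R (?s (u v) - w v)
      + (\<Sum>\<beta>\<in>T'. (2 * f (reflection \<beta> \<circ> (?s \<circ> u)) / (\<beta> \<bullet> \<beta>)) *\<^sub>R \<beta>) = 0"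
    using weight_vectorD[OF f reflection_comp_in_W[OF a u]] unfolding T'_def o_apply .
  have "0 = ?s (f (?s \<circ> u) *\<^sub>R (?s (u v) - w v)
      + (\<Sum>\<beta>\<in>T'. (2 * f (reflection \<beta> \<circ> (?s \<circ> u)) / (\<beta> \<bullet> \<beta>)) *\<^sub>R \<beta>))"
    unfolding e1 by (simp add: s.zero)
  also have "\<dots> = f (?s \<circ> u) *\<^sub>R (u v - ?s (w v))
      + (\<Sum>\<beta>\<in>T'. (2 * f (reflection \<beta> \<circ> (?s \<circ> u)) / (\<beta> \<bullet> \<beta>)) *\<^sub>R ?s \<beta>)"
    by (simp only: s.add s.scale s.diff s.sum ss)
  also have "(\<Sum>\<beta>\<in>T'. (2 * f (reflection \<beta> \<circ> (?s \<circ> u)) / (\<beta> \<bullet> \<beta>)) *\<^sub>R ?s \<beta>) = (\<Sum>\<beta>\<in>T'. G (?s \<beta>))"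
  proof (intro sum.cong refl)
    fix \<beta>
    have "reflection \<beta> \<circ> (?s \<circ> u) = ?s \<circ> (reflection (?s \<beta>) \<circ> u)"
    proof
      fix x
      show "(reflection \<beta> \<circ> (?s \<circ> u)) x = (?s \<circ> (reflection (?s \<beta>) \<circ> u)) x"
        using reflection_conj[OF a0, of "?s \<beta>" "u x"] ss by simp
    qed
    then show "(2 * f (reflection \<beta> \<circ> (?s \<circ> u)) / (\<beta> \<bullet> \<beta>)) *\<^sub>R ?s \<beta> = G (?s \<beta>)"
      unfolding G_def using inner_reflection_reflection[OF a0] by simp
  qed
  also have "\<dots> = (\<Sum>\<gamma>\<in>?s ` T'. G \<gamma>)" using sum.reindex[OF inj, of G] by simp
  \<comment> \<open>The reflected index set differs from \<open>T\<close> only by losing \<alpha> or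
    by gaining its negative, according to the sign of \<open>u p \<bullet> \<alpha>\<close>. Since
    \<open>G\<close> is odd on this pair, both cases subtract the same vector.\<close>
  also have "\<dots> = (\<Sum>\<gamma>\<in>T. G \<gamma>) - (2 * f u / (\<alpha> \<bullet> \<alpha>)) *\<^sub>R \<alpha>"
  proof -
    have im: "\<gamma> \<in> ?s ` T' \<longleftrightarrow> ?s \<gamma> \<in> Pos \<and> u p \<bullet> \<gamma> > 0" for \<gamma>
    proof -
      have "\<gamma> \<in> ?s ` T' \<longleftrightarrow> ?s \<gamma> \<in> T'" using ss by (metis image_iff)
      then show ?thesis unfolding T'_def by (simp add: inner_reflection_left ss)
    qed
    have sa: "?s \<alpha> = - \<alpha>" "?s (- \<alpha>) = \<alpha>" using reflection_self[OF a0] s.neg by auto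
    have na: "- \<alpha> \<notin> Pos" using D_in_Pos[OF a] by (auto simp: Pos_def)
    have mem: "?s \<gamma> \<in> Pos \<longleftrightarrow> \<gamma> \<in> Pos" if "\<gamma> \<noteq> \<alpha>" "\<gamma> \<noteq> - \<alpha>" for \<gamma>
    proof
      assume "\<gamma> \<in> Pos" then show "?s \<gamma> \<in> Pos" using reflection_Pos[OF a] that by blast
    next
      assume "?s \<gamma> \<in> Pos"
      moreover have "?s \<gamma> \<noteq> \<alpha>" using that sa ss by metis
      ultimately show "\<gamma> \<in> Pos" using reflection_Pos[OF a, of "?s \<gamma>"] ss by simp
    qed
    have Ga: "G \<alpha> = (2 * f u / (\<alpha> \<bullet> \<alpha>)) *\<^sub>R \<alpha>" "G (- \<alpha>) = - ((2 * f u / (\<alpha> \<bullet> \<alpha>)) *\<^sub>R \<alpha>)"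
      unfolding G_def using reflection_comp_self[OF a]
      by (simp_all add: comp_assoc[symmetric] del: o_apply)
    show ?thesis
    proof (cases "u p \<bullet> \<alpha> > 0")
      case True
      have "?s ` T' = T - {\<alpha>}"
      proof (rule set_eqI)
        fix \<gamma>
        show "\<gamma> \<in> ?s ` T' \<longleftrightarrow> \<gamma> \<in> T - {\<alpha>}"
        proof -
          consider "\<gamma> = \<alpha>" | "\<gamma> = - \<alpha>" | "\<gamma> \<noteq> \<alpha>" "\<gamma> \<noteq> - \<alpha>" by blast
          then show ?thesis
          proof cases
            case 1 then show ?thesis unfolding im T_def using sa na by simp
          next
            case 2 then show ?thesis unfolding im T_def using True na by simp
          next
            case 3 then show ?thesis unfolding im T_def using mem by simp
          qed
        qed
      qed
      moreover have "\<alpha> \<in> T" unfolding T_def using True D_in_Pos[OF a] by simp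
      ultimately show ?thesis using finT Ga by (simp add: sum_diff1)
    next
      case False
      then have neg: "u p \<bullet> \<alpha> < 0" using pn by simp
      have "?s ` T' = insert (- \<alpha>) T"
      proof (rule set_eqI)
        fix \<gamma>
        show "\<gamma> \<in> ?s ` T' \<longleftrightarrow> \<gamma> \<in> insert (- \<alpha>) T"
        proof -
          consider "\<gamma> = \<alpha>" | "\<gamma> = - \<alpha>" | "\<gamma> \<noteq> \<alpha>" "\<gamma> \<noteq> - \<alpha>" by blast
          then show ?thesis
          proof cases
            case 1
            moreover have "\<alpha> \<noteq> - \<alpha>" using na D_in_Pos[OF a] by metis
            ultimately show ?thesis unfolding im T_def using sa na neg by simp
          next
            case 2 then show ?thesis unfolding im T_def using sa neg D_in_Pos[OF a] by simp
          next
            case 3 then show ?thesis unfolding im T_def using mem by simp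
          qed
        qed
      qed
      moreover have "- \<alpha> \<notin> T" unfolding T_def using na by simp
      ultimately show ?thesis using finT Ga by simp
    qed
  qed
  finally have e2: "f (?s \<circ> u) *\<^sub>R (u v - ?s (w v)) + (\<Sum>\<gamma>\<in>T. G \<gamma>) = (2 * f u / (\<alpha> \<bullet> \<alpha>)) *\<^sub>R \<alpha>"
    by (rule aux)
  define b where "b = w v \<bullet> \<alpha>"
  define H where "H = (\<Sum>\<gamma>\<in>T. (2 * f (reflection \<gamma> \<circ> u) / (\<gamma> \<bullet> \<gamma>)) *\<^sub>R \<gamma>)"
  have e3: "H = - (f u *\<^sub>R (u v - w v))"
  proof -
    have "f u *\<^sub>R (u v - w v) + H = 0"
      unfolding H_def T_def by (rule weight_vectorD[OF f u])
    then show ?thesis by (rule eq_neg_iff_add_eq_0[THEN iffD2, OF trans[OF add.commute]])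
  qed
  have sw: "w v - ?s (w v) = (2 * b / (\<alpha> \<bullet> \<alpha>)) *\<^sub>R \<alpha>"
    unfolding reflection_def b_def by simp
  have "(\<Sum>\<beta>\<in>T. (2 * (f (?s \<circ> (reflection \<beta> \<circ> u)) - f (reflection \<beta> \<circ> u) / b) / (\<beta> \<bullet> \<beta>)) *\<^sub>R \<beta>)
      = (\<Sum>\<beta>\<in>T. G \<beta> - (1 / b) *\<^sub>R ((2 * f (reflection \<beta> \<circ> u) / (\<beta> \<bullet> \<beta>)) *\<^sub>R \<beta>))"
    unfolding G_def by (intro sum.cong refl) (simp add: algebra_simps diff_divide_distrib)
  also have "\<dots> = (\<Sum>\<beta>\<in>T. G \<beta>) - (1 / b) *\<^sub>R H"
    unfolding H_def by (simp only: sum_subtractf scaleR_sum_right)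
  finally have sm: "(\<Sum>\<beta>\<in>T. (2 * (f (?s \<circ> (reflection \<beta> \<circ> u)) - f (reflection \<beta> \<circ> u) / b) / (\<beta> \<bullet> \<beta>)) *\<^sub>R \<beta>)
      = (\<Sum>\<beta>\<in>T. G \<beta>) - (1 / b) *\<^sub>R H" .
  have "(f (?s \<circ> u) - f u / b) *\<^sub>R (u v - ?s (w v)) + ((\<Sum>\<beta>\<in>T. G \<beta>) - (1 / b) *\<^sub>R H)
      = (2 * f u / (\<alpha> \<bullet> \<alpha>)) *\<^sub>R \<alpha> - (f u / b) *\<^sub>R (u v - ?s (w v)) + (f u / b) *\<^sub>R (u v - w v)"
    unfolding e2[symmetric] e3 by (simp add: algebra_simps)
  also have "\<dots> = (2 * f u / (\<alpha> \<bullet> \<alpha>)) *\<^sub>R \<alpha> - (f u / b) *\<^sub>R (w v - ?s (w v))"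
    by (simp add: algebra_simps)
  also have "\<dots> = 0" unfolding sw using ne b_def by simp
  finally show "(f (?s \<circ> u) - f u / (w v \<bullet> \<alpha>)) *\<^sub>R (u v - (?s \<circ> w) v) +
         (\<Sum>\<beta>\<in>{\<beta>\<in>Pos. u p \<bullet> \<beta> > 0}. (2 * (f (?s \<circ> (reflection \<beta> \<circ> u)) - f (reflection \<beta> \<circ> u) / (w v \<bullet> \<alpha>)) / (\<beta> \<bullet> \<beta>)) *\<^sub>R \<beta>) = 0"
    unfolding T_def[symmetric] b_def[symmetric] sm by simp
qed

text \<open>The function \<open>u \<mapsto> (u p|p)\<close> replaces the length in triangularity arguments.\<close>

lemma reflection_lowers:
  assumes "\<beta> \<in> Pos" "u p \<bullet> \<beta> > 0"
  shows "(reflection \<beta> \<circ> u) p \<bullet> p < u p \<bullet> p"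
proof -
  have b: "\<beta> \<bullet> p > 0" using assms by (simp add: Pos_def inner_commute)
  have "\<beta> \<bullet> \<beta> > 0" using R_nonzero[OF Pos_in_R[OF assms(1)]] by simp
  then have "(2 * (u p \<bullet> \<beta>) / (\<beta> \<bullet> \<beta>)) * (\<beta> \<bullet> p) > 0" 
    using assms(2) b by (intro mult_pos_pos divide_pos_pos) auto
  then show ?thesis by (simp only: reflection_def o_apply inner_diff_left inner_scaleR_left diff_less_eq less_add_same_cancel1)
qed

text \<open>Triangularity. At a point of the support where (u p|p) is least, all reflection terms
  vanish by \<open>reflection_lowers\<close>, so the equation reads u v = w v, and freeness
  identifies the point with \<open>w\<close>.\<close>

lemma weight_vector_support:
  assumes f: "weight_vector v w f" and w: "w \<in> W" and reg: "\<And>\<gamma>. \<gamma> \<in> R \<Longrightarrow> v \<bullet> \<gamma> \<noteq> 0" and u: "f u \<noteq> 0"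
  shows "f w \<noteq> 0 \<and> w p \<bullet> p \<le> u p \<bullet> p"
proof -
  define X where "X = {u \<in> W. f u \<noteq> 0}"
  have uX: "u \<in> X" using weight_vector_outside[OF f] u unfolding X_def by blast
  have fX: "finite X" unfolding X_def using finite_W by simp
  define m where "m = Min ((\<lambda>u. u p \<bullet> p) ` X)"
  have "m \<in> (\<lambda>u. u p \<bullet> p) ` X" unfolding m_def using fX uX by (intro Min_in) auto
  then obtain x where x: "x \<in> X" and m: "m = x p \<bullet> p" by blast
  have mn: "x p \<bullet> p \<le> y p \<bullet> p" if "y \<in> X" for y
    unfolding m[symmetric] m_def using that fX by (intro Min_le) auto
  have "f (reflection \<beta> \<circ> x) = 0" if "\<beta> \<in> Pos" "x p \<bullet> \<beta> > 0" for \<beta>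
  proof (rule ccontr)
    assume nz: "f (reflection \<beta> \<circ> x) \<noteq> 0"
    then have "reflection \<beta> \<circ> x \<in> W" using weight_vector_outside[OF f] by blast
    then have "reflection \<beta> \<circ> x \<in> X" using nz unfolding X_def by blast
    then show False using mn[of "reflection \<beta> \<circ> x"] reflection_lowers[of \<beta> x, OF that] by linarith
  qed
  then have z: "(\<Sum>\<beta>\<in>{\<beta>\<in>Pos. x p \<bullet> \<beta> > 0}. (2 * f (reflection \<beta> \<circ> x) / (\<beta> \<bullet> \<beta>)) *\<^sub>R \<beta>) = 0"
    by (intro sum.neutral) simp
  have "x \<in> W" "f x \<noteq> 0" using x unfolding X_def by auto
  then have "f x *\<^sub>R (x v - w v) = 0" using weight_vectorD[OF f \<open>x \<in> W\<close>] unfolding z by simp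
  then have "x v = w v" using \<open>f x \<noteq> 0\<close> by simp
  then have "x = w" using W_free[OF \<open>x \<in> W\<close> w _ reg] by blast
  then show ?thesis using \<open>f x \<noteq> 0\<close> mn[OF uX] by simp
qed

lemma weight_vector_diff: 
  assumes f: "weight_vector v w f" and g: "weight_vector v w g" shows "weight_vector v w (\<lambda>u. f u - g u)"
  unfolding weight_vector_def
proof (intro conjI allI impI ballI)
  fix u assume "u \<notin> W" then show "f u - g u = 0" using weight_vector_outside[OF f] weight_vector_outside[OF g] by simp
next
  fix u assume u: "u \<in> W"
  let ?T = "{\<beta>\<in>Pos. u p \<bullet> \<beta> > 0}"
  have e: "f u *\<^sub>R (u v - w v) + (\<Sum>\<beta>\<in>?T. (2 * f (reflection \<beta> \<circ> u) / (\<beta> \<bullet> \<beta>)) *\<^sub>R \<beta>) = 0"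
    "g u *\<^sub>R (u v - w v) + (\<Sum>\<beta>\<in>?T. (2 * g (reflection \<beta> \<circ> u) / (\<beta> \<bullet> \<beta>)) *\<^sub>R \<beta>) = 0"
    by (rule weight_vectorD[OF f u], rule weight_vectorD[OF g u])
  have "(\<Sum>\<beta>\<in>?T. (2 * (f (reflection \<beta> \<circ> u) - g (reflection \<beta> \<circ> u)) / (\<beta> \<bullet> \<beta>)) *\<^sub>R \<beta>)
     = (\<Sum>\<beta>\<in>?T. (2 * f (reflection \<beta> \<circ> u) / (\<beta> \<bullet> \<beta>)) *\<^sub>R \<beta>)
       - (\<Sum>\<beta>\<in>?T. (2 * g (reflection \<beta> \<circ> u) / (\<beta> \<bullet> \<beta>)) *\<^sub>R \<beta>)"
    by (simp add: sum_subtractf[symmetric] algebra_simps diff_divide_distrib)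
  also have "\<dots> = - (f u *\<^sub>R (u v - w v)) + g u *\<^sub>R (u v - w v)"
    using e by (simp add: add_eq_0_iff)
  finally show "(f u - g u) *\<^sub>R (u v - w v) +
     (\<Sum>\<beta>\<in>?T. (2 * (f (reflection \<beta> \<circ> u) - g (reflection \<beta> \<circ> u)) / (\<beta> \<bullet> \<beta>)) *\<^sub>R \<beta>) = 0"
    by (simp add: algebra_simps)
qed

lemma weight_vector_unique:
  assumes "weight_vector v w f" "weight_vector v w g" "w \<in> W" "\<And>\<gamma>. \<gamma> \<in> R \<Longrightarrow> v \<bullet> \<gamma> \<noteq> 0" "f w = g w"
  shows "f = g"
proof (rule ccontr)
  assume "f \<noteq> g"
  then obtain u where "f u - g u \<noteq> 0" by (auto simp: fun_eq_iff)
  then show False using weight_vector_support[OF weight_vector_diff[OF assms(1,2)] assms(3,4)] assms(5) by auto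
qed

text \<open>The description is meaningful for regular \<open>v\<close> and \<open>w\<close> in
  \<open>W\<close>: existence comes from intertwiners applied along an increasing word, uniqueness
  from triangularity of the support.\<close>

definition eta :: "'a \<Rightarrow> ('a \<Rightarrow> 'a) \<Rightarrow> ('a \<Rightarrow> 'a) \<Rightarrow> real" where
  "eta v w = (THE f. weight_vector v w f \<and> f w = 1)"

text \<open>The reflection sum never meets the identity:
  \<open>reflection \<beta> \<circ> u = id\<close> would force u p = s p for the reflection s in
  \<beta>, hence \<open>u p \<bullet> \<beta>\<close> < 0.\<close>

lemma weight_vector_id: "weight_vector v id (\<lambda>u. if u = id then 1 else 0)"
  unfolding weight_vector_def
proof (intro conjI allI impI ballI)
  fix u :: "'a \<Rightarrow> 'a" assume "u \<notin> W"
  then show "(if u = id then 1 else 0) = (0::real)" using id_in_W by auto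
next
  fix u assume "u \<in> W"
  have "reflection \<beta> \<circ> u \<noteq> id" if "\<beta> \<in> Pos" "u p \<bullet> \<beta> > 0" for \<beta>
  proof
    have b0: "\<beta> \<noteq> 0" using that Pos_in_R R_nonzero by blast
    assume "reflection \<beta> \<circ> u = id"
    then have "reflection \<beta> (u p) = p" by (metis comp_apply id_apply)
    then have "u p = reflection \<beta> p" using b0 by (metis reflection_reflection)
    then have "u p \<bullet> \<beta> = - (p \<bullet> \<beta>)" using b0 by (simp add: inner_reflection_left reflection_self)
    then show False using that by (simp add: Pos_def)
  qed
  then have "(\<Sum>\<beta>\<in>{\<beta>\<in>Pos. u p \<bullet> \<beta> > 0}. (2 * (if reflection \<beta> \<circ> u = id then 1 else 0) / (\<beta> \<bullet> \<beta>)) *\<^sub>R \<beta>) = 0"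
    by (intro sum.neutral) (simp del: o_apply)
  then show "(if u = id then 1 else 0) *\<^sub>R (u v - id v) +
     (\<Sum>\<beta>\<in>{\<beta>\<in>Pos. u p \<bullet> \<beta> > 0}. (2 * (if reflection \<beta> \<circ> u = id then 1 else 0) / (\<beta> \<bullet> \<beta>)) *\<^sub>R \<beta>) = 0"
    by (simp del: o_apply)
qed

lemma eta_eqI:
  assumes "weight_vector v w f" "f w = 1" "w \<in> W" "\<And>\<gamma>. \<gamma> \<in> R \<Longrightarrow> v \<bullet> \<gamma> \<noteq> 0"
  shows "eta v w = f"
  unfolding eta_def
proof (rule the_equality)
  show "weight_vector v w f \<and> f w = 1" using assms by simp
  fix g assume "weight_vector v w g \<and> g w = 1"
  then show "g = f" using weight_vector_unique[of v w g f] assms by auto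
qed

text \<open>In an increasing step the new element is lower than \<open>w\<close> with respect to (u
  p|p), hence outside the support of \<open>f\<close>, and the correction term vanishes
  there.\<close>

lemma weight_vector_step_monic:
  assumes f: "weight_vector v w f" "f w = 1" and w: "w \<in> W" and a: "\<alpha> \<in> D" "w p \<bullet> \<alpha> > 0"
    and reg: "\<And>\<gamma>. \<gamma> \<in> R \<Longrightarrow> v \<bullet> \<gamma> \<noteq> 0"
  shows "f (reflection \<alpha> \<circ> (reflection \<alpha> \<circ> w)) - f (reflection \<alpha> \<circ> w) / (w v \<bullet> \<alpha>) = 1"
proof -
  have "f (reflection \<alpha> \<circ> w) = 0"
  proof (rule ccontr)
    assume "f (reflection \<alpha> \<circ> w) \<noteq> 0"
    then have "w p \<bullet> p \<le> (reflection \<alpha> \<circ> w) p \<bullet> p" using weight_vector_support[OF f(1) w reg] by blast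
    then show False using reflection_lowers[of \<alpha> w, OF D_in_Pos[OF a(1)] a(2)] by linarith
  qed
  then show ?thesis using f(2) by (simp add: comp_assoc[symmetric] reflection_comp_self[OF a(1)] del: o_apply)
qed

lemma monic_weight_vector:
  assumes "w \<in> W" and reg: "\<And>\<gamma>. \<gamma> \<in> R \<Longrightarrow> v \<bullet> \<gamma> \<noteq> 0"
  shows "weight_vector v w (eta v w) \<and> eta v w w = 1"
proof -
  have "\<exists>f. weight_vector v w f \<and> f w = 1" using assms(1)
  proof (induction rule: W_induct)
    case id
    show ?case by (intro exI conjI, rule weight_vector_id) simp
  next
    case (step u \<alpha>)
    then obtain f where f: "weight_vector v u f" "f u = 1" by blast
    have "u v \<bullet> \<alpha> \<noteq> 0" using W_regular[where v=v and w=u and \<beta>=\<alpha>, OF step.hyps(1) D_in_R[OF step.hyps(2)] reg] .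
    then show ?case
      by (intro exI conjI, rule weight_vector_step[where v=v and w=u and f=f and \<alpha>=\<alpha>, OF f(1) step.hyps(2)]) (rule weight_vector_step_monic[where v=v and w=u and f=f and \<alpha>=\<alpha>, OF f step.hyps reg])
  qed
  then obtain f where f: "weight_vector v w f" "f w = 1" by blast
  then have "eta v w = f" by (rule eta_eqI[OF _ _ assms(1) reg])
  then show ?thesis using f by (simp only: simp_thms)
qed

lemma eta_id:
  assumes "\<And>\<gamma>. \<gamma> \<in> R \<Longrightarrow> v \<bullet> \<gamma> \<noteq> 0"
  shows "eta v id = (\<lambda>u. if u = id then 1 else 0)"
  by (rule eta_eqI[where v=v and w=id, OF weight_vector_id _ id_in_W assms]) simp

lemma eta_reflection:
  assumes w: "w \<in> W" and a: "\<alpha> \<in> D" "w p \<bullet> \<alpha> > 0" and reg: "\<And>\<gamma>. \<gamma> \<in> R \<Longrightarrow> v \<bullet> \<gamma> \<noteq> 0"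
  shows "eta v (reflection \<alpha> \<circ> w) = (\<lambda>u. eta v w (reflection \<alpha> \<circ> u) - eta v w u / (w v \<bullet> \<alpha>))"
proof (rule eta_eqI)
  have e: "weight_vector v w (eta v w)" "eta v w w = 1" using monic_weight_vector[OF w reg] by auto
  have "w v \<bullet> \<alpha> \<noteq> 0" using W_regular[where v=v and w=w and \<beta>=\<alpha>, OF w D_in_R[OF a(1)] reg] .
  then show "weight_vector v (reflection \<alpha> \<circ> w) (\<lambda>u. eta v w (reflection \<alpha> \<circ> u) - eta v w u / (w v \<bullet> \<alpha>))"
    by (rule weight_vector_step[where v=v and w=w and f="eta v w" and \<alpha>=\<alpha>, OF e(1) a(1)])
  show "eta v w (reflection \<alpha> \<circ> (reflection \<alpha> \<circ> w)) - eta v w (reflection \<alpha> \<circ> w) / (w v \<bullet> \<alpha>) = 1"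
    by (rule weight_vector_step_monic[where v=v and w=w and f="eta v w" and \<alpha>=\<alpha>, OF e w a reg])
  show "reflection \<alpha> \<circ> w \<in> W" by (rule reflection_comp_in_W[OF a(1) w])
  show "v \<bullet> \<gamma> \<noteq> 0" if "\<gamma> \<in> R" for \<gamma> by (rule reg[OF that])
qed

text \<open>The weight h(w) of the wave function, a product of numerators of the c-function and
  their mirror images, since 1 - 1/a^2 = (1 - 1/a)(1 + 1/a). It runs over the positive roots that
  \<open>w\<close> keeps positive, so the longest element has weight 1 and zeros come from roots on
  which \<open>v\<close> is 1 or -1.\<close>

definition c_factor :: "'a \<Rightarrow> ('a \<Rightarrow> 'a) \<Rightarrow> real" where
  "c_factor v w = (\<Prod>\<beta>\<in>{\<beta>\<in>Pos. p \<bullet> w \<beta> > 0}. 1 - 1 / (v \<bullet> \<beta>)\<^sup>2)"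

text \<open>Composing with the simple reflection changes the sign of the image of exactly one
  positive root, the preimage of \<alpha> under \<open>w\<close>.\<close>

lemma c_factor_reflection:
  assumes w: "w \<in> W" and a: "\<alpha> \<in> D" "w p \<bullet> \<alpha> > 0"
  shows "c_factor v w = (1 - 1 / (w v \<bullet> \<alpha>)\<^sup>2) * c_factor v (reflection \<alpha> \<circ> w)"
proof -
  let ?s = "reflection \<alpha>"
  note a0 = D_nonzero[OF a(1)]
  interpret s: linear ?s by (rule linear_reflection)
  interpret w: linear w by (rule W_linear[OF w])
  obtain \<gamma> where g: "\<gamma> \<in> R" "w \<gamma> = \<alpha>" using W_preimage_R[OF w D_in_R[OF a(1)]] .
  have gP: "\<gamma> \<in> Pos" using g a W_inner[OF w, of p \<gamma>] by (simp add: Pos_def)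
  have pa: "p \<bullet> \<alpha> > 0" using D_in_Pos[OF a(1)] by (simp add: Pos_def)
  have inj: "w x = w y \<Longrightarrow> x = y" for x y
    using W_inverse[OF w] by (metis comp_apply id_apply)
  let ?N = "{\<beta>\<in>Pos. p \<bullet> (?s \<circ> w) \<beta> > 0}"
  have "{\<beta>\<in>Pos. p \<bullet> w \<beta> > 0} = insert \<gamma> ?N"
  proof (rule set_eqI)
    fix \<beta>
    show "\<beta> \<in> {\<beta>\<in>Pos. p \<bullet> w \<beta> > 0} \<longleftrightarrow> \<beta> \<in> insert \<gamma> ?N"
    proof (cases "\<beta> \<in> Pos \<and> \<beta> \<noteq> \<gamma>")
      case True
      then have bR: "w \<beta> \<in> R" using W_R[OF w] Pos_in_R by blast
      have n1: "w \<beta> \<noteq> \<alpha>" using inj g True by metis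
      have n2: "- w \<beta> \<noteq> \<alpha>"
      proof
        assume "- w \<beta> = \<alpha>"
        then have "w (- \<beta>) = w \<gamma>" using g w.neg by simp
        then have "- \<beta> = \<gamma>" using inj by blast
        then show False using True gP by (auto simp: Pos_def)
      qed
      show ?thesis
      proof (cases "w \<beta> \<in> Pos")
        case t: True
        then have "?s (w \<beta>) \<in> Pos" using reflection_Pos[OF a(1)] n1 by blast
        then show ?thesis using True t by (auto simp: Pos_def)
      next
        case False
        then have n: "- w \<beta> \<in> Pos" using Pos_or_neg[OF bR] by blast
        then have "?s (- w \<beta>) \<in> Pos" using reflection_Pos[OF a(1)] n2 by blast
        then show ?thesis using True n by (auto simp: Pos_def s.neg)
      qed
    qed (use gP g pa in auto)
  qed
  moreover have "\<gamma> \<notin> ?N" using g a0 pa by (simp add: reflection_self)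
  moreover have "w v \<bullet> \<alpha> = v \<bullet> \<gamma>" using W_inner[OF w, of v \<gamma>] g by simp
  ultimately show ?thesis unfolding c_factor_def using fin_Pos by simp
qed

section \<open>Boundary terms of Green's formula on one wall\<close>

definition eta_inner :: "'a \<Rightarrow> 'a \<Rightarrow> ('a \<Rightarrow> 'a) \<Rightarrow> ('a \<Rightarrow> 'a) \<Rightarrow> real" where
  "eta_inner v v' w w' = (\<Sum>u\<in>W. eta v w u * eta v' w' u)"

lemma sum_W_reflection:
  assumes "\<alpha> \<in> D" shows "(\<Sum>u\<in>W. F (reflection \<alpha> \<circ> u)) = (\<Sum>u\<in>W. F u)"
  by (rule sum.reindex_bij_witness[of _ "\<lambda>u. reflection \<alpha> \<circ> u" "\<lambda>u. reflection \<alpha> \<circ> u"])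
    (simp_all add: comp_assoc[symmetric] reflection_comp_self[OF assms] reflection_comp_in_W[OF assms] del: o_apply)

text \<open>Coefficient of the pair (w, w') in the wall integrand of Green's formula. The square is
  the inner product of two tensor squares, and the last factor is the difference of the normal
  derivatives of the two exponentials.\<close>

definition boundary_term :: "'a \<Rightarrow> 'a \<Rightarrow> 'a \<Rightarrow> ('a \<Rightarrow> 'a) \<Rightarrow> ('a \<Rightarrow> 'a) \<Rightarrow> real" where
  "boundary_term v v' \<alpha> w w' = c_factor v w * c_factor v' w' * (eta_inner v v' w w')\<^sup>2 * (w v \<bullet> \<alpha> - w' v' \<bullet> \<alpha>)"

text \<open>Write s for the action of the reflection on functions on \<open>W\<close>, an isometry.
  The two terms for w and s w together have a wall value V invariant under s tensor s, and the
  invariant part of their normal derivative is (s tensor 1) V. As s tensor 1 is self-adjoint, this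
  is a symmetric boundary condition; \<open>four_term_identity\<close> is its expression in
  scalars.\<close>

lemma boundary_term_four_pos:
  assumes w: "w \<in> W" "w' \<in> W" and a: "\<alpha> \<in> D" and ap: "w p \<bullet> \<alpha> > 0" "w' p \<bullet> \<alpha> > 0"
    and reg: "\<And>\<gamma>. \<gamma> \<in> R \<Longrightarrow> v \<bullet> \<gamma> \<noteq> 0" "\<And>\<gamma>. \<gamma> \<in> R \<Longrightarrow> v' \<bullet> \<gamma> \<noteq> 0"
  shows "boundary_term v v' \<alpha> w w' + boundary_term v v' \<alpha> (reflection \<alpha> \<circ> w) w'
    + boundary_term v v' \<alpha> w (reflection \<alpha> \<circ> w') + boundary_term v v' \<alpha> (reflection \<alpha> \<circ> w) (reflection \<alpha> \<circ> w') = 0"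
proof -
  let ?s = "reflection \<alpha>"
  note a0 = D_nonzero[OF a]
  define x where "x = w v \<bullet> \<alpha>"
  define y where "y = w' v' \<bullet> \<alpha>"
  have x0: "x \<noteq> 0" "y \<noteq> 0" unfolding x_def y_def
    using W_regular[OF w(1) D_in_R[OF a] reg(1)] W_regular[OF w(2) D_in_R[OF a] reg(2)] by blast+
  define P where "P = (\<Sum>u\<in>W. eta v w u * eta v' w' u)"
  define Q where "Q = (\<Sum>u\<in>W. eta v w (?s \<circ> u) * eta v' w' u)"
  have ss: "?s \<circ> (?s \<circ> u) = u" for u
    by (simp add: comp_assoc[symmetric] reflection_comp_self[OF a] del: o_apply)
  have P': "(\<Sum>u\<in>W. eta v w (?s \<circ> u) * eta v' w' (?s \<circ> u)) = P"
    unfolding P_def using sum_W_reflection[OF a, of "\<lambda>u. eta v w u * eta v' w' u"] .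
  have Q': "(\<Sum>u\<in>W. eta v w u * eta v' w' (?s \<circ> u)) = Q"
    unfolding Q_def using sum_W_reflection[OF a, of "\<lambda>u. eta v w (?s \<circ> u) * eta v' w' u"] unfolding ss .
  have er: "eta v (?s \<circ> w) u = eta v w (?s \<circ> u) - eta v w u / x"
    "eta v' (?s \<circ> w') u = eta v' w' (?s \<circ> u) - eta v' w' u / y" for u
    unfolding x_def y_def
    by (simp_all only: eta_reflection[OF w(1) a ap(1) reg(1)] eta_reflection[OF w(2) a ap(2) reg(2)])
  have g1: "eta_inner v v' w w' = P" unfolding eta_inner_def P_def ..
  have g2: "eta_inner v v' (?s \<circ> w) w' = Q - P / x"
    by (simp only: eta_inner_def er P_def Q_def left_diff_distrib sum_subtractf sum_divide_distrib times_divide_eq_left)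
  have g3: "eta_inner v v' w (?s \<circ> w') = Q - P / y"
    by (simp only: eta_inner_def er P_def Q'[symmetric] right_diff_distrib sum_subtractf sum_divide_distrib times_divide_eq_right)
  have "eta_inner v v' (?s \<circ> w) (?s \<circ> w') =
      (\<Sum>u\<in>W. eta v w (?s \<circ> u) * eta v' w' (?s \<circ> u) - eta v w u * eta v' w' (?s \<circ> u) / x
          - eta v w (?s \<circ> u) * eta v' w' u / y + eta v w u * eta v' w' u / (x * y))"
    unfolding eta_inner_def by (intro sum.cong refl) (simp only: er, simp add: algebra_simps del: o_apply)
  also have "\<dots> = P - Q / x - Q / y + P / (x * y)"
    by (simp only: sum.distrib sum_subtractf sum_divide_distrib[symmetric] P' Q')
      (simp only: P_def Q_def)
  finally have g4: "eta_inner v v' (?s \<circ> w) (?s \<circ> w') = P - Q / x - Q / y + P / (x * y)" .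
  have i: "(?s \<circ> w) v \<bullet> \<alpha> = - x" "(?s \<circ> w') v' \<bullet> \<alpha> = - y"
    unfolding x_def y_def by (simp_all add: inner_reflection_left reflection_self[OF a0])
  note h = c_factor_reflection[OF w(1) a ap(1), of v, folded x_def] c_factor_reflection[OF w(2) a ap(2), of v', folded y_def]
  let ?H = "c_factor v (?s \<circ> w) * c_factor v' (?s \<circ> w')"
  have "boundary_term v v' \<alpha> w w' + boundary_term v v' \<alpha> (?s \<circ> w) w' + boundary_term v v' \<alpha> w (?s \<circ> w') + boundary_term v v' \<alpha> (?s \<circ> w) (?s \<circ> w')
    = ?H * ((1 - 1/x\<^sup>2) * (1 - 1/y\<^sup>2) * P\<^sup>2 * (x - y) + (1 - 1/y\<^sup>2) * (Q - P/x)\<^sup>2 * (- x - y)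
    + (1 - 1/x\<^sup>2) * (Q - P/y)\<^sup>2 * (x + y) + (P - Q/x - Q/y + P/(x*y))\<^sup>2 * (- x + y))"
  proof -
    define h1 h2 where "h1 = c_factor v (?s \<circ> w)" and "h2 = c_factor v' (?s \<circ> w')"
    show ?thesis
      unfolding boundary_term_def g1 g2 g3 g4 i x_def[symmetric] y_def[symmetric] h h1_def[symmetric] h2_def[symmetric]
      by (simp only: distrib_left mult_ac diff_minus_eq_add)
  qed
  then show ?thesis using four_term_identity[OF x0] by simp
qed

text \<open>The sum is unchanged when \<open>w\<close> or \<open>w'\<close> is replaced by its
  reflected partner, so both may be chosen with increasing step.\<close>

lemma boundary_term_four:
  assumes w: "w \<in> W" "w' \<in> W" and a: "\<alpha> \<in> D"
    and reg: "\<And>\<gamma>. \<gamma> \<in> R \<Longrightarrow> v \<bullet> \<gamma> \<noteq> 0" "\<And>\<gamma>. \<gamma> \<in> R \<Longrightarrow> v' \<bullet> \<gamma> \<noteq> 0"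
  shows "boundary_term v v' \<alpha> w w' + boundary_term v v' \<alpha> (reflection \<alpha> \<circ> w) w'
    + boundary_term v v' \<alpha> w (reflection \<alpha> \<circ> w') + boundary_term v v' \<alpha> (reflection \<alpha> \<circ> w) (reflection \<alpha> \<circ> w') = 0"
proof -
  let ?s = "reflection \<alpha>"
  have ss: "?s \<circ> (?s \<circ> u) = u" for u
    by (simp add: comp_assoc[symmetric] reflection_comp_self[OF a] del: o_apply)
  have n: "u p \<bullet> \<alpha> \<noteq> 0" if "u \<in> W" for u
    using W_regular[OF that D_in_R[OF a]] regular_p by blast
  have sg: "(?s \<circ> u) p \<bullet> \<alpha> = - (u p \<bullet> \<alpha>)" for u
    by (simp add: inner_reflection_left reflection_self[OF D_nonzero[OF a]])
  define w1 where "w1 = (if w p \<bullet> \<alpha> > 0 then w else ?s \<circ> w)"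
  define w2 where "w2 = (if w' p \<bullet> \<alpha> > 0 then w' else ?s \<circ> w')"
  have "w1 \<in> W" "w2 \<in> W" unfolding w1_def w2_def using w reflection_comp_in_W[OF a] by auto
  moreover have "w1 p \<bullet> \<alpha> > 0" "w2 p \<bullet> \<alpha> > 0"
    using n[OF w(1)] n[OF w(2)] sg[of w] sg[of w'] unfolding w1_def w2_def by auto
  ultimately have "boundary_term v v' \<alpha> w1 w2 + boundary_term v v' \<alpha> (?s \<circ> w1) w2
    + boundary_term v v' \<alpha> w1 (?s \<circ> w2) + boundary_term v v' \<alpha> (?s \<circ> w1) (?s \<circ> w2) = 0"
    using boundary_term_four_pos[OF _ _ a _ _ reg] by blast
  then show ?thesis
    unfolding w1_def w2_def by (cases "w p \<bullet> \<alpha> > 0"; cases "w' p \<bullet> \<alpha> > 0") (simp_all only: ss if_True if_False ac_simps)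
qed

end

section \<open>Laplace kernels are positive definite\<close>

definition laplace_form :: "'w set \<Rightarrow> ('w \<Rightarrow> 'i \<Rightarrow> real) \<Rightarrow> 'i set \<Rightarrow> ('w \<Rightarrow> real) \<Rightarrow> real" where
  "laplace_form S x D b = (\<Sum>w\<in>S. \<Sum>w'\<in>S. b w * b w' * (\<Prod>\<alpha>\<in>D. 1 / (x w \<alpha> + x w' \<alpha>)))"

text \<open>
  The form is the square integral of \<open>t \<mapsto> \<Sum>w. b w e^(-x w t)\<close> over an orthant. Integrating out one
  coordinate at a time, \<open>G \<tau>\<close> below is the integral over the part where that coordinate is at least \<open>\<tau>\<close>.
\<close>

lemma laplace_form_aux:
  fixes x :: "'w \<Rightarrow> 'i \<Rightarrow> real"
  assumes fin: "finite D" and pos: "\<And>w \<alpha>. w \<in> S \<Longrightarrow> \<alpha> \<in> D \<Longrightarrow> x w \<alpha> > 0"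
  shows "0 \<le> laplace_form S x D b \<and>
    (laplace_form S x D b = 0 \<longrightarrow>
      (\<forall>t. (\<forall>\<alpha>\<in>D. t \<alpha> > 0) \<longrightarrow> (\<Sum>w\<in>S. b w * exp (- (\<Sum>\<alpha>\<in>D. x w \<alpha> * t \<alpha>))) = 0))"
  using fin pos
proof (induction D arbitrary: b rule: finite_induct)
  case empty
  have "laplace_form S x {} b = (\<Sum>w\<in>S. b w)\<^sup>2"
    unfolding laplace_form_def power2_eq_square by (simp add: sum_product)
  then show ?case by simp
next
  case (insert a D)
  define c where "c = (\<lambda>\<tau> w. b w * exp (- (x w a * \<tau>)))"
  define G where "G = (\<lambda>\<tau>. laplace_form S x (insert a D) (c \<tau>))"
  have xa: "x w a + x w' a > 0" if "w \<in> S" "w' \<in> S" for w w'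
    using insert.prems[of w a] insert.prems[of w' a] that by simp
  have G_eq: "G \<tau> = (\<Sum>w\<in>S. \<Sum>w'\<in>S. b w * b w' * (\<Prod>\<alpha>\<in>D. 1 / (x w \<alpha> + x w' \<alpha>))
      * exp (- ((x w a + x w' a) * \<tau>)) / (x w a + x w' a))" for \<tau>
    unfolding G_def laplace_form_def c_def using insert.hyps
    by (intro sum.cong refl) (simp add: algebra_simps mult_exp_exp)
  have IH: "0 \<le> laplace_form S x D b'" 
    "laplace_form S x D b' = 0 \<Longrightarrow> (\<And>\<alpha>. \<alpha> \<in> D \<Longrightarrow> t \<alpha> > 0) \<Longrightarrow> (\<Sum>w\<in>S. b' w * exp (- (\<Sum>\<alpha>\<in>D. x w \<alpha> * t \<alpha>))) = 0" for b' t
    using insert.IH[of b'] insert.prems by auto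
  have cancel: "P * (e * (- k)) / k = - (P * e)" if "k \<noteq> 0" for P e k :: real
    using that by simp
  have deriv: "(G has_real_derivative - laplace_form S x D (c \<tau>)) (at \<tau>)" for \<tau>
  proof -
    have "((\<lambda>\<tau>. \<Sum>w\<in>S. \<Sum>w'\<in>S. b w * b w' * (\<Prod>\<alpha>\<in>D. 1 / (x w \<alpha> + x w' \<alpha>))
      * exp (- ((x w a + x w' a) * \<tau>)) / (x w a + x w' a)) has_real_derivative
      (\<Sum>w\<in>S. \<Sum>w'\<in>S. - (c \<tau> w * c \<tau> w' * (\<Prod>\<alpha>\<in>D. 1 / (x w \<alpha> + x w' \<alpha>))))) (at \<tau>)"
    proof (intro DERIV_sum)
      fix w w' assume ww: "w \<in> S" "w' \<in> S"
      let ?P = "b w * b w' * (\<Prod>\<alpha>\<in>D. 1 / (x w \<alpha> + x w' \<alpha>))" and ?k = "x w a + x w' a"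
      have k: "?k \<noteq> 0" using xa[OF ww] by simp
      have "((\<lambda>\<tau>. ?P * exp (- (?k * \<tau>)) / ?k) has_real_derivative ?P * (exp (- (?k * \<tau>)) * (- ?k)) / ?k) (at \<tau>)"
        using k by (auto intro!: derivative_eq_intros)
      also have "?P * (exp (- (?k * \<tau>)) * (- ?k)) / ?k = - (?P * exp (- (?k * \<tau>)))"
        using k by (rule cancel)
      also have "\<dots> = - (c \<tau> w * c \<tau> w' * (\<Prod>\<alpha>\<in>D. 1 / (x w \<alpha> + x w' \<alpha>)))"
        unfolding c_def by (simp add: algebra_simps mult_exp_exp)
      finally show "((\<lambda>\<tau>. ?P * exp (- (?k * \<tau>)) / ?k) has_real_derivative
         - (c \<tau> w * c \<tau> w' * (\<Prod>\<alpha>\<in>D. 1 / (x w \<alpha> + x w' \<alpha>)))) (at \<tau>)" .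
    qed
    then show ?thesis unfolding laplace_form_def sum_negf G_eq[abs_def] by simp
  qed
  have anti: "G s \<le> G \<tau>" if "\<tau> \<le> s" for \<tau> s
  proof (rule DERIV_nonpos_imp_nonincreasing[OF that])
    fix r :: real
    show "\<exists>y. (G has_real_derivative y) (at r) \<and> y \<le> 0"
      using deriv[of r] IH(1)[of "c r"] by (intro exI[of _ "- laplace_form S x D (c r)"]) simp
  qed
  have lim: "(G \<longlongrightarrow> 0) at_top"
  proof -
    have "((\<lambda>\<tau>. \<Sum>w\<in>S. \<Sum>w'\<in>S. b w * b w' * (\<Prod>\<alpha>\<in>D. 1 / (x w \<alpha> + x w' \<alpha>))
      * exp (- ((x w a + x w' a) * \<tau>)) / (x w a + x w' a)) \<longlongrightarrow>
      (\<Sum>w\<in>S. \<Sum>w'\<in>S. b w * b w' * (\<Prod>\<alpha>\<in>D. 1 / (x w \<alpha> + x w' \<alpha>)) * 0 / (x w a + x w' a))) at_top"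
    proof (intro tendsto_sum)
      fix w w' assume ww: "w \<in> S" "w' \<in> S"
      let ?k = "x w a + x w' a"
      have "filterlim (\<lambda>\<tau>. ?k * \<tau>) at_top at_top"
        by (rule filterlim_tendsto_pos_mult_at_top[OF tendsto_const xa[OF ww] filterlim_ident])
      then have "((\<lambda>\<tau>. exp (- (?k * \<tau>))) \<longlongrightarrow> 0) at_top"
        by (intro filterlim_compose[OF exp_at_bot] filterlim_compose[OF filterlim_uminus_at_bot_at_top])
      then show "((\<lambda>\<tau>. b w * b w' * (\<Prod>\<alpha>\<in>D. 1 / (x w \<alpha> + x w' \<alpha>)) * exp (- (?k * \<tau>)) / ?k) \<longlongrightarrow>
         b w * b w' * (\<Prod>\<alpha>\<in>D. 1 / (x w \<alpha> + x w' \<alpha>)) * 0 / ?k) at_top"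
        using xa[OF ww] by (intro tendsto_intros) auto
    qed
    then show ?thesis unfolding G_eq[abs_def] by simp
  qed
  have nonneg: "0 \<le> G \<tau>" for \<tau>
    by (rule tendsto_upperbound[OF lim]) (auto intro: eventually_mono[OF eventually_ge_at_top[of \<tau>]] anti)
  have G0: "G 0 = laplace_form S x (insert a D) b" unfolding G_def c_def by simp
  have "(\<Sum>w\<in>S. b w * exp (- (\<Sum>\<alpha>\<in>insert a D. x w \<alpha> * t \<alpha>))) = 0"
    if z: "laplace_form S x (insert a D) b = 0" and t: "\<forall>\<alpha>\<in>insert a D. t \<alpha> > 0" for t
  proof -
    have ta: "t a > 0" using t by simp
    \<comment> \<open>A nonnegative decreasing function that vanishes at 0 vanishes from there on.
      Hence its derivative at \<open>t a\<close> is zero, and this derivative is minus the form in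
      one variable less for the coefficients \<open>c (t a)\<close>.\<close>
    have G0': "G \<tau> = 0" if "\<tau> \<ge> 0" for \<tau> using anti[OF that] nonneg[of \<tau>] z G0 by simp
    have "- laplace_form S x D (c (t a)) = 0"
    proof (rule DERIV_local_min[OF deriv ta], intro allI impI)
      fix y assume "\<bar>t a - y\<bar> < t a"
      then have "y \<ge> 0" by linarith
      then show "G (t a) \<le> G y" using G0' ta by simp
    qed
    then have "(\<Sum>w\<in>S. c (t a) w * exp (- (\<Sum>\<alpha>\<in>D. x w \<alpha> * t \<alpha>))) = 0"
      using IH(2)[of "c (t a)" t] t by simp
    then show ?thesis unfolding c_def using insert.hyps by (simp add: mult.assoc mult_exp_exp)
  qed
  then show ?case using nonneg[of 0] G0 by auto
qed

lemma laplace_form_nonneg: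
  assumes "finite D" "\<And>w \<alpha>. w \<in> S \<Longrightarrow> \<alpha> \<in> D \<Longrightarrow> x w \<alpha> > 0"
  shows "0 \<le> laplace_form S x D b"
  using laplace_form_aux[of D S x b, OF assms] by blast

text \<open>If the form were zero, a sum of exponentials would vanish on the open orthant. Shifting
  the coordinate \<open>i v\<close> by 1 and subtracting exp(- x v (i v)) times the unshifted sum
  kills the term of \<open>v\<close>; doing so for all \<open>v\<close> other than \<open>w0\<close>
  leaves a nonzero multiple of \<open>b w0\<close>.\<close>

lemma laplace_form_pos:
  assumes S: "finite S" and D: "finite D" and pos: "\<And>w \<alpha>. w \<in> S \<Longrightarrow> \<alpha> \<in> D \<Longrightarrow> x w \<alpha> > 0"
    and w0: "w0 \<in> S" "b w0 \<noteq> 0"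
    and sep: "\<And>v. v \<in> S \<Longrightarrow> v \<noteq> w0 \<Longrightarrow> \<exists>\<alpha>\<in>D. x v \<alpha> \<noteq> x w0 \<alpha>"
  shows "0 < laplace_form S x D b"
proof (rule ccontr)
  assume "\<not> ?thesis"
  then have "laplace_form S x D b = 0" using laplace_form_nonneg[of D S x b, OF D pos] by linarith
  then have base: "(\<Sum>w\<in>S. b w * exp (- (\<Sum>\<alpha>\<in>D. x w \<alpha> * t \<alpha>))) = 0" if "\<And>\<alpha>. \<alpha> \<in> D \<Longrightarrow> t \<alpha> > 0" for t
    using laplace_form_aux[of D S x b, OF D pos] that by blast
  obtain i where i: "\<And>v. v \<in> S - {w0} \<Longrightarrow> i v \<in> D \<and> x v (i v) \<noteq> x w0 (i v)"
  proof -
    have "\<forall>v\<in>S - {w0}. \<exists>\<alpha>. \<alpha> \<in> D \<and> x v \<alpha> \<noteq> x w0 \<alpha>" using sep by blast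
    then show thesis using that by (metis bchoice)
  qed
  let ?m = "\<lambda>V w. \<Prod>v\<in>V. (exp (- x w (i v)) - exp (- x v (i v)))"
  have key: "(\<Sum>w\<in>S. b w * exp (- (\<Sum>\<alpha>\<in>D. x w \<alpha> * t \<alpha>)) * ?m V w) = 0"
    if "finite V" "V \<subseteq> S - {w0}" "\<And>\<alpha>. \<alpha> \<in> D \<Longrightarrow> t \<alpha> > 0" for V t
    using that
  proof (induction V arbitrary: t rule: finite_induct)
    case empty
    then show ?case using base by simp
  next
    case (insert v V)
    let ?t = "t(i v := t (i v) + 1)"
    have iv: "i v \<in> D" using i insert by blast
    have "(\<Sum>\<alpha>\<in>D. x w \<alpha> * ?t \<alpha>) = (\<Sum>\<alpha>\<in>D. x w \<alpha> * t \<alpha>) + x w (i v)" for w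
      using D iv by (simp add: sum.remove[of D "i v"] algebra_simps)
    then have sh: "exp (- (\<Sum>\<alpha>\<in>D. x w \<alpha> * ?t \<alpha>)) = exp (- (\<Sum>\<alpha>\<in>D. x w \<alpha> * t \<alpha>)) * exp (- x w (i v))" for w
      by (simp only: minus_add_distrib exp_add)
    have "(\<Sum>w\<in>S. b w * exp (- (\<Sum>\<alpha>\<in>D. x w \<alpha> * ?t \<alpha>)) * ?m V w) = 0"
      using insert.prems by (intro insert.IH) (auto simp: add_pos_pos)
    moreover have "(\<Sum>w\<in>S. b w * exp (- (\<Sum>\<alpha>\<in>D. x w \<alpha> * t \<alpha>)) * ?m V w) = 0"
      using insert.prems by (intro insert.IH) auto
    moreover have "(\<Sum>w\<in>S. b w * exp (- (\<Sum>\<alpha>\<in>D. x w \<alpha> * t \<alpha>)) * ?m (insert v V) w)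
      = (\<Sum>w\<in>S. b w * exp (- (\<Sum>\<alpha>\<in>D. x w \<alpha> * ?t \<alpha>)) * ?m V w)
        - exp (- x v (i v)) * (\<Sum>w\<in>S. b w * exp (- (\<Sum>\<alpha>\<in>D. x w \<alpha> * t \<alpha>)) * ?m V w)"
      unfolding sh sum_distrib_left sum_subtractf[symmetric] using insert.hyps
      by (intro sum.cong refl) (simp add: right_diff_distrib left_diff_distrib mult_ac)
    ultimately show ?case by simp
  qed
  have "(\<Sum>w\<in>S. b w * exp (- (\<Sum>\<alpha>\<in>D. x w \<alpha> * 1)) * ?m (S - {w0}) w) = 0"
    using key[of "S - {w0}" "\<lambda>_. 1"] S by simp
  moreover have "?m (S - {w0}) w = 0" if "w \<in> S" "w \<noteq> w0" for w
    using that S by (intro prod_zero) auto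
  then have "(\<Sum>w\<in>S. b w * exp (- (\<Sum>\<alpha>\<in>D. x w \<alpha> * 1)) * ?m (S - {w0}) w)
     = b w0 * exp (- (\<Sum>\<alpha>\<in>D. x w0 \<alpha> * 1)) * ?m (S - {w0}) w0"
    using S w0(1) by (subst sum.remove[of _ w0]) (auto intro!: sum.neutral)
  moreover have "?m (S - {w0}) w0 \<noteq> 0"
    using S by (subst prod_zero_iff) (force dest: i[OF DiffI])+
  ultimately show False using w0(2) by simp
qed

section \<open>The energy of a wave function\<close>

context positive_system
begin

lemma c_factor_zero:
  assumes "\<beta> \<in> Pos" "p \<bullet> w \<beta> > 0" "\<bar>v \<bullet> \<beta>\<bar> = 1" shows "c_factor v w = 0"
proof -
  have "(v \<bullet> \<beta>)\<^sup>2 = 1" using assms(3) by (metis one_power2 power2_abs)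
  then show ?thesis unfolding c_factor_def using assms fin_Pos by (intro prod_zero) auto
qed

section \<open>Moving the spectral parameter along a line\<close>

definition line_at :: "'a \<Rightarrow> 'a \<Rightarrow> real \<Rightarrow> 'a" where "line_at l y e = l + e *\<^sub>R y"

context
  fixes l y :: 'a
  assumes reg: "\<And>\<gamma>. \<gamma> \<in> R \<Longrightarrow> l \<bullet> \<gamma> \<noteq> 0"
    and sp: "l \<in> span D" "y \<in> span D"
begin

abbreviation le :: "real \<Rightarrow> 'a" where "le \<equiv> line_at l y"

lemma le_inner: "((\<lambda>e. le e \<bullet> v) \<longlongrightarrow> l \<bullet> v) (at 0)"
proof -
  have "((\<lambda>e. l \<bullet> v + e * (y \<bullet> v)) \<longlongrightarrow> l \<bullet> v + 0 * (y \<bullet> v)) (at 0)" by (intro tendsto_intros)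
  then show ?thesis unfolding line_at_def by (simp add: inner_add_left)
qed

lemma W_le: "w \<in> W \<Longrightarrow> w (le e) = w l + e *\<^sub>R w y"
  unfolding line_at_def using W_linear[of w] by (simp add: linear_add linear_scale)

lemma W_le_inner: 
  assumes "w \<in> W" shows "((\<lambda>e. w (le e) \<bullet> v) \<longlongrightarrow> w l \<bullet> v) (at 0)"
proof -
  have "((\<lambda>e. w l \<bullet> v + e * (w y \<bullet> v)) \<longlongrightarrow> w l \<bullet> v + 0 * (w y \<bullet> v)) (at 0)" by (intro tendsto_intros)
  then show ?thesis by (simp add: W_le[OF assms] inner_add_left)
qed

lemma le_regular: "eventually (\<lambda>e. \<forall>\<gamma>\<in>R. le e \<bullet> \<gamma> \<noteq> 0) (at 0)"
  by (intro eventually_ball_finite[OF fin_R] ballI tendsto_imp_eventually_ne[OF le_inner] reg)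

text \<open>By the recursion along an increasing word, whose denominators stay away from zero
  because \<open>l\<close> is regular; nearby points of the line are regular too.\<close>

lemma eta_tendsto:
  assumes "w \<in> W" shows "((\<lambda>e. eta (le e) w u) \<longlongrightarrow> eta l w u) (at 0)"
  using assms
proof (induction arbitrary: u rule: W_induct)
  case id
  have "eventually (\<lambda>e. eta (le e) id u = eta l id u) (at 0)"
    using le_regular
  proof eventually_elim
    case (elim e)
    have "eta (le e) id = (\<lambda>u. if u = id then 1 else 0)" by (rule eta_id) (use elim in blast)
    moreover have "eta l id = (\<lambda>u. if u = id then 1 else 0)" by (rule eta_id[OF reg])
    ultimately show ?case by (simp only:)
  qed
  then show ?case by (rule tendsto_eventually)
next
  case (step w \<alpha>)
  let ?s = "reflection \<alpha>"
  have "w l \<bullet> \<alpha> \<noteq> 0"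
    using W_regular[where v=l and w=w and \<beta>=\<alpha>, OF step.hyps(1) D_in_R[OF step.hyps(2)] reg] .
  then have "((\<lambda>e. eta (le e) w (?s \<circ> u) - eta (le e) w u / (w (le e) \<bullet> \<alpha>)) \<longlongrightarrow>
     eta l w (?s \<circ> u) - eta l w u / (w l \<bullet> \<alpha>)) (at 0)"
    by (intro tendsto_diff tendsto_divide step.IH W_le_inner[OF step.hyps(1)])
  moreover have "eventually (\<lambda>e. eta (le e) w (?s \<circ> u) - eta (le e) w u / (w (le e) \<bullet> \<alpha>)
     = eta (le e) (?s \<circ> w) u) (at 0)"
    using le_regular
  proof eventually_elim
    case (elim e)
    have "eta (le e) (?s \<circ> w) = (\<lambda>u. eta (le e) w (?s \<circ> u) - eta (le e) w u / (w (le e) \<bullet> \<alpha>))"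
      by (rule eta_reflection[OF step.hyps]) (use elim in blast)
    then show ?case by (simp only:)
  qed
  moreover have "eta l (?s \<circ> w) = (\<lambda>u. eta l w (?s \<circ> u) - eta l w u / (w l \<bullet> \<alpha>))"
    by (rule eta_reflection[OF step.hyps reg])
  ultimately show ?case by (simp only: tendsto_cong)
qed

lemma c_factor_tendsto: "((\<lambda>e. c_factor (le e) w) \<longlongrightarrow> c_factor l w) (at 0)"
  unfolding c_factor_def
proof (intro tendsto_prod)
  fix \<beta> assume "\<beta> \<in> {\<beta>\<in>Pos. p \<bullet> w \<beta> > 0}"
  then have "l \<bullet> \<beta> \<noteq> 0" using reg Pos_in_R by blast
  then show "((\<lambda>e. 1 - 1 / (le e \<bullet> \<beta>)\<^sup>2) \<longlongrightarrow> 1 - 1 / (l \<bullet> \<beta>)\<^sup>2) (at 0)"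
    by (intro tendsto_diff tendsto_divide tendsto_power le_inner tendsto_const) simp
qed

lemma eta_inner_tendsto:
  assumes "w \<in> W" shows "((\<lambda>e. eta_inner (le e) l w w') \<longlongrightarrow> eta_inner l l w w') (at 0)"
  unfolding eta_inner_def by (intro tendsto_sum tendsto_mult eta_tendsto[OF assms] tendsto_const)

lemma c_factor_factor_limit:
  assumes b: "\<bar>l \<bullet> \<beta>\<bar> = 1"
  shows "\<exists>L. ((\<lambda>e. (1 - 1 / (le e \<bullet> \<beta>)\<^sup>2) / e) \<longlongrightarrow> L) (at 0)"
proof -
  define c where "c = y \<bullet> \<beta>"
  define d where "d = l \<bullet> \<beta>"
  have d2: "d\<^sup>2 = 1" using b unfolding d_def by (metis one_power2 power2_abs)
  then have d0: "d \<noteq> 0" by auto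
  have i: "le e \<bullet> \<beta> = d + e * c" for e unfolding line_at_def c_def d_def by (simp add: inner_add_left)
  \<comment> \<open>Since d^2 = 1, (d + e c)^2 - 1 = e (2 d c + e c^2), so the zero at e = 0 can be
    divided out explicitly.\<close>
  have "((\<lambda>e. (2 * d * c + e * c\<^sup>2) / (d + e * c)\<^sup>2) \<longlongrightarrow> (2 * d * c + 0 * c\<^sup>2) / (d + 0 * c)\<^sup>2) (at 0)"
    using d0 by (intro tendsto_intros) auto
  moreover have "eventually (\<lambda>e. (2 * d * c + e * c\<^sup>2) / (d + e * c)\<^sup>2 = (1 - 1 / (le e \<bullet> \<beta>)\<^sup>2) / e) (at 0)"
  proof -
    have "((\<lambda>e. d + e * c) \<longlongrightarrow> d + 0 * c) (at 0)" by (intro tendsto_intros)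
    then have "eventually (\<lambda>e. d + e * c \<noteq> 0) (at 0)"
      using d0 by (intro tendsto_imp_eventually_ne[of _ "d + 0 * c"]) auto
    moreover have "eventually (\<lambda>e::real. e \<noteq> 0) (at 0)" by (simp add: eventually_at_filter)
    ultimately show ?thesis
    proof eventually_elim
      case (elim e)
      have "(d + e * c)\<^sup>2 - 1 = e * (2 * d * c + e * c\<^sup>2)"
        using d2 by (simp add: power2_eq_square algebra_simps)
      moreover have "1 - 1 / (d + e * c)\<^sup>2 = ((d + e * c)\<^sup>2 - 1) / (d + e * c)\<^sup>2"
        using elim by (simp add: diff_divide_distrib)
      ultimately have "1 - 1 / (d + e * c)\<^sup>2 = e * (2 * d * c + e * c\<^sup>2) / (d + e * c)\<^sup>2"
        by (simp only:)
      then show ?case unfolding i using elim by simp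
    qed
  qed
  ultimately show ?thesis by (blast intro: Lim_transform_eventually)
qed

text \<open>Two factors vanish at e = 0: one absorbs the division by \<open>e\<close>, the other
  sends the remaining product to 0.\<close>

lemma c_factor_small:
  assumes b: "\<beta> \<in> Pos" "p \<bullet> w \<beta> > 0" "\<bar>l \<bullet> \<beta>\<bar> = 1"
    and c: "\<gamma> \<in> Pos" "p \<bullet> w \<gamma> > 0" "\<bar>l \<bullet> \<gamma>\<bar> = 1" and ne: "\<beta> \<noteq> \<gamma>"
  shows "((\<lambda>e. c_factor (le e) w / e) \<longlongrightarrow> 0) (at 0)"
proof -
  let ?N = "{\<beta>\<in>Pos. p \<bullet> w \<beta> > 0}"
  let ?f = "\<lambda>v \<beta>. 1 - 1 / (v \<bullet> \<beta>)\<^sup>2"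
  have N: "finite ?N" "\<beta> \<in> ?N" "\<gamma> \<in> ?N - {\<beta>}" using fin_Pos b c ne by auto
  obtain L where L: "((\<lambda>e. ?f (le e) \<beta> / e) \<longlongrightarrow> L) (at 0)" using c_factor_factor_limit[OF b(3)] by blast
  have nz: "l \<bullet> \<delta> \<noteq> 0" if "\<delta> \<in> Pos" for \<delta> using that reg Pos_in_R by blast
  have f_lim: "((\<lambda>e. ?f (le e) \<delta>) \<longlongrightarrow> ?f l \<delta>) (at 0)" if "\<delta> \<in> Pos" for \<delta>
    using nz[OF that] by (intro tendsto_diff tendsto_divide tendsto_power le_inner tendsto_const) simp
  have z: "(\<Prod>\<delta>\<in>?N - {\<beta>}. ?f l \<delta>) = 0"
  proof (rule prod_zero)
    have "(l \<bullet> \<gamma>)\<^sup>2 = 1" using c(3) by (metis one_power2 power2_abs)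
    then show "\<exists>a\<in>?N - {\<beta>}. ?f l a = 0" using N by (intro bexI[of _ \<gamma>]) simp
  qed (use N in simp)
  have "((\<lambda>e. \<Prod>\<delta>\<in>?N - {\<beta>}. ?f (le e) \<delta>) \<longlongrightarrow> (\<Prod>\<delta>\<in>?N - {\<beta>}. ?f l \<delta>)) (at 0)"
    by (intro tendsto_prod f_lim) auto
  from tendsto_mult[OF L this] have "((\<lambda>e. (?f (le e) \<beta> / e) * (\<Prod>\<delta>\<in>?N - {\<beta>}. ?f (le e) \<delta>)) \<longlongrightarrow> L * 0) (at 0)"
    unfolding z .
  moreover have eq: "c_factor (le e) w / e = (?f (le e) \<beta> / e) * (\<Prod>\<delta>\<in>?N - {\<beta>}. ?f (le e) \<delta>)" for e
    unfolding c_factor_def using prod.remove[OF N(1,2), of "?f (le e)"] by simp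
  ultimately show ?thesis unfolding eq by (simp only: mult_zero_right)
qed

lemma coord_W_le_tendsto:
  assumes "w \<in> W" "w' \<in> W"
  shows "((\<lambda>e. coord \<alpha> (w (le e) + w' l)) \<longlongrightarrow> coord \<alpha> (w l) + coord \<alpha> (w' l)) (at 0)"
proof -
  have "coord \<alpha> (w (le e) + w' l) = coord \<alpha> (w l) + e * coord \<alpha> (w y) + coord \<alpha> (w' l)" for e
    unfolding W_le[OF assms(1)] using W_span[OF assms(1)] W_span[OF assms(2)] sp
    by (simp add: coord_add coord_scale span_add span_scale)
  moreover have "((\<lambda>e. coord \<alpha> (w l) + e * coord \<alpha> (w y) + coord \<alpha> (w' l)) \<longlongrightarrow>
     coord \<alpha> (w l) + 0 * coord \<alpha> (w y) + coord \<alpha> (w' l)) (at 0)" by (intro tendsto_intros)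
  ultimately show ?thesis by simp
qed

end

text \<open>
  Up to a constant, \<open>laplace_kernel D v\<close> is the integral of \<open>e^(v|x)\<close> over the chamber, and
  \<open>laplace_kernel (D - {\<alpha>}) v\<close> the integral over the wall of \<open>\<alpha>\<close>.
\<close>

definition laplace_kernel :: "'a set \<Rightarrow> 'a \<Rightarrow> real" where "laplace_kernel D' v = (\<Prod>\<alpha>\<in>D'. 1 / - coord \<alpha> v)"

text \<open>Green's formula for the exponentials of \<open>v\<close> and \<open>v'\<close> on the
  chamber. The difference of eigenvalues is (v - v'|v + v'), and expanding v + v' in simple roots
  cancels one reciprocal factor per wall.\<close>

lemma norm_diff_laplace_kernel:
  assumes "v \<in> span D" "v' \<in> span D" "\<And>\<alpha>. \<alpha> \<in> D \<Longrightarrow> coord \<alpha> (v + v') \<noteq> 0"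
  shows "(v \<bullet> v - v' \<bullet> v') * laplace_kernel D (v + v') = - (\<Sum>\<alpha>\<in>D. (v \<bullet> \<alpha> - v' \<bullet> \<alpha>) * laplace_kernel (D - {\<alpha>}) (v + v'))"
proof -
  have "v \<bullet> v - v' \<bullet> v' = (v - v') \<bullet> (v + v')" by (simp add: inner_diff_left inner_add_right inner_commute[of v' v])
  also have "\<dots> = (v - v') \<bullet> (\<Sum>\<alpha>\<in>D. coord \<alpha> (v + v') *\<^sub>R \<alpha>)"
    using sum_coord[of "v + v'"] assms(1,2) by (simp add: span_add)
  also have "\<dots> = (\<Sum>\<alpha>\<in>D. coord \<alpha> (v + v') * (v \<bullet> \<alpha> - v' \<bullet> \<alpha>))"
    by (simp add: inner_sum_right inner_diff_left)
  finally have "(v \<bullet> v - v' \<bullet> v') * laplace_kernel D (v + v')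
     = (\<Sum>\<alpha>\<in>D. coord \<alpha> (v + v') * (v \<bullet> \<alpha> - v' \<bullet> \<alpha>) * laplace_kernel D (v + v'))"
    by (simp add: sum_distrib_right)
  also have "\<dots> = (\<Sum>\<alpha>\<in>D. - ((v \<bullet> \<alpha> - v' \<bullet> \<alpha>) * laplace_kernel (D - {\<alpha>}) (v + v')))"
  proof (intro sum.cong refl)
    fix \<alpha> assume a: "\<alpha> \<in> D"
    have "laplace_kernel D (v + v') = 1 / - coord \<alpha> (v + v') * laplace_kernel (D - {\<alpha>}) (v + v')"
      unfolding laplace_kernel_def by (rule prod.remove[OF fin_D a])
    then show "coord \<alpha> (v + v') * (v \<bullet> \<alpha> - v' \<bullet> \<alpha>) * laplace_kernel D (v + v') = - ((v \<bullet> \<alpha> - v' \<bullet> \<alpha>) * laplace_kernel (D - {\<alpha>}) (v + v'))"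
      using assms(3)[OF a] by simp
  qed
  finally show ?thesis by (simp add: sum_negf)
qed

text \<open>The reflection changes only the \<alpha>-coordinate, which the wall integral omits: the
  two exponentials agree on the wall.\<close>

lemma laplace_kernel_reflection:
  assumes "\<alpha> \<in> D" "v \<in> span D" "v' \<in> span D"
  shows "laplace_kernel (D - {\<alpha>}) (reflection \<alpha> v + v') = laplace_kernel (D - {\<alpha>}) (v + v')"
    and "laplace_kernel (D - {\<alpha>}) (v + reflection \<alpha> v') = laplace_kernel (D - {\<alpha>}) (v + v')"
  unfolding laplace_kernel_def using assms
  by (auto intro!: prod.cong simp: coord_add reflection_span coord_reflection)

lemma sum_reflection_pairs:
  fixes X :: "('a \<Rightarrow> 'a) set"
  assumes a: "\<alpha> \<in> D" and X: "\<And>w. w \<in> X \<Longrightarrow> reflection \<alpha> \<circ> w \<in> X"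
  shows "(\<Sum>w\<in>X. F (reflection \<alpha> \<circ> w)) = (\<Sum>w\<in>X. F w :: real)"
proof -
  have ss: "reflection \<alpha> \<circ> (reflection \<alpha> \<circ> u) = u" for u :: "'a \<Rightarrow> 'a"
    by (simp add: comp_assoc[symmetric] reflection_comp_self[OF a] del: o_apply)
  show ?thesis
    by (rule sum.reindex_bij_witness[of _ "\<lambda>u. reflection \<alpha> \<circ> u" "\<lambda>u. reflection \<alpha> \<circ> u"])
      (rule ss refl | erule X)+
qed

text \<open>Closure of both index sets under the reflection lets the double sum be averaged over the
  four pairs made of w or s w and w' or s w'. The wall kernel is common to the four, and
  \<open>boundary_term_four\<close> applies.\<close>

lemma boundary_sum_zero:
  assumes a: "\<alpha> \<in> D" and X: "X \<subseteq> W" "\<And>w. w \<in> X \<Longrightarrow> reflection \<alpha> \<circ> w \<in> X"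
    and Y: "Y \<subseteq> W" "\<And>w. w \<in> Y \<Longrightarrow> reflection \<alpha> \<circ> w \<in> Y"
    and reg: "\<And>\<gamma>. \<gamma> \<in> R \<Longrightarrow> v \<bullet> \<gamma> \<noteq> 0" "\<And>\<gamma>. \<gamma> \<in> R \<Longrightarrow> v' \<bullet> \<gamma> \<noteq> 0"
    and sp: "v \<in> span D" "v' \<in> span D"
  shows "(\<Sum>w\<in>X. \<Sum>w'\<in>Y. boundary_term v v' \<alpha> w w' * laplace_kernel (D - {\<alpha>}) (w v + w' v')) = 0"
proof -
  let ?s = "reflection \<alpha>"
  define F where "F = (\<lambda>w w'. boundary_term v v' \<alpha> w w' * laplace_kernel (D - {\<alpha>}) (w v + w' v'))"
  have four: "F w w' + F (?s \<circ> w) w' + F w (?s \<circ> w') + F (?s \<circ> w) (?s \<circ> w') = 0" if "w \<in> X" "w' \<in> Y" for w w'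
  proof -
    have W: "w \<in> W" "w' \<in> W" using that X Y by auto
    have s1: "w v \<in> span D" "w' v' \<in> span D" using W W_span sp by auto
    have k: "laplace_kernel (D - {\<alpha>}) ((?s \<circ> w) v + w' v') = laplace_kernel (D - {\<alpha>}) (w v + w' v')"
      "laplace_kernel (D - {\<alpha>}) (w v + (?s \<circ> w') v') = laplace_kernel (D - {\<alpha>}) (w v + w' v')"
      "laplace_kernel (D - {\<alpha>}) ((?s \<circ> w) v + (?s \<circ> w') v') = laplace_kernel (D - {\<alpha>}) (w v + w' v')"
      using laplace_kernel_reflection[OF a] s1 reflection_span[OF _ a] by simp_all
    show ?thesis unfolding F_def k distrib_right[symmetric] using boundary_term_four[OF W a reg] by simp
  qed
  have "4 * (\<Sum>w\<in>X. \<Sum>w'\<in>Y. F w w') = (\<Sum>w\<in>X. \<Sum>w'\<in>Y. F w w') + (\<Sum>w\<in>X. \<Sum>w'\<in>Y. F (?s \<circ> w) w')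
     + (\<Sum>w\<in>X. \<Sum>w'\<in>Y. F w (?s \<circ> w')) + (\<Sum>w\<in>X. \<Sum>w'\<in>Y. F (?s \<circ> w) (?s \<circ> w'))"
  proof -
    have "(\<Sum>w\<in>X. \<Sum>w'\<in>Y. F (?s \<circ> w) w') = (\<Sum>w\<in>X. \<Sum>w'\<in>Y. F w w')"
      by (rule sum_reflection_pairs[OF a X(2), of "\<lambda>w. \<Sum>w'\<in>Y. F w w'"])
    moreover have "(\<Sum>w'\<in>Y. F w (?s \<circ> w')) = (\<Sum>w'\<in>Y. F w w')" for w
      by (rule sum_reflection_pairs[OF a Y(2), of "\<lambda>w'. F w w'"])
    ultimately show ?thesis by (simp only:)
  qed
  also have "\<dots> = (\<Sum>w\<in>X. \<Sum>w'\<in>Y. F w w' + F (?s \<circ> w) w' + F w (?s \<circ> w') + F (?s \<circ> w) (?s \<circ> w'))"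
    by (simp only: sum.distrib)
  also have "\<dots> = 0" using four by (intro sum.neutral ballI) blast
  finally show ?thesis unfolding F_def by simp
qed

section \<open>Positivity of the square norm\<close>

lemma laplace_kernel_form:
  assumes fin: "finite S" and pos: "\<And>w \<alpha>. w \<in> S \<Longrightarrow> \<alpha> \<in> D \<Longrightarrow> coord \<alpha> (w l) < 0" and S: "S \<subseteq> W"
    and sp: "l \<in> span D"
  shows "(\<Sum>w\<in>S. \<Sum>w'\<in>S. b w * b w' * laplace_kernel D (w l + w' l)) = laplace_form S (\<lambda>w \<alpha>. - coord \<alpha> (w l)) D b"
  unfolding laplace_form_def laplace_kernel_def
proof (intro sum.cong refl arg_cong2[of _ _ _ _ times] prod.cong)
  fix w w' \<alpha> assume "w \<in> S" "w' \<in> S"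
  then have "w l \<in> span D" "w' l \<in> span D" using S W_span sp by auto
  then show "1 / - coord \<alpha> (w l + w' l) = 1 / (- coord \<alpha> (w l) + - coord \<alpha> (w' l))"
    by (simp add: coord_add)
qed

text \<open>Expanding the squared inner product over pairs (u, u') splits the energy into Laplace
  forms, one for each component of the tensor square. The component (z, z) has a nonzero coefficient
  at \<open>z\<close> because \<open>eta l z z = 1\<close>, and the exponents w l are distinct by
  freeness, so this form is strictly positive.\<close>

lemma energy_pos:
  assumes S: "S \<subseteq> W" and neg: "\<And>w \<alpha>. w \<in> S \<Longrightarrow> \<alpha> \<in> D \<Longrightarrow> coord \<alpha> (w l) < 0"
    and sp: "l \<in> span D" and reg: "\<And>\<gamma>. \<gamma> \<in> R \<Longrightarrow> l \<bullet> \<gamma> \<noteq> 0"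
    and z: "z \<in> S" "c_factor l z \<noteq> 0"
  shows "0 < (\<Sum>w\<in>S. \<Sum>w'\<in>S. c_factor l w * c_factor l w' * (eta_inner l l w w')\<^sup>2 * laplace_kernel D (w l + w' l))"
proof -
  have fS: "finite S" using S finite_W finite_subset by blast
  define b where "b = (\<lambda>u u' w. c_factor l w * eta l w u * eta l w u')"
  define x where "x = (\<lambda>w \<alpha>. - coord \<alpha> (w l))"
  have xp: "x w \<alpha> > 0" if "w \<in> S" "\<alpha> \<in> D" for w \<alpha> unfolding x_def using neg that by simp
  have "(\<Sum>w\<in>S. \<Sum>w'\<in>S. c_factor l w * c_factor l w' * (eta_inner l l w w')\<^sup>2 * laplace_kernel D (w l + w' l))
    = (\<Sum>w\<in>S. \<Sum>w'\<in>S. \<Sum>u\<in>W. \<Sum>u'\<in>W. b u u' w * b u u' w' * laplace_kernel D (w l + w' l))"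
  proof (intro sum.cong refl)
    fix w w'
    have "(eta_inner l l w w')\<^sup>2 = (\<Sum>u\<in>W. \<Sum>u'\<in>W. (eta l w u * eta l w' u) * (eta l w u' * eta l w' u'))"
      unfolding eta_inner_def power2_eq_square by (rule sum_product)
    then have "c_factor l w * c_factor l w' * (eta_inner l l w w')\<^sup>2 * laplace_kernel D (w l + w' l)
      = (\<Sum>u\<in>W. \<Sum>u'\<in>W. c_factor l w * c_factor l w' * ((eta l w u * eta l w' u) * (eta l w u' * eta l w' u')) * laplace_kernel D (w l + w' l))"
      by (simp only: sum_distrib_left sum_distrib_right)
    also have "\<dots> = (\<Sum>u\<in>W. \<Sum>u'\<in>W. b u u' w * b u u' w' * laplace_kernel D (w l + w' l))"
      unfolding b_def by (intro sum.cong refl) (simp only: mult_ac)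
    finally show "c_factor l w * c_factor l w' * (eta_inner l l w w')\<^sup>2 * laplace_kernel D (w l + w' l)
      = (\<Sum>u\<in>W. \<Sum>u'\<in>W. b u u' w * b u u' w' * laplace_kernel D (w l + w' l))" .
  qed
  also have "\<dots> = (\<Sum>u\<in>W. \<Sum>u'\<in>W. \<Sum>w\<in>S. \<Sum>w'\<in>S. b u u' w * b u u' w' * laplace_kernel D (w l + w' l))"
  proof -
    have swap3: "(\<Sum>w\<in>S. \<Sum>w'\<in>S. \<Sum>u\<in>W. g w w' u) = (\<Sum>u\<in>W. \<Sum>w\<in>S. \<Sum>w'\<in>S. g w w' u)"
      for g :: "('a \<Rightarrow> 'a) \<Rightarrow> ('a \<Rightarrow> 'a) \<Rightarrow> ('a \<Rightarrow> 'a) \<Rightarrow> real"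
    proof -
      have "(\<Sum>w\<in>S. \<Sum>w'\<in>S. \<Sum>u\<in>W. g w w' u) = (\<Sum>w\<in>S. \<Sum>u\<in>W. \<Sum>w'\<in>S. g w w' u)"
        by (intro sum.cong refl sum.swap)
      also have "\<dots> = (\<Sum>u\<in>W. \<Sum>w\<in>S. \<Sum>w'\<in>S. g w w' u)" by (rule sum.swap)
      finally show ?thesis .
    qed
    show ?thesis by (subst swap3) (intro sum.cong refl swap3)
  qed
  also have "\<dots> = (\<Sum>u\<in>W. \<Sum>u'\<in>W. laplace_form S x D (b u u'))"
    unfolding x_def by (intro sum.cong refl laplace_kernel_form[OF fS _ S sp]) (use neg in auto)
  also have "\<dots> > 0"
  proof -
    have zW: "z \<in> W" using z S by blast
    have nn: "0 \<le> laplace_form S x D (b u u')" for u u'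
      by (rule laplace_form_nonneg[OF fin_D xp])
    have "eta l z z = 1" using monic_weight_vector[OF zW reg] by blast
    then have bz: "b z z z \<noteq> 0" unfolding b_def using z by simp
    have "\<exists>\<alpha>\<in>D. x v \<alpha> \<noteq> x z \<alpha>" if "v \<in> S" "v \<noteq> z" for v
    proof (rule ccontr)
      have vW: "v \<in> W" using that S by blast
      assume "\<not> ?thesis"
      then have "coord \<alpha> (v l) = coord \<alpha> (z l)" if "\<alpha> \<in> D" for \<alpha> using that unfolding x_def by auto
      then have "(\<Sum>\<alpha>\<in>D. coord \<alpha> (v l) *\<^sub>R \<alpha>) = (\<Sum>\<alpha>\<in>D. coord \<alpha> (z l) *\<^sub>R \<alpha>)" by simp
      then have "v l = z l" using sum_coord W_span[OF vW sp] W_span[OF zW sp] by simp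
      then show False using W_free[OF vW zW _ reg] that by blast
    qed
    then have "0 < laplace_form S x D (b z z)"
      by (intro laplace_form_pos[of S D x z "b z z", OF fS fin_D xp z(1) bz])
    then have "0 < (\<Sum>u'\<in>W. laplace_form S x D (b z u'))"
      using nn zW by (intro sum_pos2[OF finite_W zW]) auto
    then show ?thesis
      by (rule sum_pos2[OF finite_W zW, where f = "\<lambda>u. \<Sum>u'\<in>W. laplace_form S x D (b u u')"])
        (intro sum_nonneg nn)
  qed
  finally show ?thesis .
qed

text \<open>The element that carries -p into the chamber.\<close>

lemma longest_exists: obtains z where "z \<in> W" "\<And>\<beta>. \<beta> \<in> Pos \<Longrightarrow> p \<bullet> z \<beta> < 0"
proof -
  have r: "- p \<bullet> \<gamma> \<noteq> 0" if "\<gamma> \<in> R" for \<gamma> using regular_p[OF that] by simp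
  obtain z where z: "z \<in> W" "\<And>\<alpha>. \<alpha> \<in> D \<Longrightarrow> z (- p) \<bullet> \<alpha> > 0" using W_to_chamber[of "- p"] r by blast
  have "p \<bullet> z \<beta> < 0" if b: "\<beta> \<in> Pos" for \<beta>
  proof (rule ccontr)
    assume "\<not> ?thesis"
    moreover have zR: "z \<beta> \<in> R" using W_R[OF z(1)] Pos_in_R[OF b] by blast
    ultimately have "z \<beta> \<in> Pos" using regular_p[OF zR] by (simp add: Pos_def)
    then have "z (- p) \<bullet> z \<beta> > 0" by (rule Pos_inner_pos[OF _ z(2)])
    then have "- p \<bullet> \<beta> > 0" unfolding W_inner[OF z(1)] .
    then show False using b by (simp add: Pos_def)
  qed
  then show thesis using that z by blast
qed

text \<open>
  Moving \<open>l\<close> in the direction \<open>y\<close>, the terms of the wave function outside \<open>S\<close> are \<open>o(e)\<close>: the factor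
  \<open>c_factor\<close> either has two zeros, or its only zero stems from a root in \<open>T\<close> and persists.
\<close>

lemma no_extension:
  fixes l y :: 'a and T :: "'a set"
  defines "B \<equiv> {\<beta>\<in>Pos. \<bar>l \<bullet> \<beta>\<bar> = 1}"
  assumes reg: "\<And>\<gamma>. \<gamma> \<in> R \<Longrightarrow> l \<bullet> \<gamma> \<noteq> 0"
    and sp: "l \<in> span D" "y \<in> span D"
    and ly: "l \<bullet> y \<noteq> 0"
    and yT: "\<And>\<beta>. \<beta> \<in> T \<Longrightarrow> y \<bullet> \<beta> = 0"
    and strict: "\<And>w \<alpha>. w \<in> W \<Longrightarrow> (\<And>\<beta>. \<beta> \<in> B \<Longrightarrow> p \<bullet> w \<beta> < 0) \<Longrightarrow> \<alpha> \<in> D \<Longrightarrow> coord \<alpha> (w l) < 0"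
    and weak: "\<And>w \<beta> \<alpha>. w \<in> W \<Longrightarrow> \<beta> \<in> B - T \<Longrightarrow> (\<And>\<gamma>. \<gamma> \<in> B - {\<beta>} \<Longrightarrow> p \<bullet> w \<gamma> < 0) \<Longrightarrow> \<alpha> \<in> D
        \<Longrightarrow> coord \<alpha> (w l) \<le> 0"
  shows False
proof -
  define S0 where "S0 = {w\<in>W. \<forall>\<beta>\<in>B. p \<bullet> w \<beta> < 0}"
  define S where "S = S0 \<union> {w\<in>W. \<exists>\<beta>\<in>B - T. \<forall>\<gamma>\<in>B - {\<beta>}. p \<bullet> w \<gamma> < 0}"
  define L where "L = line_at l y"
  have S0W: "S0 \<subseteq> W" and SW: "S \<subseteq> W" and S0S: "S0 \<subseteq> S" unfolding S0_def S_def by auto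
  have fS: "finite S" "finite S0" using SW S0W finite_W finite_subset by blast+
  have neg0: "coord \<alpha> (w l) < 0" if "w \<in> S0" "\<alpha> \<in> D" for w \<alpha>
    using strict[of w \<alpha>] that unfolding S0_def by blast
  have neg1: "coord \<alpha> (w l) \<le> 0" if ww: "w \<in> S" "\<alpha> \<in> D" for w \<alpha>
  proof (cases "w \<in> S0")
    case True then show ?thesis using neg0 ww by (simp add: less_imp_le)
  next
    case False
    then obtain \<beta> where "\<beta> \<in> B - T" "\<forall>\<gamma>\<in>B - {\<beta>}. p \<bullet> w \<gamma> < 0" "w \<in> W" using ww unfolding S_def by blast
    then show ?thesis using weak[of w \<beta> \<alpha>] ww by blast
  qed
  have sgn: "p \<bullet> w \<beta> > 0" if "w \<in> W" "\<beta> \<in> B" "\<not> p \<bullet> w \<beta> < 0" for w \<beta>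
    using regular_p[OF W_R[OF that(1), of \<beta>]] that Pos_in_R unfolding B_def by auto
  have h0: "c_factor l w = 0" if w: "w \<in> W" "w \<notin> S0" for w
  proof -
    obtain \<beta> where "\<beta> \<in> B" "\<not> p \<bullet> w \<beta> < 0" using w unfolding S0_def by blast
    then show ?thesis using c_factor_zero[of \<beta> w l] sgn[OF w(1)] unfolding B_def by blast
  qed
  have h1: "((\<lambda>e. c_factor (L e) w / e) \<longlongrightarrow> 0) (at 0)" if w: "w \<in> W" "w \<notin> S" for w
  proof -
    have "w \<notin> S0" using w S0S by blast
    then obtain \<beta> where b: "\<beta> \<in> B" "\<not> p \<bullet> w \<beta> < 0" using w unfolding S0_def by blast
    have bp: "p \<bullet> w \<beta> > 0" using sgn[OF w(1) b] .
    have bB: "\<beta> \<in> Pos" "\<bar>l \<bullet> \<beta>\<bar> = 1" using b unfolding B_def by auto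
    show ?thesis
    proof (cases "\<exists>\<gamma>\<in>B - {\<beta>}. \<not> p \<bullet> w \<gamma> < 0")
      case True
      then obtain \<gamma> where g: "\<gamma> \<in> B" "\<gamma> \<noteq> \<beta>" "\<not> p \<bullet> w \<gamma> < 0" by blast
      have "\<gamma> \<in> Pos" "\<bar>l \<bullet> \<gamma>\<bar> = 1" using g unfolding B_def by auto
      then show ?thesis unfolding L_def
        using c_factor_small[where l=l and y=y and \<beta>=\<beta> and \<gamma>=\<gamma> and w=w, OF reg sp bB(1) bp bB(2)] sgn[OF w(1) g(1,3)] g(2)
        by blast
    next
      case False
      then have "\<beta> \<in> T" using w b unfolding S_def by blast
      then have "\<bar>L e \<bullet> \<beta>\<bar> = 1" for e
        using yT bB unfolding L_def line_at_def by (simp add: inner_add_left)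
      then have "c_factor (L e) w = 0" for e using c_factor_zero[of \<beta> w "L e"] bB bp by blast
      then show ?thesis by simp
    qed
  qed
  have L_eq: "L e = l + e *\<^sub>R y" for e unfolding L_def line_at_def ..
  have Lsp: "L e \<in> span D" for e unfolding L_eq using sp by (simp add: span_add span_scale)
  have clim: "((\<lambda>e. coord \<alpha> (w (L e) + w' l)) \<longlongrightarrow> coord \<alpha> (w l) + coord \<alpha> (w' l)) (at 0)"
    if "w \<in> W" "w' \<in> W" for w w' \<alpha>
    unfolding L_def by (rule coord_W_le_tendsto[OF reg sp that])
  have csum: "coord \<alpha> (w l + w' l) = coord \<alpha> (w l) + coord \<alpha> (w' l)" if "w \<in> W" "w' \<in> W" for w w' \<alpha>
    using W_span[OF that(1) sp(1)] W_span[OF that(2) sp(1)] by (simp add: coord_add)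
  \<comment> \<open>Exponents from \<open>S\<close> are only weakly negative, but every pairing
    below has its second member in \<open>S0\<close>, where they are strictly negative; so all
    integrals converge even though the derivative alone need not be square integrable.\<close>
  have cne: "coord \<alpha> (w l) + coord \<alpha> (w' l) < 0" if "w \<in> S" "w' \<in> S0" "\<alpha> \<in> D" for w w' \<alpha>
    using neg1[OF that(1,3)] neg0[OF that(2,3)] by linarith
  have Klim: "((\<lambda>e. laplace_kernel D' (w (L e) + w' l)) \<longlongrightarrow> laplace_kernel D' (w l + w' l)) (at 0)"
    if "w \<in> S" "w' \<in> S0" "D' \<subseteq> D" for w w' D'
    unfolding laplace_kernel_def
  proof (intro tendsto_prod tendsto_divide tendsto_const tendsto_minus)
    fix \<alpha> assume a: "\<alpha> \<in> D'"
    have W: "w \<in> W" "w' \<in> W" using that SW S0W by auto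
    show "((\<lambda>e. coord \<alpha> (w (L e) + w' l)) \<longlongrightarrow> coord \<alpha> (w l + w' l)) (at 0)"
      unfolding csum[OF W] by (rule clim[OF W])
    show "- coord \<alpha> (w l + w' l) \<noteq> 0" unfolding csum[OF W] using cne[OF that(1,2), of \<alpha>] a that(3) by auto
  qed
  \<comment> \<open>\<open>I e\<close> pairs the wave function at \<open>L e\<close>, truncated to
    \<open>S\<close>, with the one at \<open>l\<close>. Its limit \<open>I0\<close> is the square
    norm of the latter, since the terms of \<open>S\<close> outside \<open>S0\<close> have weight
    zero at \<open>l\<close>.\<close>
  define I where "I = (\<lambda>e. \<Sum>w\<in>S. \<Sum>w'\<in>S0. c_factor (L e) w * c_factor l w' * (eta_inner (L e) l w w')\<^sup>2 * laplace_kernel D (w (L e) + w' l))"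
  define I0 where "I0 = (\<Sum>w\<in>S. \<Sum>w'\<in>S0. c_factor l w * c_factor l w' * (eta_inner l l w w')\<^sup>2 * laplace_kernel D (w l + w' l))"
  have Ilim: "(I \<longlongrightarrow> I0) (at 0)"
    unfolding I_def I0_def
  proof (intro tendsto_sum tendsto_mult tendsto_power tendsto_const)
    fix w w' assume w: "w \<in> S" "w' \<in> S0"
    have wW: "w \<in> W" by (rule subsetD[OF SW w(1)])
    show "((\<lambda>e. c_factor (L e) w) \<longlongrightarrow> c_factor l w) (at 0)" unfolding L_def by (rule c_factor_tendsto[OF reg sp])
    show "((\<lambda>e. eta_inner (L e) l w w') \<longlongrightarrow> eta_inner l l w w') (at 0)"
      unfolding L_def by (rule eta_inner_tendsto[OF reg sp wW])
    show "((\<lambda>e. laplace_kernel D (w (L e) + w' l)) \<longlongrightarrow> laplace_kernel D (w l + w' l)) (at 0)" by (rule Klim[OF w]) simp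
  qed
  have "I0 = (\<Sum>w\<in>S0. \<Sum>w'\<in>S0. c_factor l w * c_factor l w' * (eta_inner l l w w')\<^sup>2 * laplace_kernel D (w l + w' l))"
    unfolding I0_def by (rule sum.mono_neutral_right[OF fS(1) S0S]) (use h0 SW in auto)
  \<comment> \<open>The longest element has an empty weight product, hence weight 1; this guarantees
    that the wave function is not zero.\<close>
  moreover obtain z where z: "z \<in> W" "\<And>\<beta>. \<beta> \<in> Pos \<Longrightarrow> p \<bullet> z \<beta> < 0" using longest_exists by blast
  have zS: "z \<in> S0" unfolding S0_def B_def using z by blast
  have e: "{\<beta>\<in>Pos. p \<bullet> z \<beta> > 0} = {}" using z(2) by fastforce
  have hz: "c_factor l z \<noteq> 0" unfolding c_factor_def e by simp
  have "0 < (\<Sum>w\<in>S0. \<Sum>w'\<in>S0. c_factor l w * c_factor l w' * (eta_inner l l w w')\<^sup>2 * laplace_kernel D (w l + w' l))"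
  proof (rule energy_pos[where S=S0 and l=l and z=z, OF S0W _ sp(1) reg zS hz])
    fix w \<alpha> assume "w \<in> S0" "\<alpha> \<in> D"
    then show "coord \<alpha> (w l) < 0" by (rule neg0)
  qed
  ultimately have I0: "I0 > 0" by simp
  define E where "E = (\<lambda>\<alpha> e. \<Sum>w\<in>S. \<Sum>w'\<in>S0. boundary_term (L e) l \<alpha> w w' * laplace_kernel (D - {\<alpha>}) (w (L e) + w' l))"
  have Lreg: "eventually (\<lambda>e. \<forall>\<gamma>\<in>R. L e \<bullet> \<gamma> \<noteq> 0) (at 0)" unfolding L_def by (rule le_regular[OF reg sp])
  \<comment> \<open>Green's formula divided by \<open>e\<close>. As |L e|^2 - |l|^2 = e (2 (l|y) + e
    (y|y)), the left side tends to 2 (l|y) \<open>I0\<close>, the pairing of the generalised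
    eigenvector equation with the eigenfunction.\<close>
  have green: "eventually (\<lambda>e. (2 * (l \<bullet> y) + e * (y \<bullet> y)) * I e = - (\<Sum>\<alpha>\<in>D. E \<alpha> e / e)) (at 0)"
  proof -
    have "eventually (\<lambda>e. \<forall>w\<in>S. \<forall>w'\<in>S0. \<forall>\<alpha>\<in>D. coord \<alpha> (w (L e) + w' l) \<noteq> 0) (at 0)"
    proof (intro eventually_ball_finite fS fin_D ballI)
      fix w w' \<alpha> assume a: "w \<in> S" "w' \<in> S0" "\<alpha> \<in> D"
      then have W: "w \<in> W" "w' \<in> W" using SW S0W by auto
      show "eventually (\<lambda>e. coord \<alpha> (w (L e) + w' l) \<noteq> 0) (at 0)"
        using cne[OF a] by (intro tendsto_imp_eventually_ne[OF clim[OF W]]) simp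
    qed
    moreover have "eventually (\<lambda>e::real. e \<noteq> 0) (at 0)" by (simp add: eventually_at_filter)
    ultimately show ?thesis
    proof eventually_elim
      case (elim e)
      have ne: "L e \<bullet> L e - l \<bullet> l = e * (2 * (l \<bullet> y) + e * (y \<bullet> y))"
        unfolding L_eq by (simp add: inner_add_left inner_add_right inner_commute[of y l] algebra_simps)
      have "(L e \<bullet> L e - l \<bullet> l) * I e = (\<Sum>w\<in>S. \<Sum>w'\<in>S0. c_factor (L e) w * c_factor l w' * (eta_inner (L e) l w w')\<^sup>2
          * ((L e \<bullet> L e - l \<bullet> l) * laplace_kernel D (w (L e) + w' l)))"
        unfolding I_def by (simp only: sum_distrib_left mult_ac)
      also have "\<dots> = (\<Sum>w\<in>S. \<Sum>w'\<in>S0. - (\<Sum>\<alpha>\<in>D. boundary_term (L e) l \<alpha> w w' * laplace_kernel (D - {\<alpha>}) (w (L e) + w' l)))"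
      proof (intro sum.cong refl)
        fix w w' assume w: "w \<in> S" "w' \<in> S0"
        then have W: "w \<in> W" "w' \<in> W" using SW S0W by auto
        have "(w (L e) \<bullet> w (L e) - w' l \<bullet> w' l) * laplace_kernel D (w (L e) + w' l)
          = - (\<Sum>\<alpha>\<in>D. (w (L e) \<bullet> \<alpha> - w' l \<bullet> \<alpha>) * laplace_kernel (D - {\<alpha>}) (w (L e) + w' l))"
          by (rule norm_diff_laplace_kernel[OF W_span[OF W(1) Lsp] W_span[OF W(2) sp(1)]]) (use elim w in blast)
        then have k: "(L e \<bullet> L e - l \<bullet> l) * laplace_kernel D (w (L e) + w' l)
          = - (\<Sum>\<alpha>\<in>D. (w (L e) \<bullet> \<alpha> - w' l \<bullet> \<alpha>) * laplace_kernel (D - {\<alpha>}) (w (L e) + w' l))"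
          unfolding W_inner[OF W(1)] W_inner[OF W(2)] .
        show "c_factor (L e) w * c_factor l w' * (eta_inner (L e) l w w')\<^sup>2 * ((L e \<bullet> L e - l \<bullet> l) * laplace_kernel D (w (L e) + w' l))
          = - (\<Sum>\<alpha>\<in>D. boundary_term (L e) l \<alpha> w w' * laplace_kernel (D - {\<alpha>}) (w (L e) + w' l))"
          unfolding k boundary_term_def by (simp only: mult_minus_right sum_distrib_left mult.assoc)
      qed
      also have "\<dots> = - (\<Sum>w\<in>S. \<Sum>\<alpha>\<in>D. \<Sum>w'\<in>S0. boundary_term (L e) l \<alpha> w w' * laplace_kernel (D - {\<alpha>}) (w (L e) + w' l))"
        unfolding sum_negf by (intro arg_cong[of _ _ uminus] sum.cong refl sum.swap)
      also have "\<dots> = - (\<Sum>\<alpha>\<in>D. E \<alpha> e)"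
        unfolding E_def by (intro arg_cong[of _ _ uminus] sum.swap)
      finally have "e * ((2 * (l \<bullet> y) + e * (y \<bullet> y)) * I e) = - (\<Sum>\<alpha>\<in>D. E \<alpha> e)"
        unfolding ne by (simp only: mult.assoc)
      then have "(2 * (l \<bullet> y) + e * (y \<bullet> y)) * I e = - (\<Sum>\<alpha>\<in>D. E \<alpha> e) / e"
        using elim(2) by (simp add: field_simps)
      then show ?case by (simp add: sum_divide_distrib)
    qed
  qed
  \<comment> \<open>Truncation destroys invariance under the reflection. Closing up \<open>S\<close>
    and \<open>S0\<close> to \<open>X\<close> and \<open>Y\<close> makes the wall sum vanish; the
    terms added to \<open>S0\<close> have weight 0 at \<open>l\<close>, and those added to
    \<open>S\<close> have weight o(e).\<close>
  have Elim: "((\<lambda>e. E \<alpha> e / e) \<longlongrightarrow> 0) (at 0)" if a: "\<alpha> \<in> D" for \<alpha>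
  proof -
    let ?s = "reflection \<alpha>"
    have ss: "?s \<circ> (?s \<circ> u) = u" for u :: "'a \<Rightarrow> 'a"
      by (simp add: comp_assoc[symmetric] reflection_comp_self[OF a] del: o_apply)
    define X where "X = S \<union> (\<lambda>w. ?s \<circ> w) ` S"
    define Y where "Y = S0 \<union> (\<lambda>w. ?s \<circ> w) ` S0"
    have XW: "X \<subseteq> W" and YW: "Y \<subseteq> W" unfolding X_def Y_def using SW S0W reflection_comp_in_W[OF a] by auto
    have Xs: "?s \<circ> w \<in> X" if "w \<in> X" for w
    proof -
      from that consider "w \<in> S" | w1 where "w1 \<in> S" "w = ?s \<circ> w1" unfolding X_def by blast
      then show ?thesis by cases (simp_all only: X_def ss, blast+)
    qed
    have Ys: "?s \<circ> w \<in> Y" if "w \<in> Y" for w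
    proof -
      from that consider "w \<in> S0" | w1 where "w1 \<in> S0" "w = ?s \<circ> w1" unfolding Y_def by blast
      then show ?thesis by cases (simp_all only: Y_def ss, blast+)
    qed
    have fX: "finite X" "finite Y" using XW YW finite_W finite_subset by blast+
    define F where "F = (\<lambda>e w w'. boundary_term (L e) l \<alpha> w w' * laplace_kernel (D - {\<alpha>}) (w (L e) + w' l))"
    have ev: "eventually (\<lambda>e. - (\<Sum>w\<in>X - S. \<Sum>w'\<in>S0. F e w w' / e) = E \<alpha> e / e) (at 0)"
      using Lreg
    proof eventually_elim
      case (elim e)
      have "(\<Sum>w\<in>X. \<Sum>w'\<in>Y. F e w w') = 0"
        unfolding F_def by (rule boundary_sum_zero[OF a XW Xs YW Ys _ reg Lsp sp(1)]) (use elim in blast)+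
      moreover have "(\<Sum>w'\<in>Y. F e w w') = (\<Sum>w'\<in>S0. F e w w')" for w
        by (rule sum.mono_neutral_right[OF fX(2)]) (use h0 YW in \<open>auto simp: Y_def F_def boundary_term_def\<close>)
      ultimately have "(\<Sum>w\<in>X. \<Sum>w'\<in>S0. F e w w') = 0" by simp
      moreover have "(\<Sum>w\<in>X. \<Sum>w'\<in>S0. F e w w') = (\<Sum>w\<in>X - S. \<Sum>w'\<in>S0. F e w w') + (\<Sum>w\<in>S. \<Sum>w'\<in>S0. F e w w')"
        by (rule sum.subset_diff[OF _ fX(1)]) (simp add: X_def)
      ultimately have "E \<alpha> e = - (\<Sum>w\<in>X - S. \<Sum>w'\<in>S0. F e w w')" unfolding E_def F_def by linarith
      then show ?case by (simp add: sum_divide_distrib)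
    qed
    have "((\<lambda>e. - (\<Sum>w\<in>X - S. \<Sum>w'\<in>S0. F e w w' / e)) \<longlongrightarrow> - (\<Sum>w\<in>X - S. \<Sum>w'\<in>S0. 0)) (at 0)"
    proof (intro tendsto_minus tendsto_sum)
      fix w w' assume w: "w \<in> X - S" "w' \<in> S0"
      have W: "w \<in> W" "w' \<in> W" using w XW S0W by auto
      \<comment> \<open>The coordinates of w l need not be negative for \<open>w\<close> outside
        \<open>S\<close>; the limit of the wall kernel exists because it coincides with that of the
        reflected element of \<open>S\<close>.\<close>
      obtain w1 where w1: "w1 \<in> S" "w = ?s \<circ> w1" using w unfolding X_def by blast
      have w1W: "w1 \<in> W" using w1 SW by blast
      have "laplace_kernel (D - {\<alpha>}) (w (L e) + w' l) = laplace_kernel (D - {\<alpha>}) (w1 (L e) + w' l)" for e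
        unfolding w1(2) o_apply by (rule laplace_kernel_reflection(1)[OF a W_span[OF w1W Lsp] W_span[OF W(2) sp(1)]])
      then have k: "((\<lambda>e. laplace_kernel (D - {\<alpha>}) (w (L e) + w' l)) \<longlongrightarrow> laplace_kernel (D - {\<alpha>}) (w1 l + w' l)) (at 0)"
        using Klim[OF w1(1) w(2), of "D - {\<alpha>}"] by (simp only: Diff_subset)
      have i: "((\<lambda>e. w (L e) \<bullet> \<alpha>) \<longlongrightarrow> w l \<bullet> \<alpha>) (at 0)" unfolding L_def by (rule W_le_inner[OF reg sp W(1)])
      have g: "((\<lambda>e. eta_inner (L e) l w w') \<longlongrightarrow> eta_inner l l w w') (at 0)" unfolding L_def by (rule eta_inner_tendsto[OF reg sp W(1)])
      have h: "((\<lambda>e. c_factor (L e) w / e) \<longlongrightarrow> 0) (at 0)" using h1[OF W(1)] w by blast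
      have "((\<lambda>e. c_factor (L e) w / e * (c_factor l w' * (eta_inner (L e) l w w')\<^sup>2 * (w (L e) \<bullet> \<alpha> - w' l \<bullet> \<alpha>)
          * laplace_kernel (D - {\<alpha>}) (w (L e) + w' l))) \<longlongrightarrow> 0 * (c_factor l w' * (eta_inner l l w w')\<^sup>2 * (w l \<bullet> \<alpha> - w' l \<bullet> \<alpha>)
          * laplace_kernel (D - {\<alpha>}) (w1 l + w' l))) (at 0)"
        by (intro tendsto_mult h tendsto_const tendsto_power g tendsto_diff i k)
      then show "((\<lambda>e. F e w w' / e) \<longlongrightarrow> 0) (at 0)"
        unfolding F_def boundary_term_def by (simp add: mult_ac)
    qed
    then show ?thesis using ev by (simp add: tendsto_cong)
  qed
  have "((\<lambda>e. (2 * (l \<bullet> y) + e * (y \<bullet> y)) * I e) \<longlongrightarrow> (2 * (l \<bullet> y) + 0 * (y \<bullet> y)) * I0) (at 0)"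
    by (intro tendsto_intros Ilim)
  moreover have "((\<lambda>e. - (\<Sum>\<alpha>\<in>D. E \<alpha> e / e)) \<longlongrightarrow> - (\<Sum>\<alpha>\<in>D. 0)) (at 0)"
    by (intro tendsto_minus tendsto_sum Elim)
  then have "((\<lambda>e. (2 * (l \<bullet> y) + e * (y \<bullet> y)) * I e) \<longlongrightarrow> - (\<Sum>\<alpha>\<in>D. 0)) (at 0)"
    using tendsto_cong[OF green] by blast
  ultimately have "(2 * (l \<bullet> y) + 0 * (y \<bullet> y)) * I0 = - (\<Sum>\<alpha>\<in>D. 0)"
    by (rule tendsto_unique[rotated]) simp
  then show False using I0 ly by simp
qed

end

section \<open>Roots of height one\<close>

lemma nonneg_comb_remove:
  assumes fin: "finite D" and "\<delta> \<in> D" and \<delta>: "nonneg_comb (D - {\<delta>}) \<delta>" and \<beta>: "nonneg_comb D \<beta>"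
  shows "nonneg_comb (D - {\<delta>}) \<beta>"
proof -
  obtain e where e: "\<forall>\<gamma>\<in>D - {\<delta>}. 0 \<le> e \<gamma>" "\<delta> = (\<Sum>\<gamma>\<in>D - {\<delta>}. e \<gamma> *\<^sub>R \<gamma>)"
    using \<delta> unfolding nonneg_comb_def by blast
  obtain c where c: "\<forall>\<gamma>\<in>D. 0 \<le> c \<gamma>" "\<beta> = (\<Sum>\<gamma>\<in>D. c \<gamma> *\<^sub>R \<gamma>)"
    using \<beta> unfolding nonneg_comb_def by blast
  have "\<beta> = c \<delta> *\<^sub>R \<delta> + (\<Sum>\<gamma>\<in>D - {\<delta>}. c \<gamma> *\<^sub>R \<gamma>)" 
    by (rule trans[OF c(2) sum.remove[OF fin assms(2)]])
  also have "c \<delta> *\<^sub>R \<delta> = (\<Sum>\<gamma>\<in>D - {\<delta>}. (c \<delta> * e \<gamma>) *\<^sub>R \<gamma>)"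
    by (rule trans[OF arg_cong[OF e(2), of "\<lambda>v. c \<delta> *\<^sub>R v"]]) (simp add: scaleR_sum_right)
  finally have "\<beta> = (\<Sum>\<gamma>\<in>D - {\<delta>}. (c \<delta> * e \<gamma> + c \<gamma>) *\<^sub>R \<gamma>)"
    by (simp add: scaleR_add_left sum.distrib)
  moreover have "\<forall>\<gamma>\<in>D - {\<delta>}. 0 \<le> c \<delta> * e \<gamma> + c \<gamma>" using e(1) c(1) assms(2) by simp
  ultimately show ?thesis
    unfolding nonneg_comb_def by (intro exI[of _ "\<lambda>\<gamma>. c \<delta> * e \<gamma> + c \<gamma>"] conjI)
qed

text \<open>Separate a relation into its positive and nonpositive coefficients. Both sides equal a
  vector \<open>x\<close> with (x|x) at most 0, so x = 0; pairing each side with \<open>p\<close>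
  then kills every coefficient.\<close>

lemma obtuse_independent:
  fixes p :: "'a::euclidean_space"
  assumes fin: "finite D" and pos: "\<And>\<gamma>. \<gamma> \<in> D \<Longrightarrow> p \<bullet> \<gamma> > 0"
    and obt: "\<And>\<beta> \<gamma>. \<beta> \<in> D \<Longrightarrow> \<gamma> \<in> D \<Longrightarrow> \<beta> \<noteq> \<gamma> \<Longrightarrow> \<beta> \<bullet> \<gamma> \<le> 0"
  shows "independent D"
proof
  assume "dependent D"
  then obtain u where u: "\<exists>\<gamma>\<in>D. u \<gamma> \<noteq> 0" "(\<Sum>\<gamma>\<in>D. u \<gamma> *\<^sub>R \<gamma>) = 0"
    using dependent_finite[OF fin] by auto
  define P N where "P = {\<gamma>\<in>D. u \<gamma> > 0}" and "N = D - P"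
  define x where "x = (\<Sum>\<gamma>\<in>P. u \<gamma> *\<^sub>R \<gamma>)"
  have fPN: "finite P" "finite N" "P \<subseteq> D" "N \<subseteq> D" unfolding P_def N_def using fin by auto
  have "(\<Sum>\<gamma>\<in>D. u \<gamma> *\<^sub>R \<gamma>) = (\<Sum>\<gamma>\<in>N. u \<gamma> *\<^sub>R \<gamma>) + x"
    unfolding N_def x_def by (rule sum.subset_diff[OF fPN(3) fin])
  then have x: "x = (\<Sum>\<gamma>\<in>N. (- u \<gamma>) *\<^sub>R \<gamma>)" using u(2) by (simp add: sum_negf add_eq_0_iff)
  have "x \<bullet> x = (\<Sum>\<beta>\<in>P. u \<beta> *\<^sub>R \<beta>) \<bullet> (\<Sum>\<gamma>\<in>N. (- u \<gamma>) *\<^sub>R \<gamma>)" using x unfolding x_def by simp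
  also have "\<dots> = (\<Sum>\<beta>\<in>P. \<Sum>\<gamma>\<in>N. (u \<beta> * (- u \<gamma>)) * (\<beta> \<bullet> \<gamma>))"
    by (subst inner_sum_left, intro sum.cong refl, subst inner_sum_right, intro sum.cong refl) simp
  also have "\<dots> \<le> 0"
  proof (intro sum_nonpos mult_nonneg_nonpos obt)
    fix \<beta> \<gamma> assume "\<beta> \<in> P" "\<gamma> \<in> N"
    then have "0 \<le> u \<beta>" "0 \<le> - u \<gamma>" unfolding P_def N_def by auto
    then show "0 \<le> u \<beta> * - u \<gamma>" by (rule mult_nonneg_nonneg)
  qed (auto simp: P_def N_def)
  finally have x0: "x = 0" by (metis inner_eq_zero_iff inner_ge_zero order_antisym)
  have "(\<Sum>\<gamma>\<in>P. u \<gamma> * (p \<bullet> \<gamma>)) = p \<bullet> x" unfolding x_def by (simp add: inner_sum_right)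
  then have "(\<Sum>\<gamma>\<in>P. u \<gamma> * (p \<bullet> \<gamma>)) = 0" using x0 by simp
  moreover have "\<forall>\<gamma>\<in>P. 0 < u \<gamma> * (p \<bullet> \<gamma>)" unfolding P_def using pos by simp
  ultimately have P: "P = {}"
    using sum_pos[of P "\<lambda>\<gamma>. u \<gamma> * (p \<bullet> \<gamma>)"] fPN(1) by (cases "P = {}") auto
  have "(\<Sum>\<gamma>\<in>N. - u \<gamma> * (p \<bullet> \<gamma>)) = p \<bullet> x" unfolding x by (simp add: inner_sum_right)
  then have "(\<Sum>\<gamma>\<in>N. - u \<gamma> * (p \<bullet> \<gamma>)) = 0" using x0 by simp
  moreover have "0 \<le> - u \<gamma> * (p \<bullet> \<gamma>)" if "\<gamma> \<in> N" for \<gamma>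
    using that pos[of \<gamma>] unfolding N_def P_def by (auto intro!: mult_nonpos_nonneg)
  ultimately have "\<forall>\<gamma>\<in>N. - u \<gamma> * (p \<bullet> \<gamma>) = 0" 
    using sum_nonneg_eq_0_iff[of N "\<lambda>\<gamma>. - u \<gamma> * (p \<bullet> \<gamma>)"] fPN(2) by simp
  then have "u \<gamma> = 0" if "\<gamma> \<in> D" for \<gamma> using P pos[OF that] that unfolding N_def by auto
  then show False using u(1) by blast
qed

text \<open>Take a set of positive roots of least cardinality that generates all of them
  nonnegatively. If two members formed an acute angle, the reflection of one in the other would make
  one of them redundant; so they are pairwise obtuse and therefore independent.\<close>

lemma simple_system_exists:
  fixes R :: "'a::euclidean_space set"
  assumes fin: "finite R" and z: "0 \<notin> R"
    and closed: "\<And>\<alpha> \<beta>. \<alpha> \<in> R \<Longrightarrow> \<beta> \<in> R \<Longrightarrow> reflection \<alpha> \<beta> \<in> R"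
    and reg: "\<And>\<beta>. \<beta> \<in> R \<Longrightarrow> p \<bullet> \<beta> \<noteq> 0"
  obtains D where "D \<subseteq> {\<beta>\<in>R. p \<bullet> \<beta> > 0}" "independent D"
    "\<And>\<beta>. \<beta> \<in> R \<Longrightarrow> p \<bullet> \<beta> > 0 \<Longrightarrow> nonneg_comb D \<beta>"
proof -
  define P where "P = {\<beta>\<in>R. p \<bullet> \<beta> > 0}"
  define G where "G = (\<lambda>D. D \<subseteq> P \<and> (\<forall>\<beta>\<in>P. nonneg_comb D \<beta>))"
  have fP: "finite P" unfolding P_def using fin by simp
  have "nonneg_comb P \<beta>" if "\<beta> \<in> P" for \<beta>
    unfolding nonneg_comb_def
    by (rule exI[of _ "\<lambda>\<gamma>. if \<gamma> = \<beta> then 1 else 0"])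
      (use that fP in \<open>simp add: if_distrib[of "\<lambda>c. c *\<^sub>R _"] cong: if_cong\<close>)
  then have "G P" unfolding G_def by blast
  then obtain D where D: "G D" and mn: "\<And>D'. G D' \<Longrightarrow> card D \<le> card D'"
    using ex_has_least_nat[of G P card] by blast
  have DP: "D \<subseteq> P" and gen: "\<And>\<beta>. \<beta> \<in> P \<Longrightarrow> nonneg_comb D \<beta>" using D unfolding G_def by auto
  have fD: "finite D" using DP fP finite_subset by blast
  have pD: "p \<bullet> \<gamma> > 0" if "\<gamma> \<in> D" for \<gamma> using that DP unfolding P_def by blast
  \<comment> \<open>Pairing with \<open>p\<close> shows that \<open>m\<close> is positive, so
    \<delta> is a nonnegative combination of the other members, against minimality. The positive
    coefficient at \<epsilon> makes the pairing strict.\<close>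
  have irred: False if \<delta>: "\<delta> \<in> D" and eq: "m *\<^sub>R \<delta> = (\<Sum>\<gamma>\<in>D - {\<delta>}. f \<gamma> *\<^sub>R \<gamma>)"
    and nn: "\<And>\<gamma>. \<gamma> \<in> D - {\<delta>} \<Longrightarrow> 0 \<le> f \<gamma>" and \<epsilon>: "\<epsilon> \<in> D - {\<delta>}" "f \<epsilon> > 0" for \<delta> m f \<epsilon>
  proof -
    have "m * (p \<bullet> \<delta>) = p \<bullet> (m *\<^sub>R \<delta>)" by simp
    also have "\<dots> = (\<Sum>\<gamma>\<in>D - {\<delta>}. f \<gamma> * (p \<bullet> \<gamma>))" unfolding eq by (simp add: inner_sum_right)
    also have "\<dots> > 0"
      using fD \<epsilon> pD nn by (intro sum_pos2[of _ \<epsilon>]) (auto simp: less_imp_le)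
    finally have m: "m > 0" using pD[OF \<delta>] by (simp add: zero_less_mult_iff)
    have "\<delta> = (1 / m) *\<^sub>R (m *\<^sub>R \<delta>)" using m by simp
    also have "\<dots> = (\<Sum>\<gamma>\<in>D - {\<delta>}. (f \<gamma> / m) *\<^sub>R \<gamma>)" unfolding eq by (simp add: scaleR_sum_right)
    finally have "nonneg_comb (D - {\<delta>}) \<delta>"
      unfolding nonneg_comb_def using nn m by (intro exI[of _ "\<lambda>\<gamma>. f \<gamma> / m"]) auto
    then have "G (D - {\<delta>})" unfolding G_def using DP gen nonneg_comb_remove[OF fD \<delta>] by blast
    then have "card D \<le> card (D - {\<delta>})" by (rule mn)
    then show False using fD \<delta> by (metis card_Diff1_less not_le)
  qed
  have "\<beta> \<bullet> \<alpha> \<le> 0" if ab: "\<beta> \<in> D" "\<alpha> \<in> D" "\<beta> \<noteq> \<alpha>" for \<beta> \<alpha>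
  proof (rule ccontr)
    assume "\<not> ?thesis"
    then have pos: "\<beta> \<bullet> \<alpha> > 0" by simp
    have aR: "\<alpha> \<in> R" "\<beta> \<in> R" using ab DP unfolding P_def by auto
    define k where "k = 2 * (\<beta> \<bullet> \<alpha>) / (\<alpha> \<bullet> \<alpha>)"
    have "\<alpha> \<noteq> 0" using aR(1) z by blast
    then have k: "k > 0" unfolding k_def using pos by (intro divide_pos_pos) auto
    have s: "reflection \<alpha> \<beta> = \<beta> - k *\<^sub>R \<alpha>" unfolding reflection_def k_def ..
    have sR: "\<beta> - k *\<^sub>R \<alpha> \<in> R" using closed[OF aR] s by simp
    have rem: "(\<Sum>\<gamma>\<in>D. c \<gamma> *\<^sub>R \<gamma>) = c \<delta> *\<^sub>R \<delta> + (\<Sum>\<gamma>\<in>D - {\<delta>}. c \<gamma> *\<^sub>R \<gamma>)" if "\<delta> \<in> D" for c \<delta>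
      using sum.remove[OF fD that] .
    have bump: "(\<Sum>\<gamma>\<in>D - {\<delta>}. (c \<gamma> + (if \<gamma> = \<epsilon> then q else 0)) *\<^sub>R \<gamma>) = (\<Sum>\<gamma>\<in>D - {\<delta>}. c \<gamma> *\<^sub>R \<gamma>) + q *\<^sub>R \<epsilon>"
      if "\<epsilon> \<in> D - {\<delta>}" for c q \<delta> \<epsilon>
      using fD that by (simp add: scaleR_add_left sum.distrib if_distrib[of "\<lambda>c. c *\<^sub>R _"] cong: if_cong)
    show False
    \<comment> \<open>If \<beta> - k \<alpha> is positive, its expansion makes \<beta> redundant,
      with a coefficient at least \<open>k\<close> at \<alpha>; if it is negative, the expansion of
      its opposite makes \<alpha> redundant.\<close>
    proof (cases "p \<bullet> (\<beta> - k *\<^sub>R \<alpha>) > 0")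
      case True
      then have "nonneg_comb D (\<beta> - k *\<^sub>R \<alpha>)" using gen sR unfolding P_def by blast
      then obtain c where c: "\<And>\<gamma>. \<gamma> \<in> D \<Longrightarrow> 0 \<le> c \<gamma>" "\<beta> - k *\<^sub>R \<alpha> = (\<Sum>\<gamma>\<in>D. c \<gamma> *\<^sub>R \<gamma>)"
        unfolding nonneg_comb_def by blast
      have "(1 - c \<beta>) *\<^sub>R \<beta> = (\<Sum>\<gamma>\<in>D - {\<beta>}. (c \<gamma> + (if \<gamma> = \<alpha> then k else 0)) *\<^sub>R \<gamma>)"
      proof -
        have "(\<Sum>\<gamma>\<in>D - {\<beta>}. c \<gamma> *\<^sub>R \<gamma>) = \<beta> - k *\<^sub>R \<alpha> - c \<beta> *\<^sub>R \<beta>"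
          unfolding c(2) rem[OF ab(1)] by simp
        then show ?thesis using ab by (subst bump) (simp_all add: algebra_simps)
      qed
      then show False
        by (rule irred[OF ab(1), where \<epsilon> = \<alpha>]) (use ab c(1) k in \<open>auto simp: add_nonneg_pos\<close>)
    next
      case False
      then have "p \<bullet> (- (\<beta> - k *\<^sub>R \<alpha>)) > 0" using reg[OF sR] by (simp add: inner_diff_right)
      moreover have "- (\<beta> - k *\<^sub>R \<alpha>) \<in> R"
      proof -
        have "\<beta> - k *\<^sub>R \<alpha> \<noteq> 0" using sR z by auto
        then have "reflection (\<beta> - k *\<^sub>R \<alpha>) (\<beta> - k *\<^sub>R \<alpha>) = - (\<beta> - k *\<^sub>R \<alpha>)" by (rule reflection_self)
        then show ?thesis using closed[OF sR sR] by metis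
      qed
      ultimately have "nonneg_comb D (- (\<beta> - k *\<^sub>R \<alpha>))" using gen unfolding P_def by blast
      then obtain c where c: "\<And>\<gamma>. \<gamma> \<in> D \<Longrightarrow> 0 \<le> c \<gamma>" "- (\<beta> - k *\<^sub>R \<alpha>) = (\<Sum>\<gamma>\<in>D. c \<gamma> *\<^sub>R \<gamma>)"
        unfolding nonneg_comb_def by blast
      have "(k - c \<alpha>) *\<^sub>R \<alpha> = (\<Sum>\<gamma>\<in>D - {\<alpha>}. (c \<gamma> + (if \<gamma> = \<beta> then 1 else 0)) *\<^sub>R \<gamma>)"
      proof -
        have "(\<Sum>\<gamma>\<in>D - {\<alpha>}. c \<gamma> *\<^sub>R \<gamma>) = - (\<beta> - k *\<^sub>R \<alpha>) - c \<alpha> *\<^sub>R \<alpha>"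
          unfolding c(2) rem[OF ab(2)] by simp
        then show ?thesis using ab by (subst bump) (simp_all add: algebra_simps)
      qed
      then show False
        by (rule irred[OF ab(2), where \<epsilon> = \<beta>]) (use ab c(1) in \<open>auto simp: add_nonneg_pos\<close>)
    qed
  qed
  then have ind: "independent D" by (intro obtuse_independent[OF fD pD])
  show thesis
  proof (rule that[OF _ ind])
    show "D \<subseteq> {\<beta>\<in>R. p \<bullet> \<beta> > 0}" using DP unfolding P_def .
    show "nonneg_comb D \<beta>" if "\<beta> \<in> R" "p \<bullet> \<beta> > 0" for \<beta> using gen that unfolding P_def by simp
  qed
qed

lemma independent_prescribe_inner:
  fixes B :: "'a::euclidean_space set"
  assumes "independent B"
  shows "\<exists>x. \<forall>\<beta>\<in>B. x \<bullet> \<beta> = f \<beta>"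
proof -
  obtain g where g: "linear g" "\<forall>\<beta>\<in>B. g \<beta> = f \<beta>"
    using linear_independent_extend[OF assms, of f] by blast
  have "adjoint g 1 \<bullet> \<beta> = f \<beta>" if "\<beta> \<in> B" for \<beta>
    using adjoint_works[OF g(1), of \<beta> 1] g(2) that by (simp add: inner_commute[of \<beta>])
  then show ?thesis by blast
qed

theorem height_one_independent:
  fixes \<Phi> :: "'a::euclidean_space set"
  assumes fin: "finite \<Phi>" and z: "0 \<notin> \<Phi>"
    and closed: "\<And>\<alpha> \<beta>. \<alpha> \<in> \<Phi> \<Longrightarrow> \<beta> \<in> \<Phi> \<Longrightarrow> reflection \<alpha> \<beta> \<in> \<Phi>"
    and red: "\<And>\<beta> c. \<beta> \<in> \<Phi> \<Longrightarrow> c *\<^sub>R \<beta> \<in> \<Phi> \<Longrightarrow> c = 1 \<or> c = - 1"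
    and reg: "\<And>\<beta>. \<beta> \<in> \<Phi> \<Longrightarrow> v \<bullet> \<beta> \<noteq> 0"
  shows "independent {\<beta>\<in>\<Phi>. v \<bullet> \<beta> = 1}"
proof
  define A where "A = {\<beta>\<in>\<Phi>. v \<bullet> \<beta> = 1}"
  assume "dependent {\<beta>\<in>\<Phi>. v \<bullet> \<beta> = 1}"
  then have "A \<subseteq> A \<and> dependent A" unfolding A_def by simp
  then obtain Q where Q: "Q \<subseteq> A" "dependent Q" and mn: "\<And>Q'. Q' \<subseteq> A \<Longrightarrow> dependent Q' \<Longrightarrow> card Q \<le> card Q'"
    using ex_has_least_nat[of "\<lambda>Q. Q \<subseteq> A \<and> dependent Q" A card] by blast
  have Q\<Phi>: "Q \<subseteq> \<Phi>" and Qv: "\<And>\<beta>. \<beta> \<in> Q \<Longrightarrow> v \<bullet> \<beta> = 1" using Q(1) unfolding A_def by auto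
  have fQ: "finite Q" using Q\<Phi> fin finite_subset by blast
  have ind: "independent (Q - {\<beta>})" if "\<beta> \<in> Q" for \<beta>
  proof
    assume "dependent (Q - {\<beta>})"
    then have "card Q \<le> card (Q - {\<beta>})" using mn Q(1) by blast
    then show False using card_Diff1_less[OF fQ that] by simp
  qed
  \<comment> \<open>By minimality of \<open>Q\<close> its relations form a line: a relation that
    vanishes at one member vanishes at all. In particular \<open>d\<close> has no zero on
    \<open>Q\<close>.\<close>
  have rel0: "q \<gamma> = 0" if r: "(\<Sum>\<gamma>\<in>Q. q \<gamma> *\<^sub>R \<gamma>) = 0" and b: "\<beta> \<in> Q" "q \<beta> = 0" and g: "\<gamma> \<in> Q" for q \<beta> \<gamma>
  proof (cases "\<gamma> = \<beta>")
    case False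
    have "(\<Sum>\<gamma>\<in>Q - {\<beta>}. q \<gamma> *\<^sub>R \<gamma>) = 0" using r sum.remove[OF fQ b(1), of "\<lambda>\<gamma>. q \<gamma> *\<^sub>R \<gamma>"] b(2) by simp
    then show ?thesis
      using independentD[OF ind[OF b(1)], of "Q - {\<beta>}" q \<gamma>] fQ False g by simp
  qed (use b in simp)
  obtain d where d: "\<exists>\<beta>\<in>Q. d \<beta> \<noteq> 0" "(\<Sum>\<beta>\<in>Q. d \<beta> *\<^sub>R \<beta>) = 0"
    using Q(2) dependent_finite[OF fQ] by auto
  have dn: "d \<beta> \<noteq> 0" if "\<beta> \<in> Q" for \<beta> using rel0[OF d(2) that] d(1) by blast
  obtain l zz where l: "l \<in> span Q" and zz: "\<And>w. w \<in> span Q \<Longrightarrow> orthogonal zz w" and v: "v = l + zz"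
    using orthogonal_subspace_decomp_exists[of Q v] by blast
  have lv: "l \<bullet> \<beta> = v \<bullet> \<beta>" if "\<beta> \<in> span Q" for \<beta>
    using zz[OF that] unfolding v by (simp add: inner_add_left orthogonal_def)
  obtain e where e: "l = (\<Sum>\<beta>\<in>Q. e \<beta> *\<^sub>R \<beta>)" using l span_finite[OF fQ] by auto
  \<comment> \<open>All expansions of \<open>l\<close> over \<open>Q\<close> have the coefficients e
    + s d for some parameter s; \<open>r \<beta>\<close> is the parameter at which the coefficient
    of \<beta> is zero.\<close>
  define r where "r = (\<lambda>\<beta>. - e \<beta> / d \<beta>)"
  define a where "a = (\<lambda>s \<beta>. d \<beta> * (s - r \<beta>))"
  have la: "l = (\<Sum>\<beta>\<in>Q. a s \<beta> *\<^sub>R \<beta>)" for s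
  proof -
    have "(\<Sum>\<beta>\<in>Q. a s \<beta> *\<^sub>R \<beta>) = (\<Sum>\<beta>\<in>Q. s *\<^sub>R (d \<beta> *\<^sub>R \<beta>) + e \<beta> *\<^sub>R \<beta>)"
    proof (intro sum.cong refl)
      fix \<beta> assume "\<beta> \<in> Q"
      then have "a s \<beta> = s * d \<beta> + e \<beta>" unfolding a_def r_def using dn by (simp add: field_simps)
      then show "a s \<beta> *\<^sub>R \<beta> = s *\<^sub>R (d \<beta> *\<^sub>R \<beta>) + e \<beta> *\<^sub>R \<beta>" by (simp add: scaleR_add_left)
    qed
    also have "\<dots> = s *\<^sub>R (\<Sum>\<beta>\<in>Q. d \<beta> *\<^sub>R \<beta>) + l" unfolding e by (simp add: sum.distrib scaleR_sum_right)
    finally show ?thesis using d(2) by simp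
  qed
  have Qne: "Q \<noteq> {}" using d(1) by blast
  define t1 where "t1 = Min (r ` Q)"
  have t1: "t1 \<in> r ` Q" "\<And>\<beta>. \<beta> \<in> Q \<Longrightarrow> t1 \<le> r \<beta>" 
    unfolding t1_def using fQ Qne by (intro Min_in Min_le; simp)+
  then obtain b1 where b1: "b1 \<in> Q" "r b1 = t1" by auto
  \<comment> \<open>If all coefficients vanished at the same parameter, \<open>l\<close> would be
    zero, although (l|b1) = 1.\<close>
  have "r ` Q - {t1} \<noteq> {}"
  proof
    assume "r ` Q - {t1} = {}"
    then have "r \<beta> = t1" if "\<beta> \<in> Q" for \<beta> using that by blast
    then have "a t1 \<beta> = 0" if "\<beta> \<in> Q" for \<beta> using that unfolding a_def by simp
    then have "l = 0" by (subst la[of t1]) (simp add: sum.neutral)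
    then show False using lv[OF span_base[OF b1(1)]] Qv[OF b1(1)] by simp
  qed
  define t2 where "t2 = Min (r ` Q - {t1})"
  have t2: "t2 \<in> r ` Q - {t1}" "\<And>\<beta>. \<beta> \<in> Q \<Longrightarrow> r \<beta> \<noteq> t1 \<Longrightarrow> t2 \<le> r \<beta>"
    unfolding t2_def using fQ \<open>r ` Q - {t1} \<noteq> {}\<close> by (intro Min_in Min_le; simp)+
  then obtain b2 where b2: "b2 \<in> Q" "r b2 = t2" by auto
  have t12: "t1 < t2" using t1(2)[OF b2(1)] b2(2) t2(1) by auto
  have b12: "b1 \<noteq> b2" using b1 b2 t12 by auto
  \<comment> \<open>\<open>t1\<close> and \<open>t2\<close> are the two smallest zeros, so no
    coefficient changes sign between them. The signs \<sigma> at the midpoint make the coefficients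
    strictly positive at \<open>t\<close> and nonnegative on the closed interval, while
    \<open>b1\<close> drops out at \<open>t1\<close> and \<open>b2\<close> at
    \<open>t2\<close>.\<close>
  define t where "t = (t1 + t2) / 2"
  have tm: "t1 < t" "t < t2" unfolding t_def using t12 by auto
  have at: "a t \<beta> \<noteq> 0" if "\<beta> \<in> Q" for \<beta>
    using dn[OF that] t2(2)[OF that] tm unfolding a_def by auto
  define \<sigma> where "\<sigma> = (\<lambda>\<beta>. sgn (a t \<beta>))"
  have \<sigma>2: "\<sigma> \<beta> * \<sigma> \<beta> = 1" if "\<beta> \<in> Q" for \<beta> using at[OF that] unfolding \<sigma>_def sgn_real_def by simp
  have \<sigma>a: "0 \<le> \<sigma> \<beta> * a s \<beta>" if "\<beta> \<in> Q" "t1 \<le> s" "s \<le> t2" for \<beta> s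
  proof -
    have "sgn (t - r \<beta>) * (s - r \<beta>) \<ge> 0"
      using t2(2)[OF that(1)] tm that by (cases "r \<beta> = t1") (auto simp: sgn_real_def)
    moreover have "sgn (d \<beta>) * d \<beta> \<ge> 0" by (simp add: sgn_real_def)
    ultimately have "(sgn (d \<beta>) * d \<beta>) * (sgn (t - r \<beta>) * (s - r \<beta>)) \<ge> 0"
      by (simp only: mult_nonneg_nonneg)
    then show ?thesis unfolding \<sigma>_def a_def sgn_mult by (simp add: mult_ac)
  qed
  have \<sigma>at: "0 < \<sigma> \<beta> * a t \<beta>" if "\<beta> \<in> Q" for \<beta>
    using at[OF that] unfolding \<sigma>_def sgn_real_def by simp
  \<comment> \<open>The sign pattern \<sigma> must be realised by a vector. The only constraint on
    the values of \<open>x\<close> on \<open>Q\<close> is the relation \<open>d\<close>, and it is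
    compatible with \<sigma> because d has the same sign as \<sigma> at \<open>b1\<close> and the
    opposite sign at \<open>b2\<close>. Values are prescribed off \<open>b1\<close>.\<close>
  obtain x where x: "\<And>\<beta>. \<beta> \<in> Q \<Longrightarrow> \<sigma> \<beta> * (x \<bullet> \<beta>) > 0"
  proof -
    define C where "C = (\<Sum>\<beta>\<in>Q - {b1} - {b2}. d \<beta> * \<sigma> \<beta>)"
    \<comment> \<open>Chosen so that the term of \<open>b2\<close> in the relation is -(|C| + 1),
      which outweighs the other prescribed terms and forces the right sign at
      \<open>b1\<close>.\<close>
    define M where "M = (\<bar>C\<bar> + 1) / \<bar>d b2\<bar>"
    have M: "M > 0" "\<bar>d b2\<bar> * M = \<bar>C\<bar> + 1" unfolding M_def using dn[OF b2(1)] by auto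
    obtain x where "\<forall>\<beta>\<in>Q - {b1}. x \<bullet> \<beta> = (if \<beta> = b2 then \<sigma> b2 * M else \<sigma> \<beta>)"
      using independent_prescribe_inner[OF ind[OF b1(1)], of "\<lambda>\<beta>. if \<beta> = b2 then \<sigma> b2 * M else \<sigma> \<beta>"] by blast
    then have x: "x \<bullet> \<beta> = (if \<beta> = b2 then \<sigma> b2 * M else \<sigma> \<beta>)" if "\<beta> \<in> Q - {b1}" for \<beta> using that by blast
    have xb2: "x \<bullet> b2 = \<sigma> b2 * M" using x[of b2] b2 b12 by simp
    have s1: "\<sigma> b1 = sgn (d b1)" unfolding \<sigma>_def a_def sgn_mult using b1(2) tm by (simp add: sgn_real_def)
    have s2: "\<sigma> b2 = - sgn (d b2)" unfolding \<sigma>_def a_def sgn_mult using b2(2) tm by (simp add: sgn_real_def)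
    have "0 = x \<bullet> (\<Sum>\<beta>\<in>Q. d \<beta> *\<^sub>R \<beta>)" using d(2) by simp
    also have "\<dots> = (\<Sum>\<beta>\<in>Q. d \<beta> * (x \<bullet> \<beta>))" by (simp add: inner_sum_right)
    also have "\<dots> = d b1 * (x \<bullet> b1) + (d b2 * (x \<bullet> b2) + (\<Sum>\<beta>\<in>Q - {b1} - {b2}. d \<beta> * (x \<bullet> \<beta>)))"
      using fQ b1(1) b2(1) b12 by (subst sum.remove[of Q b1], simp, simp, subst sum.remove[of "Q - {b1}" b2]) auto
    also have "(\<Sum>\<beta>\<in>Q - {b1} - {b2}. d \<beta> * (x \<bullet> \<beta>)) = C"
      unfolding C_def by (intro sum.cong refl) (simp add: x)
    also have "d b2 * (x \<bullet> b2) = - (\<bar>C\<bar> + 1)"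
      unfolding xb2 s2 M(2)[symmetric] by (simp add: abs_sgn)
    finally have "d b1 * (x \<bullet> b1) > 0" by linarith
    then have x1: "\<sigma> b1 * (x \<bullet> b1) > 0" unfolding s1 by (auto simp: sgn_real_def zero_less_mult_iff)
    show thesis
    proof (rule that)
      fix \<beta> assume b: "\<beta> \<in> Q"
      consider "\<beta> = b1" | "\<beta> = b2" | "\<beta> \<in> Q - {b1}" "\<beta> \<noteq> b2" using b by blast
      then show "\<sigma> \<beta> * (x \<bullet> \<beta>) > 0"
      proof cases
        case 1 then show ?thesis using x1 by simp
      next
        case 2
        have "\<sigma> b2 * (x \<bullet> b2) = (\<sigma> b2 * \<sigma> b2) * M" unfolding xb2 by simp
        then show ?thesis using 2 \<sigma>2[OF b2(1)] M(1) by simp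
      next
        case 3 then show ?thesis using x[of \<beta>] \<sigma>2[OF b] by simp
      qed
    qed
  qed
  define R where "R = \<Phi> \<inter> span Q"
  have QR: "Q \<subseteq> R" unfolding R_def using Q\<Phi> span_base by blast
  have fR: "finite R" unfolding R_def using fin by simp
  have lreg: "l \<bullet> \<gamma> \<noteq> 0" if "\<gamma> \<in> R" for \<gamma> using that reg lv unfolding R_def by auto
  \<comment> \<open>A small positive multiple of \<open>l\<close> is added to \<open>x\<close>:
    since \<open>l\<close> is nonzero on every root of \<open>R\<close> this removes all zeros,
    while the strict inequalities on \<open>Q\<close> persist.\<close>
  obtain p where p: "\<And>\<gamma>. \<gamma> \<in> R \<Longrightarrow> p \<bullet> \<gamma> \<noteq> 0" and pQ: "\<And>\<beta>. \<beta> \<in> Q \<Longrightarrow> \<sigma> \<beta> * (p \<bullet> \<beta>) > 0"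
  proof -
    have lim: "((\<lambda>s. (x + s *\<^sub>R l) \<bullet> \<gamma>) \<longlongrightarrow> x \<bullet> \<gamma>) (at_right 0)" for \<gamma>
    proof -
      have "((\<lambda>s. x \<bullet> \<gamma> + s * (l \<bullet> \<gamma>)) \<longlongrightarrow> x \<bullet> \<gamma> + 0 * (l \<bullet> \<gamma>)) (at_right 0)" by (intro tendsto_intros)
      then show ?thesis by (simp add: inner_add_left)
    qed
    have "eventually (\<lambda>s. (x + s *\<^sub>R l) \<bullet> \<gamma> \<noteq> 0) (at_right 0)" if "\<gamma> \<in> R" for \<gamma>
    proof (cases "x \<bullet> \<gamma> = 0")
      case True
      then show ?thesis using lreg[OF that] 
        by (auto simp: inner_add_left eventually_at_right_less intro: eventually_mono[OF eventually_at_right_less[of 0]])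
    next
      case False then show ?thesis by (rule tendsto_imp_eventually_ne[OF lim])
    qed
    then have "eventually (\<lambda>s. \<forall>\<gamma>\<in>R. (x + s *\<^sub>R l) \<bullet> \<gamma> \<noteq> 0) (at_right 0)"
      by (intro eventually_ball_finite[OF fR] ballI)
    moreover have "eventually (\<lambda>s. \<forall>\<beta>\<in>Q. \<sigma> \<beta> * ((x + s *\<^sub>R l) \<bullet> \<beta>) > 0) (at_right 0)"
      by (intro eventually_ball_finite[OF fQ] ballI order_tendstoD(1)[OF tendsto_mult[OF tendsto_const lim] x])
    ultimately have "eventually (\<lambda>s. (\<forall>\<gamma>\<in>R. (x + s *\<^sub>R l) \<bullet> \<gamma> \<noteq> 0) \<and> (\<forall>\<beta>\<in>Q. \<sigma> \<beta> * ((x + s *\<^sub>R l) \<bullet> \<beta>) > 0)) (at_right 0)"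
      by (rule eventually_conj)
    then obtain s where "(\<forall>\<gamma>\<in>R. (x + s *\<^sub>R l) \<bullet> \<gamma> \<noteq> 0) \<and> (\<forall>\<beta>\<in>Q. \<sigma> \<beta> * ((x + s *\<^sub>R l) \<bullet> \<beta>) > 0)"
      using eventually_happens'[OF trivial_limit_at_right_real] by blast
    then show thesis using that[of "x + s *\<^sub>R l"] by blast
  qed
  have reflR: "reflection \<alpha> \<beta> \<in> R" if "\<alpha> \<in> R" "\<beta> \<in> R" for \<alpha> \<beta>
    using that closed unfolding R_def reflection_def by (auto intro: span_diff span_scale)
  have zR: "0 \<notin> R" unfolding R_def using z by blast
  obtain D where D: "D \<subseteq> {\<beta>\<in>R. p \<bullet> \<beta> > 0}" "independent D"
    "\<And>\<beta>. \<beta> \<in> R \<Longrightarrow> p \<bullet> \<beta> > 0 \<Longrightarrow> nonneg_comb D \<beta>"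
    using simple_system_exists[of R p, OF fR zR reflR p] by blast
  have redR: "c = 1 \<or> c = - 1" if "\<beta> \<in> R" "c *\<^sub>R \<beta> \<in> R" for \<beta> c
    using red[of \<beta> c] that unfolding R_def by blast
  interpret positive_system R p D
    by unfold_locales (fact fR zR reflR redR p D)+
  have spD: "span D = span Q"
  proof -
    have "span R \<subseteq> span Q" by (rule span_minimal) (auto simp: R_def)
    then have "span R = span Q" using span_mono[OF QR] by blast
    then show ?thesis using span_R by simp
  qed
  have lD: "l \<in> span D" using l spD by simp
  define B where "B = {\<beta>\<in>Pos. \<bar>l \<bullet> \<beta>\<bar> = 1}"
  define sg where "sg = (\<lambda>\<beta>. \<sigma> \<beta> *\<^sub>R \<beta>)"
  have \<sigma>1: "\<sigma> \<beta> = 1 \<or> \<sigma> \<beta> = - 1" if "\<beta> \<in> Q" for \<beta> using at[OF that] unfolding \<sigma>_def sgn_real_def by simp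
  have sgB: "sg \<beta> \<in> B" if "\<beta> \<in> Q" for \<beta>
  proof -
    have "sg \<beta> \<in> R" unfolding sg_def using \<sigma>1[OF that] QR that uminus_in_R[of \<beta>] by auto
    moreover have "p \<bullet> sg \<beta> > 0" unfolding sg_def using pQ[OF that] by simp
    moreover have "\<bar>l \<bullet> sg \<beta>\<bar> = 1" unfolding sg_def using \<sigma>1[OF that] lv[OF span_base[OF that]] Qv[OF that] by auto
    ultimately show ?thesis unfolding B_def Pos_def by simp
  qed
  have lsg: "l = (\<Sum>\<beta>\<in>Q. (\<sigma> \<beta> * a s \<beta>) *\<^sub>R sg \<beta>)" for s
  proof -
    have "(\<Sum>\<beta>\<in>Q. (\<sigma> \<beta> * a s \<beta>) *\<^sub>R sg \<beta>) = (\<Sum>\<beta>\<in>Q. a s \<beta> *\<^sub>R \<beta>)"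
    proof (intro sum.cong refl)
      fix \<beta> assume "\<beta> \<in> Q"
      then have "\<sigma> \<beta> * a s \<beta> * \<sigma> \<beta> = a s \<beta>" using \<sigma>1[of \<beta>] by auto
      then show "(\<sigma> \<beta> * a s \<beta>) *\<^sub>R sg \<beta> = a s \<beta> *\<^sub>R \<beta>" unfolding sg_def by simp
    qed
    then show ?thesis using la[of s] by simp
  qed
  have Wsg: "w (sg \<beta>) \<in> span D" if "w \<in> W" "\<beta> \<in> Q" for w \<beta>
    using W_span[OF that(1)] sgB[OF that(2)] Pos_in_R R_subset_span_D unfolding B_def by blast
  have coordl: "coord \<alpha> (w l) = (\<Sum>\<beta>\<in>Q. (\<sigma> \<beta> * a s \<beta>) * coord \<alpha> (w (sg \<beta>)))" if w: "w \<in> W" for w \<alpha> s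
  proof -
    have "w l = (\<Sum>\<beta>\<in>Q. (\<sigma> \<beta> * a s \<beta>) *\<^sub>R w (sg \<beta>))"
      by (subst lsg[of s]) (simp only: linear_sum[OF W_linear[OF w]] linear_scale[OF W_linear[OF w]])
    then show ?thesis by (simp only: coord_lincomb[OF Wsg[OF w]])
  qed
  have cneg: "coord \<alpha> (w \<gamma>) \<le> 0" if w: "w \<in> W" and g: "\<gamma> \<in> B" "p \<bullet> w \<gamma> < 0" and al: "\<alpha> \<in> D" for w \<gamma> \<alpha>
  proof -
    have "w \<gamma> \<in> R" using W_R[OF w] g(1) Pos_in_R unfolding B_def by blast
    then have "- w \<gamma> \<in> Pos" "w \<gamma> \<in> span D" using g(2) uminus_in_R R_subset_span_D unfolding Pos_def by auto
    then show ?thesis using coord_Pos[of "- w \<gamma>" \<alpha>] al by (simp add: representation_neg[OF indep_D])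
  qed
  \<comment> \<open>Members of \<open>Q\<close> that cannot be dropped from the expansion of
    \<open>l\<close>; \<open>y\<close> is made orthogonal to them so that their zeros of the weight
    persist along the line.\<close>
  define T where "T = sg ` (Q - {b1, b2})"
  obtain a0 y where a0: "a0 \<in> span (Q - {b1, b2})" and y: "\<And>w. w \<in> span (Q - {b1, b2}) \<Longrightarrow> orthogonal y w"
    and ly: "l = a0 + y"
    using orthogonal_subspace_decomp_exists[of "Q - {b1, b2}" l] by blast
  have yD: "y \<in> span D"
  proof -
    have "a0 \<in> span Q" using a0 span_mono[of "Q - {b1, b2}" Q] by blast
    moreover have "y = l - a0" using ly by simp
    ultimately show ?thesis using l spD by (simp add: span_diff)
  qed
  have "l \<bullet> y = y \<bullet> y" using y[OF a0] unfolding ly by (simp add: inner_add_left orthogonal_def inner_commute[of a0])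
  moreover have "y \<noteq> 0"
  proof
    assume "y = 0"
    then have "l \<in> span (Q - {b1, b2})" using a0 ly by simp
    then obtain f where f: "l = (\<Sum>\<beta>\<in>Q - {b1, b2}. f \<beta> *\<^sub>R \<beta>)" using span_finite[of "Q - {b1, b2}"] fQ by auto
    \<comment> \<open>An expansion of \<open>l\<close> avoiding \<open>b1\<close> and
      \<open>b2\<close>, minus the one at \<open>t1\<close>, is a relation vanishing at
      \<open>b1\<close>. It would then vanish at \<open>b2\<close>, where its value is d b2 * (t2 -
      t1).\<close>
    define q where "q = (\<lambda>\<beta>. (if \<beta> \<in> Q - {b1, b2} then f \<beta> else 0) - a t1 \<beta>)"
    have "(\<Sum>\<beta>\<in>Q. (if \<beta> \<in> Q - {b1, b2} then f \<beta> else 0) *\<^sub>R \<beta>) = (\<Sum>\<beta>\<in>Q - {b1, b2}. f \<beta> *\<^sub>R \<beta>)"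
      by (rule sum.mono_neutral_cong_right) (use fQ in auto)
    then have "(\<Sum>\<beta>\<in>Q. q \<beta> *\<^sub>R \<beta>) = l - l"
      unfolding q_def scaleR_diff_left sum_subtractf using f la[of t1] by simp
    then have "(\<Sum>\<beta>\<in>Q. q \<beta> *\<^sub>R \<beta>) = 0" by simp
    moreover have "q b1 = 0" unfolding q_def a_def using b1 by simp
    ultimately have "q b2 = 0" using rel0[OF _ b1(1) _ b2(1)] by blast
    then show False unfolding q_def a_def using b2 dn[OF b2(1)] t12 by simp
  qed
  ultimately have ly0: "l \<bullet> y \<noteq> 0" by simp
  show False
  proof (rule no_extension[where l=l and y=y and T=T, folded B_def, OF lreg lD yD ly0])
    fix \<beta> assume "\<beta> \<in> T"
    then obtain \<gamma> where "\<gamma> \<in> Q - {b1, b2}" "\<beta> = sg \<gamma>" unfolding T_def by blast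
    then show "y \<bullet> \<beta> = 0" using y[OF span_base, of \<gamma>] unfolding sg_def by (simp add: orthogonal_def)
  next
    fix w \<alpha> assume w: "w \<in> W" and neg: "\<And>\<beta>. \<beta> \<in> B \<Longrightarrow> p \<bullet> w \<beta> < 0" and al: "\<alpha> \<in> D"
    have np: "(\<sigma> \<beta> * a t \<beta>) * coord \<alpha> (w (sg \<beta>)) \<le> 0" if "\<beta> \<in> Q" for \<beta>
      using \<sigma>at[OF that] cneg[OF w sgB[OF that] neg[OF sgB[OF that]] al] by (simp add: mult_nonneg_nonpos)
    have le: "coord \<alpha> (w l) \<le> 0" unfolding coordl[OF w, of \<alpha> t] by (intro sum_nonpos np)
    show "coord \<alpha> (w l) < 0"
    proof (rule ccontr)
      assume "\<not> ?thesis"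
      then have "(\<Sum>\<beta>\<in>Q. - ((\<sigma> \<beta> * a t \<beta>) * coord \<alpha> (w (sg \<beta>)))) = 0"
        using le coordl[OF w, of \<alpha> t] by (simp add: sum_negf)
      then have "- ((\<sigma> \<beta> * a t \<beta>) * coord \<alpha> (w (sg \<beta>))) = 0" if "\<beta> \<in> Q" for \<beta>
        using sum_nonneg_eq_0_iff[of Q "\<lambda>\<beta>. - ((\<sigma> \<beta> * a t \<beta>) * coord \<alpha> (w (sg \<beta>)))"] fQ np that by simp
      then have z0: "coord \<alpha> (w (sg \<beta>)) = 0" if "\<beta> \<in> Q" for \<beta> using \<sigma>at[OF that] that by fastforce
      \<comment> \<open>All the vectors \<open>w (sg \<beta>)\<close> would have \<alpha>-coordinate
        zero. Their span contains \<alpha> itself, because the preimage of \<alpha> under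
        \<open>w\<close> lies in the span of \<open>Q\<close>.\<close>
      obtain \<gamma> where g: "\<gamma> \<in> R" "w \<gamma> = \<alpha>" using W_preimage_R[OF w D_in_R[OF al]] by blast
      then have "\<gamma> \<in> span Q" unfolding R_def by blast
      then obtain h where h: "\<gamma> = (\<Sum>\<beta>\<in>Q. h \<beta> *\<^sub>R \<beta>)" using span_finite[OF fQ] by auto
      have "\<gamma> = (\<Sum>\<beta>\<in>Q. (h \<beta> * \<sigma> \<beta>) *\<^sub>R sg \<beta>)"
        unfolding h sg_def by (intro sum.cong refl) (simp add: mult.assoc \<sigma>2)
      then have "\<alpha> = (\<Sum>\<beta>\<in>Q. (h \<beta> * \<sigma> \<beta>) *\<^sub>R w (sg \<beta>))"
        using g(2) by (simp only: linear_sum[OF W_linear[OF w]] linear_scale[OF W_linear[OF w]])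
      then have "coord \<alpha> \<alpha> = (\<Sum>\<beta>\<in>Q. (h \<beta> * \<sigma> \<beta>) * coord \<alpha> (w (sg \<beta>)))"
        using coord_lincomb[where B = Q and f = "\<lambda>\<beta>. w (sg \<beta>)" and \<alpha> = \<alpha> and c = "\<lambda>\<beta>. h \<beta> * \<sigma> \<beta>", OF Wsg[OF w]]
        by metis
      then have "coord \<alpha> \<alpha> = 0" using z0 by simp
      then show False using coord_basis[OF al al] by simp
    qed
  next
    fix w \<beta>0 \<alpha> assume w: "w \<in> W" and b0: "\<beta>0 \<in> B - T" and neg: "\<And>\<gamma>. \<gamma> \<in> B - {\<beta>0} \<Longrightarrow> p \<bullet> w \<gamma> < 0"
      and al: "\<alpha> \<in> D"
    \<comment> \<open>The endpoint at which the exempt root has coefficient zero. If that root does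
      not come from \<open>Q\<close>, all representatives are sent to negative roots and either
      endpoint would do.\<close>
    define s where "s = (if \<beta>0 = sg b2 then t2 else t1)"
    have s: "t1 \<le> s" "s \<le> t2" unfolding s_def using t12 by auto
    show "coord \<alpha> (w l) \<le> 0" unfolding coordl[OF w, of \<alpha> s]
    proof (rule sum_nonpos)
      fix \<beta> assume b: "\<beta> \<in> Q"
      show "(\<sigma> \<beta> * a s \<beta>) * coord \<alpha> (w (sg \<beta>)) \<le> 0"
      proof (cases "sg \<beta> = \<beta>0")
        case False
        then show ?thesis using \<sigma>a[OF b s] cneg[OF w sgB[OF b] neg al] sgB[OF b] by (simp add: mult_nonneg_nonpos)
      next
        case True
        then have "\<beta> = b1 \<or> \<beta> = b2" using b0 b unfolding T_def by blast
        moreover have "sg b1 \<noteq> sg b2"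
        proof
          assume eq: "sg b1 = sg b2"
          have i: "l \<bullet> sg \<beta> = \<sigma> \<beta>" if "\<beta> \<in> Q" for \<beta>
            unfolding sg_def using lv[OF span_base[OF that]] Qv[OF that] by simp
          have "\<sigma> b1 = \<sigma> b2" using i[OF b1(1)] i[OF b2(1)] eq by simp
          then show False using eq \<sigma>1[OF b1(1)] b12 unfolding sg_def by auto
        qed
        ultimately have "a s \<beta> = 0" unfolding s_def a_def using True b1(2) b2(2) by auto
        then show ?thesis by simp
      qed
    qed
  qed
qed

section \<open>Regions\<close>

context
  fixes \<Phi> \<Delta> :: "'a::euclidean_space set"
  assumes rs: "root_system \<Phi>" and sr: "simple_roots \<Phi> \<Delta>"
begin

lemma fin_\<Delta>: "finite \<Delta>"
  using rs sr finite_subset unfolding root_system_def simple_roots_def by blast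

lemma fin_pos: "finite (pos_roots \<Phi> \<Delta>)"
  using rs unfolding root_system_def pos_roots_def by simp

lemma chamber_nonneg_comb:
  assumes "v \<in> chamber \<Delta>" "nonneg_comb \<Delta> x" "x \<noteq> 0"
  shows "v \<bullet> x > 0"
proof -
  obtain c where c: "\<forall>\<alpha>\<in>\<Delta>. 0 \<le> c \<alpha>" "x = (\<Sum>\<alpha>\<in>\<Delta>. c \<alpha> *\<^sub>R \<alpha>)"
    using assms(2) unfolding nonneg_comb_def by blast
  obtain \<alpha> where a: "\<alpha> \<in> \<Delta>" "c \<alpha> \<noteq> 0"
    using assms(3) c(2) by (metis (no_types, lifting) scale_eq_0_iff sum.neutral)
  have v: "v \<bullet> \<beta> > 0" if "\<beta> \<in> \<Delta>" for \<beta> using assms(1) that unfolding chamber_def by blast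
  have "v \<bullet> x = (\<Sum>\<alpha>\<in>\<Delta>. c \<alpha> * (v \<bullet> \<alpha>))" unfolding c(2) by (simp add: inner_sum_right)
  also have "\<dots> > 0"
  proof (rule sum_pos2[OF fin_\<Delta> a(1)])
    show "0 < c \<alpha> * (v \<bullet> \<alpha>)" using a c(1) v by (simp add: less_le)
    show "0 \<le> c \<beta> * (v \<bullet> \<beta>)" if "\<beta> \<in> \<Delta>" for \<beta> using c(1) v[OF that] that by simp
  qed
  finally show ?thesis .
qed

lemma root_le_inner_less:
  assumes v: "v \<in> chamber \<Delta>" and "root_le \<Delta> x y" "x \<noteq> y"
  shows "v \<bullet> x < v \<bullet> y"
  using chamber_nonneg_comb[OF v, of "y - x"] assms unfolding root_le_def by (simp add: inner_diff_right)

lemma root_le_trans: "root_le \<Delta> x y \<Longrightarrow> root_le \<Delta> y z \<Longrightarrow> root_le \<Delta> x z"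
  unfolding root_le_def nonneg_comb_def
proof (elim exE conjE)
  fix c d assume c: "\<forall>\<alpha>\<in>\<Delta>. 0 \<le> c \<alpha>" "y - x = (\<Sum>\<alpha>\<in>\<Delta>. c \<alpha> *\<^sub>R \<alpha>)"
    and d: "\<forall>\<alpha>\<in>\<Delta>. 0 \<le> d \<alpha>" "z - y = (\<Sum>\<alpha>\<in>\<Delta>. d \<alpha> *\<^sub>R \<alpha>)"
  have "z - x = (y - x) + (z - y)" by simp
  also have "\<dots> = (\<Sum>\<alpha>\<in>\<Delta>. (c \<alpha> + d \<alpha>) *\<^sub>R \<alpha>)" unfolding c(2) d(2) by (simp add: scaleR_add_left sum.distrib)
  finally show "\<exists>c. (\<forall>\<alpha>\<in>\<Delta>. 0 \<le> c \<alpha>) \<and> z - x = (\<Sum>\<alpha>\<in>\<Delta>. c \<alpha> *\<^sub>R \<alpha>)"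
    using c(1) d(1) by (intro exI[of _ "\<lambda>\<alpha>. c \<alpha> + d \<alpha>"]) auto
qed

lemma root_le_refl: "root_le \<Delta> x x"
  unfolding root_le_def nonneg_comb_def by (intro exI[of _ "\<lambda>_. 0"]) auto

text \<open>A chamber vector is strictly monotone for the root order, so an element below \<beta>
  with least value is minimal.\<close>

lemma minimal_below:
  assumes v: "v \<in> chamber \<Delta>" and S: "finite S" "\<beta> \<in> S"
  shows "\<exists>\<gamma>\<in>minimal_roots \<Delta> S. root_le \<Delta> \<gamma> \<beta>"
proof -
  define X where "X = {\<gamma>\<in>S. root_le \<Delta> \<gamma> \<beta>}"
  have X: "finite X" "\<beta> \<in> X" unfolding X_def using S root_le_refl by auto
  have "Min ((\<bullet>) v ` X) \<in> (\<bullet>) v ` X" using X by (intro Min_in) auto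
  then obtain \<gamma> where g: "\<gamma> \<in> X" "v \<bullet> \<gamma> = Min ((\<bullet>) v ` X)" by auto
  have "\<delta> = \<gamma>" if "\<delta> \<in> S" "root_le \<Delta> \<delta> \<gamma>" for \<delta>
  proof (rule ccontr)
    assume "\<delta> \<noteq> \<gamma>"
    then have "v \<bullet> \<delta> < v \<bullet> \<gamma>" using root_le_inner_less[OF v that(2)] by blast
    moreover have "\<delta> \<in> X" using that g(1) root_le_trans unfolding X_def by blast
    then have "v \<bullet> \<gamma> \<le> v \<bullet> \<delta>" unfolding g(2) using X by (intro Min_le) auto
    ultimately show False by simp
  qed
  then show ?thesis using g(1) unfolding X_def minimal_roots_def by blast
qed

lemma maximal_above:
  assumes v: "v \<in> chamber \<Delta>" and S: "finite S" "\<beta> \<in> S"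
  shows "\<exists>\<gamma>\<in>maximal_roots \<Delta> S. root_le \<Delta> \<beta> \<gamma>"
proof -
  define X where "X = {\<gamma>\<in>S. root_le \<Delta> \<beta> \<gamma>}"
  have X: "finite X" "\<beta> \<in> X" unfolding X_def using S root_le_refl by auto
  have "Max ((\<bullet>) v ` X) \<in> (\<bullet>) v ` X" using X by (intro Max_in) auto
  then obtain \<gamma> where g: "\<gamma> \<in> X" "v \<bullet> \<gamma> = Max ((\<bullet>) v ` X)" by auto
  have "\<delta> = \<gamma>" if "\<delta> \<in> S" "root_le \<Delta> \<gamma> \<delta>" for \<delta>
  proof (rule ccontr)
    assume "\<delta> \<noteq> \<gamma>"
    then have "v \<bullet> \<gamma> < v \<bullet> \<delta>" using root_le_inner_less[OF v that(2)] by blast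
    moreover have "\<delta> \<in> X" using that g(1) root_le_trans unfolding X_def by blast
    then have "v \<bullet> \<delta> \<le> v \<bullet> \<gamma>" unfolding g(2) using X by (intro Max_ge) auto
    ultimately show False by simp
  qed
  then show ?thesis using g(1) unfolding X_def maximal_roots_def by blast
qed

lemma chamber_regular:
  assumes v: "v \<in> chamber \<Delta>" and b: "\<beta> \<in> \<Phi>" shows "v \<bullet> \<beta> \<noteq> 0"
proof -
  have "\<beta> \<noteq> 0" using rs b unfolding root_system_def by blast
  moreover have "nonneg_comb \<Delta> \<beta> \<or> nonneg_comb \<Delta> (- \<beta>)" using sr b unfolding simple_roots_def by blast
  ultimately show ?thesis using chamber_nonneg_comb[OF v, of \<beta>] chamber_nonneg_comb[OF v, of "- \<beta>"] by auto
qed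

lemma chamber_height_one_independent:
  assumes v: "v \<in> chamber \<Delta>"
  shows "independent {\<beta>\<in>\<Phi>. v \<bullet> \<beta> = 1}"
proof (rule height_one_independent)
  show "finite \<Phi>" "0 \<notin> \<Phi>" using rs unfolding root_system_def by auto
  show "reflection \<alpha> \<beta> \<in> \<Phi>" if "\<alpha> \<in> \<Phi>" "\<beta> \<in> \<Phi>" for \<alpha> \<beta>
    using rs that unfolding root_system_def by blast
  show "c = 1 \<or> c = - 1" if "\<beta> \<in> \<Phi>" "c *\<^sub>R \<beta> \<in> \<Phi>" for \<beta> c
  proof -
    have "\<Phi> \<inter> range (\<lambda>c. c *\<^sub>R \<beta>) = {\<beta>, - \<beta>}" "\<beta> \<noteq> 0" using rs that unfolding root_system_def by blast+
    then have "c *\<^sub>R \<beta> = 1 *\<^sub>R \<beta> \<or> c *\<^sub>R \<beta> = (- 1) *\<^sub>R \<beta>" using that by auto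
    then show ?thesis using \<open>\<beta> \<noteq> 0\<close> by (simp only: scaleR_cancel_right simp_thms)
  qed
qed (rule chamber_regular[OF v])

text \<open>Only the roots of value exactly 1 are undecided at \<open>v\<close>. By their
  independence there is a direction raising those in \<open>J\<close> and lowering the others; a
  small step along it keeps all inequalities that are already strict. Both parts of the theorem thus
  reduce to weak inequalities at the given point.\<close>

lemma region_nonempty:
  assumes v: "v \<in> chamber \<Delta>" and J: "J \<subseteq> pos_roots \<Phi> \<Delta>"
    and ge: "\<And>\<beta>. \<beta> \<in> J \<Longrightarrow> v \<bullet> \<beta> \<ge> 1"
    and le: "\<And>\<beta>. \<beta> \<in> pos_roots \<Phi> \<Delta> - J \<Longrightarrow> v \<bullet> \<beta> \<le> 1"
  shows "region \<Phi> \<Delta> J \<noteq> {}"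
proof -
  obtain x where x: "\<forall>\<beta>\<in>{\<beta>\<in>\<Phi>. v \<bullet> \<beta> = 1}. x \<bullet> \<beta> = (if \<beta> \<in> J then 1 else - 1)"
    using independent_prescribe_inner[OF chamber_height_one_independent[OF v], of "\<lambda>\<beta>. if \<beta> \<in> J then 1 else - 1"]
    by blast
  have lim: "((\<lambda>s. (v + s *\<^sub>R x) \<bullet> \<gamma>) \<longlongrightarrow> v \<bullet> \<gamma>) (at_right 0)" for \<gamma>
  proof -
    have "((\<lambda>s. v \<bullet> \<gamma> + s * (x \<bullet> \<gamma>)) \<longlongrightarrow> v \<bullet> \<gamma> + 0 * (x \<bullet> \<gamma>)) (at_right 0)" by (intro tendsto_intros)
    then show ?thesis by (simp add: inner_add_left)
  qed
  have pos: "eventually (\<lambda>s::real. s > 0) (at_right 0)" by (simp add: eventually_at_right_less)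
  have "eventually (\<lambda>s. \<forall>\<alpha>\<in>\<Delta>. (v + s *\<^sub>R x) \<bullet> \<alpha> > 0) (at_right 0)"
  proof (intro eventually_ball_finite[OF fin_\<Delta>] ballI)
    fix \<alpha> assume "\<alpha> \<in> \<Delta>"
    then have "v \<bullet> \<alpha> > 0" using v unfolding chamber_def by blast
    then show "eventually (\<lambda>s. (v + s *\<^sub>R x) \<bullet> \<alpha> > 0) (at_right 0)" by (rule order_tendstoD(1)[OF lim])
  qed
  moreover have "eventually (\<lambda>s. \<forall>\<beta>\<in>J. (v + s *\<^sub>R x) \<bullet> \<beta> > 1) (at_right 0)"
  proof (intro eventually_ball_finite[OF finite_subset[OF J fin_pos]] ballI)
    fix \<beta> assume b: "\<beta> \<in> J"
    show "eventually (\<lambda>s. (v + s *\<^sub>R x) \<bullet> \<beta> > 1) (at_right 0)"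
    proof (cases "v \<bullet> \<beta> = 1")
      case True
      then have "x \<bullet> \<beta> = 1" using x b J unfolding pos_roots_def by auto
      with True show ?thesis by (intro eventually_mono[OF pos]) (simp add: inner_add_left)
    next
      case False
      then show ?thesis using ge[OF b] by (intro order_tendstoD(1)[OF lim]) simp
    qed
  qed
  moreover have "eventually (\<lambda>s. \<forall>\<beta>\<in>pos_roots \<Phi> \<Delta> - J. (v + s *\<^sub>R x) \<bullet> \<beta> < 1) (at_right 0)"
  proof (intro eventually_ball_finite[OF finite_Diff[OF fin_pos]] ballI)
    fix \<beta> assume b: "\<beta> \<in> pos_roots \<Phi> \<Delta> - J"
    show "eventually (\<lambda>s. (v + s *\<^sub>R x) \<bullet> \<beta> < 1) (at_right 0)"
    proof (cases "v \<bullet> \<beta> = 1")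
      case True
      then have "x \<bullet> \<beta> = - 1" using x b unfolding pos_roots_def by auto
      with True show ?thesis by (intro eventually_mono[OF pos]) (simp add: inner_add_left)
    next
      case False
      then show ?thesis using le[OF b] by (intro order_tendstoD(2)[OF lim]) simp
    qed
  qed
  ultimately have "eventually (\<lambda>s. v + s *\<^sub>R x \<in> region \<Phi> \<Delta> J) (at_right 0)"
    by eventually_elim (simp add: region_def chamber_def)
  then show ?thesis using eventually_happens'[OF trivial_limit_at_right_real] by blast
qed

end

theorem theorem3p1:
  fixes \<Phi> \<Delta> I :: "'a::euclidean_space set"
  assumes "root_system \<Phi>"
    and "simple_roots \<Phi> \<Delta>"
    and "increasing_set \<Phi> \<Delta> I"
    and "I \<noteq> {}"
  shows "((\<exists>v\<^sub>0\<in>chamber \<Delta>.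
            (\<forall>\<beta>\<in>minimal_roots \<Delta> I. v\<^sub>0 \<bullet> \<beta> = 1) \<and>
            (\<forall>\<beta>\<in>maximal_roots \<Delta> (pos_roots \<Phi> \<Delta> - I). v\<^sub>0 \<bullet> \<beta> < 1))
          \<longrightarrow> (\<forall>\<Lambda>\<subseteq>minimal_roots \<Delta> I. region \<Phi> \<Delta> (I - \<Lambda>) \<noteq> {})) \<and>
         ((\<exists>v\<^sub>0\<in>chamber \<Delta>.
            (\<forall>\<beta>\<in>maximal_roots \<Delta> (pos_roots \<Phi> \<Delta> - I). v\<^sub>0 \<bullet> \<beta> = 1) \<and>
            (\<forall>\<beta>\<in>minimal_roots \<Delta> I. v\<^sub>0 \<bullet> \<beta> > 1))
          \<longrightarrow> (\<forall>\<Lambda>\<subseteq>maximal_roots \<Delta> (pos_roots \<Phi> \<Delta> - I). region \<Phi> \<Delta> (I \<union> \<Lambda>) \<noteq> {}))"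
proof -
  note ctx = assms(1,2)
  let ?P = "pos_roots \<Phi> \<Delta>"
  have IP: "I \<subseteq> ?P" using assms(3) unfolding increasing_set_def by blast
  have fI: "finite I" "finite (?P - I)" using fin_pos[OF ctx] IP finite_subset by auto
  have minI: "minimal_roots \<Delta> I \<subseteq> I" and maxI: "maximal_roots \<Delta> (?P - I) \<subseteq> ?P - I"
    unfolding minimal_roots_def maximal_roots_def by auto
  \<comment> \<open>Bounds on the minimal elements of \<open>I\<close> spread upwards, and dually
    bounds on the maximal elements of the complement spread downwards, by monotonicity of chamber
    vectors. Roots of \<Lambda> have value exactly 1, so they satisfy the weak inequality on
    whichever side they are moved to.\<close>
  have up: "m \<le> v \<bullet> \<beta>" if v: "v \<in> chamber \<Delta>" and m: "\<And>\<gamma>. \<gamma> \<in> minimal_roots \<Delta> I \<Longrightarrow> m \<le> v \<bullet> \<gamma>" and b: "\<beta> \<in> I" for v \<beta> m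
  proof -
    obtain \<gamma> where g: "\<gamma> \<in> minimal_roots \<Delta> I" "root_le \<Delta> \<gamma> \<beta>" using minimal_below[OF ctx v fI(1) b] by blast
    have "v \<bullet> \<gamma> \<le> v \<bullet> \<beta>" using root_le_inner_less[OF ctx v g(2)] by (cases "\<gamma> = \<beta>") auto
    then show ?thesis using m[OF g(1)] by linarith
  qed
  have down: "v \<bullet> \<beta> \<le> m" if v: "v \<in> chamber \<Delta>" and m: "\<And>\<gamma>. \<gamma> \<in> maximal_roots \<Delta> (?P - I) \<Longrightarrow> v \<bullet> \<gamma> \<le> m"
    and b: "\<beta> \<in> ?P - I" for v \<beta> m
  proof -
    obtain \<gamma> where g: "\<gamma> \<in> maximal_roots \<Delta> (?P - I)" "root_le \<Delta> \<beta> \<gamma>"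
      using maximal_above[OF ctx v fI(2) b] by blast
    have "v \<bullet> \<beta> \<le> v \<bullet> \<gamma>" using root_le_inner_less[OF ctx v g(2)] by (cases "\<gamma> = \<beta>") auto
    then show ?thesis using m[OF g(1)] by linarith
  qed
  show ?thesis
  proof (intro conjI impI allI; elim bexE conjE)
    fix \<Lambda> v assume L: "\<Lambda> \<subseteq> minimal_roots \<Delta> I" and v: "v \<in> chamber \<Delta>"
      and mn: "\<forall>\<beta>\<in>minimal_roots \<Delta> I. v \<bullet> \<beta> = 1" and mx: "\<forall>\<beta>\<in>maximal_roots \<Delta> (?P - I). v \<bullet> \<beta> < 1"
    show "region \<Phi> \<Delta> (I - \<Lambda>) \<noteq> {}"
    proof (rule region_nonempty[OF ctx v])
      show "I - \<Lambda> \<subseteq> ?P" using IP by blast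
      show "v \<bullet> \<beta> \<ge> 1" if "\<beta> \<in> I - \<Lambda>" for \<beta>
        by (rule up[OF v]) (use mn that in auto)
      show "v \<bullet> \<beta> \<le> 1" if "\<beta> \<in> ?P - (I - \<Lambda>)" for \<beta>
      proof (cases "\<beta> \<in> \<Lambda>")
        case True then show ?thesis using mn L by auto
      next
        case False
        show ?thesis by (rule down[OF v]) (use mx that False in \<open>auto simp: less_imp_le\<close>)
      qed
    qed
  next
    fix \<Lambda> v assume L: "\<Lambda> \<subseteq> maximal_roots \<Delta> (?P - I)" and v: "v \<in> chamber \<Delta>"
      and mx: "\<forall>\<beta>\<in>maximal_roots \<Delta> (?P - I). v \<bullet> \<beta> = 1" and mn: "\<forall>\<beta>\<in>minimal_roots \<Delta> I. v \<bullet> \<beta> > 1"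
    show "region \<Phi> \<Delta> (I \<union> \<Lambda>) \<noteq> {}"
    proof (rule region_nonempty[OF ctx v])
      show "I \<union> \<Lambda> \<subseteq> ?P" using IP L maxI by blast
      show "v \<bullet> \<beta> \<ge> 1" if "\<beta> \<in> I \<union> \<Lambda>" for \<beta>
      proof (cases "\<beta> \<in> \<Lambda>")
        case True then show ?thesis using mx L by auto
      next
        case False
        show ?thesis by (rule up[OF v]) (use mn that False in \<open>auto simp: less_imp_le\<close>)
      qed
      show "v \<bullet> \<beta> \<le> 1" if "\<beta> \<in> ?P - (I \<union> \<Lambda>)" for \<beta>
        by (rule down[OF v]) (use mx that in auto)
    qed
  qed
qed

end
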